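(* Assume that $q\ne\pm1$. Given any completely prime ideal $P\in\operatorname{spec}A$, there is a unique pair $(\boldsymbol r,\boldsymbol c)\in\boldsymbol{RC}$ such that $K_{\boldsymbol r,\boldsymbol c}\subseteq P$ and $P\cap D_{\boldsymbol r,\boldsymbol c}=\varnothing$. Thus, if $q$ is not a root of unity, $$\operatorname{spec}A=\bigsqcup_{(\boldsymbol r,\boldsymbol c)\in\boldsymbol{RC}}\operatorname{spec}_{\boldsymbol r,\boldsymbol c}A$$ (disjoint union).
   Context: Let $k$ be an arbitrary field, $n$ a positive integer, $q\in k^\times$. $A=\mathcal O_q(M_n(k))$ is the $k$-algebra with generators $X_{ij}$ ($1\le i,j\le n$) and relations $X_{ij}X_{lj}=qX_{lj}X_{ij}$ ($i<l$); $X_{ij}X_{im}=qX_{im}X_{ij}$ ($j<m$); $X_{ij}X_{lm}=X_{lm}X_{ij}$ ($i<l$, $j>m$); $X_{ij}X_{lm}-X_{lm}X_{ij}=(q-q^{-1})X_{im}X_{lj}$ ($i<l$, $j<m$). Quantum minors: for $I=\{i_1<\dots<i_s\}$, $J=\{j_1<\dots<j_s\}\subseteq\{1,\dots,n\}$, $[I\mid J]=\sum_{\sigma\in S_s}(-q)^{\ell(\sigma)}X_{i_1j_{\sigma(1)}}\cdots X_{i_sj_{\sigma(s)}}$, where $\ell(\sigma)$ is the number of inversions of $\sigma$; $[\varnothing\mid\varnothing]=1$. For index sets of the same size $I=\{i_1<\dots<i_s\}$, $I'=\{i'_1<\dots<i'_s\}$, write $I\le I'$ iff $i_m\le i'_m$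 for all $m$. $\boldsymbol{RC}$ is the set of pairs $(\boldsymbol r,\boldsymbol c)$ of strictly increasing sequences $\boldsymbol r=(r_1,\dots,r_t)$, $\boldsymbol c=(c_1,\dots,c_t)$ in $\{1,\dots,n\}$ of the same length $t$ ($0\le t\le n$). For such a pair, $K_{\boldsymbol r,\boldsymbol c}$ is the two-sided ideal of $A$ generated by all $[I\mid J]$ with $|I|>t$, all $[I\mid J]$ with $|I|=l\le t$ and $I\not\ge\{r_1,\dots,r_l\}$, and all $[I\mid J]$ with $|I|=l\le t$ and $J\not\ge\{c_1,\dots,c_l\}$. $D_{\boldsymbol r,\boldsymbol c}$ is the multiplicative subset of $A$ generated by the (commuting) elements $[r_1\cdots r_l\mid c_1\cdots c_l]$, $l=1,\dots,t$ (it is $\{1\}$ if $t=0$). $\operatorname{spec}_{\boldsymbol r,\boldsymbol c}A=\{P\in\operatorname{spec}A\mid K_{\boldsymbol r,\boldsymbol c}\subseteq P,\ P\cap D_{\boldsymbol r,\boldsymbol c}=\varnothing\}$. $\operatorname{spec}A$ is the set of prime ideals of $A$. An ideal $P$ is completely prime if $A/P$ is a domain (nonzero, no zero divisors). *)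

theory Defs
  imports
    "HOL-Algebra.QuotRing"
    "HOL-Algebra.Ideal_Product"
    "HOL-Combinatorics.Permutations"
    "HOL-Library.Poly_Mapping"
    "HOL-Library.Disjoint_Sets"
begin

section \<open>Free algebras\<close>

text \<open>
  The multiplication of \<^typ>\<open>'m \<Rightarrow>\<^sub>0 'k\<close> is convolution with respect to the additively written
  monoid \<^typ>\<open>'m\<close>.  Lists are wrapped so that concatenation can be that addition without
  instantiating the class on lists themselves.
\<close>

datatype 'a word = Word (letters: "'a list")

instantiation word :: (type) monoid_add
begin

definition zero_word :: "'a word" where
  "0 = Word []"

definition plus_word :: "'a word \<Rightarrow> 'a word \<Rightarrow> 'a word" where
  "u + v = Word (letters u @ letters v)"

instance
  by standard (simp_all add: zero_word_def plus_word_def)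

end

definition free_algebra :: "'a set \<Rightarrow> ('a word \<Rightarrow>\<^sub>0 'k::field) ring" where
  "free_algebra L =
     \<lparr>carrier = {p. \<forall>w\<in>Poly_Mapping.keys p. set (letters w) \<subseteq> L},
      monoid.mult = (*), one = 1, zero = 0, add = (+)\<rparr>"

definition fa_const :: "'k \<Rightarrow> ('a word \<Rightarrow>\<^sub>0 'k::field)" where
  "fa_const c = Poly_Mapping.single 0 c"

definition fa_gen :: "nat \<Rightarrow> nat \<Rightarrow> ((nat \<times> nat) word \<Rightarrow>\<^sub>0 'k::field)" where
  "fa_gen i j = Poly_Mapping.single (Word [(i, j)]) 1"

section \<open>The quantum matrix algebra\<close>

definition qmat_rels :: "nat \<Rightarrow> 'k::field \<Rightarrow> ((nat \<times> nat) word \<Rightarrow>\<^sub>0 'k) set" where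
  "qmat_rels n q =
     {fa_gen i j * fa_gen l j - fa_const q * (fa_gen l j * fa_gen i j) | i l j.
        i \<in> {1..n} \<and> l \<in> {1..n} \<and> j \<in> {1..n} \<and> i < l}
   \<union> {fa_gen i j * fa_gen i m - fa_const q * (fa_gen i m * fa_gen i j) | i j m.
        i \<in> {1..n} \<and> j \<in> {1..n} \<and> m \<in> {1..n} \<and> j < m}
   \<union> {fa_gen i j * fa_gen l m - fa_gen l m * fa_gen i j | i j l m.
        i \<in> {1..n} \<and> j \<in> {1..n} \<and> l \<in> {1..n} \<and> m \<in> {1..n} \<and> i < l \<and> j > m}
   \<union> {fa_gen i j * fa_gen l m - fa_gen l m * fa_gen i j - fa_const (q - inverse q) * (fa_gen i m * fa_gen l j) | i j l m.
        i \<in> {1..n} \<and> j \<in> {1..n} \<and> l \<in> {1..n} \<and> m \<in> {1..n} \<and> i < l \<and> j < m}"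

definition qmat_free :: "nat \<Rightarrow> 'k::field itself \<Rightarrow> ((nat \<times> nat) word \<Rightarrow>\<^sub>0 'k) ring" where
  "qmat_free n _ = free_algebra ({1..n} \<times> {1..n})"

definition qmat_ideal :: "nat \<Rightarrow> 'k::field \<Rightarrow> ((nat \<times> nat) word \<Rightarrow>\<^sub>0 'k) set" where
  "qmat_ideal n q = Idl\<^bsub>qmat_free n TYPE('k)\<^esub> (qmat_rels n q)"

definition qmat :: "nat \<Rightarrow> 'k::field \<Rightarrow> ((nat \<times> nat) word \<Rightarrow>\<^sub>0 'k) set ring" where
  "qmat n q = qmat_free n TYPE('k) Quot qmat_ideal n q"

definition qmat_proj ::
  "nat \<Rightarrow> 'k::field \<Rightarrow> ((nat \<times> nat) word \<Rightarrow>\<^sub>0 'k) \<Rightarrow> ((nat \<times> nat) word \<Rightarrow>\<^sub>0 'k) set" where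
  "qmat_proj n q p = qmat_ideal n q +>\<^bsub>qmat_free n TYPE('k)\<^esub> p"

definition qX :: "nat \<Rightarrow> 'k::field \<Rightarrow> nat \<Rightarrow> nat \<Rightarrow> ((nat \<times> nat) word \<Rightarrow>\<^sub>0 'k) set" where
  "qX n q i j = qmat_proj n q (fa_gen i j)"

section \<open>Quantum minors\<close>

definition num_inversions :: "nat \<Rightarrow> (nat \<Rightarrow> nat) \<Rightarrow> nat" where
  "num_inversions s \<sigma> = card {(a, b). a < b \<and> b < s \<and> \<sigma> a > \<sigma> b}"

text \<open>
  The factors do not commute: \<^const>\<open>foldr\<close> multiplies them in increasing order of the row
  index.  Positions inside an index set are counted from 0.
\<close>

definition qminor ::
  "nat \<Rightarrow> 'k::field \<Rightarrow> nat set \<Rightarrow> nat set \<Rightarrow> ((nat \<times> nat) word \<Rightarrow>\<^sub>0 'k) set" where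
  "qminor n q I J =
     (\<Oplus>\<^bsub>qmat n q\<^esub>\<sigma>\<in>{\<sigma>. \<sigma> permutes {..<card I}}.
        qmat_proj n q (fa_const ((- q) ^ num_inversions (card I) \<sigma>)) \<otimes>\<^bsub>qmat n q\<^esub>
        foldr (\<lambda>a y. qX n q (sorted_list_of_set I ! a) (sorted_list_of_set J ! \<sigma> a) \<otimes>\<^bsub>qmat n q\<^esub> y)
          [0..<card I] \<one>\<^bsub>qmat n q\<^esub>)"

definition index_le :: "nat set \<Rightarrow> nat set \<Rightarrow> bool" where
  "index_le I I' \<longleftrightarrow> card I = card I' \<and>
     (\<forall>m<card I. sorted_list_of_set I ! m \<le> sorted_list_of_set I' ! m)"

section \<open>Prime and completely prime ideals\<close>

text \<open>
  The library's \<^locale>\<open>primeideal\<close> and \<^locale>\<open>domain\<close> require commutativity.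
\<close>

definition prime_ideal :: "'a set \<Rightarrow> ('a, 'b) ring_scheme \<Rightarrow> bool" where
  "prime_ideal P R \<longleftrightarrow> ideal P R \<and> P \<noteq> carrier R \<and>
     (\<forall>I J. ideal I R \<longrightarrow> ideal J R \<longrightarrow> I \<cdot>\<^bsub>R\<^esub> J \<subseteq> P \<longrightarrow> I \<subseteq> P \<or> J \<subseteq> P)"

definition ring_spec :: "('a, 'b) ring_scheme \<Rightarrow> 'a set set" where
  "ring_spec R = {P. prime_ideal P R}"

definition nc_domain :: "('a, 'b) ring_scheme \<Rightarrow> bool" where
  "nc_domain R \<longleftrightarrow> ring R \<and> \<one>\<^bsub>R\<^esub> \<noteq> \<zero>\<^bsub>R\<^esub> \<and>
     (\<forall>a\<in>carrier R. \<forall>b\<in>carrier R. a \<otimes>\<^bsub>R\<^esub> b = \<zero>\<^bsub>R\<^esub> \<longrightarrow> a = \<zero>\<^bsub>R\<^esub> \<or> b = \<zero>\<^bsub>R\<^esub>)"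

definition completely_prime :: "'a set \<Rightarrow> ('a, 'b) ring_scheme \<Rightarrow> bool" where
  "completely_prime P R \<longleftrightarrow> ideal P R \<and> nc_domain (R Quot P)"

section \<open>The partition of the spectrum\<close>

definition RC :: "nat \<Rightarrow> (nat list \<times> nat list) set" where
  "RC n = {(r, c). sorted_wrt (<) r \<and> sorted_wrt (<) c \<and>
     set r \<subseteq> {1..n} \<and> set c \<subseteq> {1..n} \<and> length r = length c}"

definition K_ideal ::
  "nat \<Rightarrow> 'k::field \<Rightarrow> nat list \<Rightarrow> nat list \<Rightarrow> ((nat \<times> nat) word \<Rightarrow>\<^sub>0 'k) set set" where
  "K_ideal n q r c = Idl\<^bsub>qmat n q\<^esub>
     {qminor n q I J | I J. I \<subseteq> {1..n} \<and> J \<subseteq> {1..n} \<and> card I = card J \<and>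
        (card I > length r
         \<or> card I \<le> length r \<and> \<not> index_le (set (take (card I) r)) I
         \<or> card I \<le> length r \<and> \<not> index_le (set (take (card I) c)) J)}"

definition D_set ::
  "nat \<Rightarrow> 'k::field \<Rightarrow> nat list \<Rightarrow> nat list \<Rightarrow> ((nat \<times> nat) word \<Rightarrow>\<^sub>0 'k) set set" where
  "D_set n q r c = \<Inter>{S. submonoid S (qmat n q) \<and>
     {qminor n q (set (take l r)) (set (take l c)) | l. l \<in> {1..length r}} \<subseteq> S}"

definition spec_rc ::
  "nat \<Rightarrow> 'k::field \<Rightarrow> nat list \<Rightarrow> nat list \<Rightarrow> ((nat \<times> nat) word \<Rightarrow>\<^sub>0 'k) set set set" where
  "spec_rc n q r c =
     {P \<in> ring_spec (qmat n q). K_ideal n q r c \<subseteq> P \<and> P \<inter> D_set n q r c = {}}"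

end

theory Submission
  imports Defs "HOL-Combinatorics.Multiset_Permutations"
begin

text \<open>
  The existence of a stratum is Gaussian elimination over \<open>B = A/P\<close>.  Let \<open>x\<close> be the matrix of the
  images of the generators, \<open>r\<close> its first nonzero row and \<open>c\<close> its first nonzero column.  If \<open>B\<close> is a
  domain, then the pivot \<open>a = x r c\<close> is nonzero, because
  \<open>a * x i j - x i j * a = (q - p) * (x r j * x i c)\<close> with \<open>p\<close> the inverse of \<open>q\<close>.  The Schur
  complement \<open>z i j = a * x i j - q * (x i c * x r j)\<close> is again a quantum matrix, and the minors of
  \<open>x\<close> are, up to powers of \<open>a\<close>, combinations of minors of \<open>z\<close>; so induction applies.

  If \<open>q\<close> is not a root of unity and \<open>P\<close> is merely prime, then the same elimination works because every
  pivot is left regular: the elements of \<open>B\<close> annihilated on the left by a power of \<open>a\<close> form a two-sided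
  ideal, which is annihilated by one power of \<open>a\<close> since \<open>B\<close> is right Noetherian.  If it is nonzero,
  then \<open>a\<close> is nilpotent; but if \<open>m\<close> is minimal with \<open>a ^ Suc m = 0\<close>, commuting \<open>a ^ Suc m\<close> with the
  entries of \<open>x\<close> gives \<open>x r j * x i c * a ^ m = 0\<close> for all \<open>i\<close> and \<open>j\<close>, whereas the right annihilators
  of row \<open>r\<close> and of column \<open>c\<close> are two-sided ideals and hence zero.
\<close>

section \<open>Quantum matrices and their Schur complements\<close>

text \<open>Powers of the pivots stand on the left of the minors, so cancellation from the left is
  what an elimination step needs. The obstacle in the prime case is that after one step the entries
  of the Schur complement no longer generate \<open>B\<close>, so testing on them does not show that
  a right ideal is two-sided. By \<open>a * x i j = z i j + q * (x i c * x r j)\<close> the lost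
  entries are recovered by cancelling \<open>a\<close>, provided that the ideal is also stable under
  the entries of the earlier pivot rows and columns; most of the prime case follows how these
  commute with later Schur complements. The conditions on \<open>q\<close> differ because a domain
  needs a single commutator, with coefficient \<open>q - p\<close>, whereas commuting
  \<open>a ^ Suc m\<close> sums a geometric series in \<open>q ^ 2\<close>, whose value has to be
  invertible for every \<open>m\<close>. Uniqueness rests on the order of index sets: the largest
  leading minor of one pair lies outside \<open>P\<close>, so it is not a generator of the ideal of
  the other pair, which bounds the other pair entrywise; by symmetry the two agree.\<close>

locale quantum_parameter =
  fixes q p :: "'b::ring_1"
  assumes q_central: "y * q = q * y"
    and p_central: "y * p = p * y"
    and q_p: "q * p = 1"
    and diff_unit: "\<exists>w. w * (q - p) = 1"
begin

lemma p_q: "p * q = 1"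
  using q_p q_central by metis

lemma q_left_commute: "y * (q * z) = q * (y * z)"
  by (metis mult.assoc q_central)

lemma p_left_commute: "y * (p * z) = p * (y * z)"
  by (metis mult.assoc p_central)

lemma q_p_cancel: "q * (p * y) = y" "p * (q * y) = y"
  by (metis mult.assoc mult_1_left q_p, metis mult.assoc mult_1_left p_q)

lemma diff_cancel: "(q - p) * y = 0 \<Longrightarrow> y = 0"
  by (metis diff_unit mult.assoc mult_1_left mult_zero_right)

end

text \<open>
  The indices range over all natural numbers: a matrix of finite size is extended by zeros, which
  satisfies the relations everywhere.
\<close>

locale quantum_matrix = quantum_parameter q p for q p :: "'b::ring_1" +
  fixes x :: "nat \<Rightarrow> nat \<Rightarrow> 'b"
  assumes col_rel: "i < l \<Longrightarrow> x i j * x l j = q * (x l j * x i j)"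
    and row_rel: "j < m \<Longrightarrow> x i j * x i m = q * (x i m * x i j)"
    and commute_rel: "i < l \<Longrightarrow> m < j \<Longrightarrow> x i j * x l m = x l m * x i j"
    and cross_rel: "i < l \<Longrightarrow> j < m \<Longrightarrow> x i j * x l m - x l m * x i j = (q - p) * (x i m * x l j)"
begin

text \<open>
  The factor 1 keeps the third rewrite rule from being treated as permutative, so that every
  monomial is brought into lexicographic order.
\<close>

lemma order_rules:
  shows "i < l \<Longrightarrow> x l j * x i j = p * (x i j * x l j)"
    and "j < m \<Longrightarrow> x i m * x i j = p * (x i j * x i m)"
    and "i < l \<Longrightarrow> j < m \<Longrightarrow> x l j * x i m = 1 * (x i m * x l j)"
    and "i < l \<Longrightarrow> j < m \<Longrightarrow> x l m * x i j = x i j * x l m - (q - p) * (x i m * x l j)"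
proof -
  show "i < l \<Longrightarrow> x l j * x i j = p * (x i j * x l j)" "j < m \<Longrightarrow> x i m * x i j = p * (x i j * x i m)"
    by (simp_all only: col_rel row_rel q_p_cancel)
  assume "i < l" "j < m"
  then show "x l j * x i m = 1 * (x i m * x l j)"
    by (simp only: commute_rel[of i l j m] mult_1_left)
  from \<open>i < l\<close> \<open>j < m\<close> show "x l m * x i j = x i j * x l m - (q - p) * (x i m * x l j)"
    by (simp only: cross_rel[symmetric] diff_diff_eq2 add_diff_cancel_left')
qed

lemma order_rules_assoc:
  shows "i < l \<Longrightarrow> x l j * (x i j * y) = p * (x i j * (x l j * y))"
    and "j < m \<Longrightarrow> x i m * (x i j * y) = p * (x i j * (x i m * y))"
    and "i < l \<Longrightarrow> j < m \<Longrightarrow> x l j * (x i m * y) = 1 * (x i m * (x l j * y))"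
    and "i < l \<Longrightarrow> j < m \<Longrightarrow> x l m * (x i j * y) = x i j * (x l m * y) - (q - p) * (x i m * (x l j * y))"
  by (simp_all only: mult.assoc[symmetric] order_rules left_diff_distrib mult_1_left)

lemma coeff_rules:
  "x i j * q = q * x i j" "x i j * (q * y) = q * (x i j * y)"
  "x i j * p = p * x i j" "x i j * (p * y) = p * (x i j * y)"
  "q * p = 1" "q * (p * y) = y" "p * q = 1" "p * (q * y) = y"
  by (rule q_central q_left_commute p_central p_left_commute q_p p_q q_p_cancel)+

text \<open>Within the quadrant this is the quantum minor on rows \<open>r\<close>, \<open>i\<close>
  and columns \<open>c\<close>, \<open>j\<close>, because \<open>x i c\<close> and
  \<open>x r j\<close> commute. The value 0 elsewhere extends it to all indices, so that elimination
  is iterated without renumbering.\<close>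

definition schur :: "nat \<Rightarrow> nat \<Rightarrow> nat \<Rightarrow> nat \<Rightarrow> 'b" where
  "schur r c i j = (if r < i \<and> c < j then x r c * x i j - q * (x i c * x r j) else 0)"

lemmas normal_order = coeff_rules order_rules order_rules_assoc algebra_simps

text \<open>A 2 by 2 quantum minor is central in the algebra generated by its four entries.\<close>

lemma schur_commute_pivot: "x r c * schur r c i j = schur r c i j * x r c"
  by (cases "c < j"; cases "r < i") (simp_all add: schur_def normal_order)

lemma schur_commute_col:
  "r < i \<Longrightarrow> i < l \<Longrightarrow> x l c * schur r c i j = p * (schur r c i j * x l c)"
  by (cases "c < j") (simp_all add: schur_def normal_order)

lemma schur_commute_col_same: "r < i \<Longrightarrow> x i c * schur r c i j = schur r c i j * x i c"
  by (cases "c < j") (simp_all add: schur_def normal_order)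

text \<open>The correction term mixes two rows. Hence the entries of the pivot column do not
  skew-commute with the Schur complement one by one; the column as a whole satisfies closed
  relations, which \<open>column_family\<close> axiomatises.\<close>

lemma schur_commute_col_above:
  "r < l \<Longrightarrow> l < i \<Longrightarrow>
    x l c * schur r c i j = p * (schur r c i j * x l c + (q - p) * (schur r c l j * x i c))"
  by (cases "c < j") (simp_all add: schur_def normal_order)

lemma schur_col_rel: "i < l \<Longrightarrow> schur r c i j * schur r c l j = q * (schur r c l j * schur r c i j)"
  by (cases "c < j"; cases "r < i") (simp_all add: schur_def normal_order)

lemma schur_row_rel: "j < m \<Longrightarrow> schur r c i j * schur r c i m = q * (schur r c i m * schur r c i j)"
  by (cases "c < j"; cases "r < i") (simp_all add: schur_def normal_order)

lemma schur_commute_rel: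
  "i < l \<Longrightarrow> m < j \<Longrightarrow> schur r c i j * schur r c l m = schur r c l m * schur r c i j"
  by (cases "c < m"; cases "r < i") (simp_all add: schur_def normal_order)

lemma schur_cross_rel:
  "i < l \<Longrightarrow> j < m \<Longrightarrow> schur r c i j * schur r c l m - schur r c l m * schur r c i j
     = (q - p) * (schur r c i m * schur r c l j)"
  by (cases "c < j"; cases "r < i") (simp_all add: schur_def normal_order)

lemma quantum_matrix_schur: "quantum_matrix q p (schur r c)"
  by unfold_locales
    (erule (1) schur_col_rel schur_row_rel schur_commute_rel schur_cross_rel | erule schur_col_rel schur_row_rel)+

end

section \<open>Quantum minors by expansion\<close>

context quantum_parameter
begin

text \<open>
  An element of the quantum exterior algebra over \<^typ>\<open>'b\<close> is given by its coefficients at the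
  monomials \<open>e\<^sub>J\<close>.  Then \<open>lmul v\<close> and \<open>\<lambda>f. rmul f v\<close> are the multiplications by the sum of
  \<open>v j e\<^sub>j\<close> from the left and from the right, and \<open>qdet x is J\<close> is the coefficient at \<open>e\<^sub>J\<close>
  of the product of the rows \<open>is\<close> of \<open>x\<close>.
\<close>

definition lmul :: "(nat \<Rightarrow> 'b) \<Rightarrow> (nat set \<Rightarrow> 'b) \<Rightarrow> nat set \<Rightarrow> 'b" where
  "lmul v f J = (\<Sum>j\<in>J. (- q) ^ card {m \<in> J. m < j} * (v j * f (J - {j})))"

definition rmul :: "(nat set \<Rightarrow> 'b) \<Rightarrow> (nat \<Rightarrow> 'b) \<Rightarrow> nat set \<Rightarrow> 'b" where
  "rmul f v J = (\<Sum>j\<in>J. (- q) ^ card {m \<in> J. j < m} * (f (J - {j}) * v j))"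

definition ext_one :: "nat set \<Rightarrow> 'b" where
  "ext_one J = (if J = {} then 1 else 0)"

definition lmuls :: "(nat \<Rightarrow> nat \<Rightarrow> 'b) \<Rightarrow> nat list \<Rightarrow> (nat set \<Rightarrow> 'b) \<Rightarrow> nat set \<Rightarrow> 'b" where
  "lmuls x is f = foldr (\<lambda>i. lmul (x i)) is f"

definition qdet :: "(nat \<Rightarrow> nat \<Rightarrow> 'b) \<Rightarrow> nat list \<Rightarrow> nat set \<Rightarrow> 'b" where
  "qdet x is = lmuls x is ext_one"

lemma lmuls_simps [simp]:
  "lmuls x [] f = f" "lmuls x (i # is) f = lmul (x i) (lmuls x is f)"
  "lmuls x (is @ js) f = lmuls x is (lmuls x js f)"
  by (simp_all add: lmuls_def)

lemma qdet_simps [simp]: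
  "qdet x [] = ext_one" "qdet x (i # is) = lmul (x i) (qdet x is)"
  "qdet x (is @ js) = lmuls x is (qdet x js)"
  by (simp_all add: qdet_def)

lemma neg_q_power_central: "y * (- q) ^ n = (- q) ^ n * y"
  by (rule power_commuting_commutes[symmetric]) (simp add: q_central)

lemma neg_q_power_left_commute: "y * ((- q) ^ n * z) = (- q) ^ n * (y * z)"
  by (metis mult.assoc neg_q_power_central)

lemma neg_p_power_central: "y * (- p) ^ n = (- p) ^ n * y"
  by (rule power_commuting_commutes[symmetric]) (simp add: p_central)

lemma q_power_central: "y * q ^ n = q ^ n * y"
  by (rule power_commuting_commutes[symmetric]) (simp add: q_central)

lemma neg_p_power_left_commute: "y * ((- p) ^ n * z) = (- p) ^ n * (y * z)"
  by (metis mult.assoc neg_p_power_central)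

lemma q_power_left_commute: "y * (q ^ n * z) = q ^ n * (y * z)"
  by (metis mult.assoc q_power_central)

lemma neg_power_q_p: "(- q) ^ n * (- p) ^ n = 1" "(- p) ^ n * (- q) ^ n = 1"
proof -
  have "(- q) ^ n * (- p) ^ n = (q * p) ^ n" for n :: nat
  proof (induction n)
    case (Suc n)
    have "(- q) ^ Suc n * (- p) ^ Suc n = - q * ((- q) ^ n * (- p) ^ n) * (- p)"
      by (subst power_Suc, subst power_Suc2) (simp only: mult.assoc)
    then show ?case
      using Suc by (simp add: q_p)
  qed simp
  then show "(- q) ^ n * (- p) ^ n = 1" by (simp add: q_p)
  then show "(- p) ^ n * (- q) ^ n = 1" by (simp add: neg_q_power_central)
qed

lemma central_mult:
  fixes s t y :: 'b
  assumes s: "\<And>y. y * s = s * y" and t: "\<And>y. y * t = t * y"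
  shows "y * (s * t) = s * t * y"
  by (metis mult.assoc s t)

lemma lmul_cong: "(\<And>j. j \<in> J \<Longrightarrow> f (J - {j}) = g (J - {j})) \<Longrightarrow> lmul v f J = lmul v g J"
  unfolding lmul_def by simp

lemma lmul_add: "lmul v (\<lambda>J. f J + g J) J = lmul v f J + lmul v g J"
  unfolding lmul_def by (simp add: distrib_left sum.distrib)

lemma lmul_sum: "lmul v (\<lambda>J. \<Sum>i\<in>S. f i J) J = (\<Sum>i\<in>S. lmul v (f i) J)"
  unfolding lmul_def by (simp add: sum_distrib_left) (rule sum.swap)

text \<open>The factors \<open>s\<close> and \<open>t\<close> may differ, so that coefficients can
  be extracted that merely \<open>q\<close>-commute with the row, as the pivot column does with the
  rows of the Schur complement in \<open>pivot_qdet\<close>.\<close>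

lemma lmul_scale:
  assumes "\<And>j. v j * t = s * v j"
  shows "lmul v (\<lambda>J. t * f J) J = s * lmul v f J"
proof -
  have "v j * (t * y) = s * (v j * y)" for j y
    by (metis assms mult.assoc)
  then show ?thesis
    unfolding lmul_def by (simp add: sum_distrib_left neg_q_power_left_commute[of s])
qed

lemma card_less_Diff:
  fixes J :: "nat set"
  assumes "finite J" "j \<in> J"
  shows "card {k \<in> J. k < m} = card {k \<in> J - {j}. k < m} + (if j < m then 1 else 0)"
    and "card {k \<in> J. m < k} = card {k \<in> J - {j}. m < k} + (if m < j then 1 else 0)"
proof -
  have "{k \<in> J. k < m} = (if j < m then insert j {k \<in> J - {j}. k < m} else {k \<in> J - {j}. k < m})"
    "{k \<in> J. m < k} = (if m < j then insert j {k \<in> J - {j}. m < k} else {k \<in> J - {j}. m < k})"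
    using assms by auto
  then show "card {k \<in> J. k < m} = card {k \<in> J - {j}. k < m} + (if j < m then 1 else 0)"
    "card {k \<in> J. m < k} = card {k \<in> J - {j}. m < k} + (if m < j then 1 else 0)"
    using assms by auto
qed

text \<open>Each pair of columns \<open>j < m\<close> is met in both orders, and the order
  \<open>m\<close>, \<open>j\<close> carries one more factor \<open>- q\<close>. The two terms
  therefore combine to a 2 by 2 expression in \<open>u\<close> and \<open>v\<close>, to which the
  relations between rows apply.\<close>

lemma lmul_lmul:
  assumes J: "finite J"
  shows "lmul u (lmul v f) J =
    (\<Sum>(j, m)\<in>{(j, m). j \<in> J \<and> m \<in> J \<and> j < m}.
       (- q) ^ (card {k \<in> J. k < j} + card {k \<in> J - {j}. k < m}) *
         ((u j * v m - q * (u m * v j)) * f (J - {j, m})))"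
proof -
  define N where "N j = card {k \<in> J. k < j}" for j
  define M where "M j m = card {k \<in> J - {j}. k < m}" for j m
  define t where "t j m = (- q) ^ (N j + M j m) * (u j * v m * f (J - {j, m}))" for j m
  let ?A = "{(j, m). j \<in> J \<and> m \<in> J \<and> j < m}"
  let ?B = "{(j, m). j \<in> J \<and> m \<in> J \<and> m < j}"
  have fin: "finite ?A" "finite ?B"
    using J by (auto intro: finite_subset[of _ "J \<times> J"])
  have "lmul u (lmul v f) J = (\<Sum>j\<in>J. \<Sum>m\<in>J - {j}. t j m)"
    unfolding lmul_def t_def N_def M_def
    by (simp add: sum_distrib_left neg_q_power_left_commute[of "u j" for j] power_add mult.assoc Diff_insert2[symmetric])
  also have "\<dots> = (\<Sum>(j, m)\<in>Sigma J (\<lambda>j. J - {j}). t j m)"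
    using J by (simp add: sum.Sigma)
  also have "Sigma J (\<lambda>j. J - {j}) = ?A \<union> ?B"
    by auto
  also have "(\<Sum>(j, m)\<in>?A \<union> ?B. t j m) = (\<Sum>(j, m)\<in>?A. t j m) + (\<Sum>(j, m)\<in>?B. t j m)"
    by (rule sum.union_disjoint) (use fin in auto)
  also have "(\<Sum>(j, m)\<in>?B. t j m) = (\<Sum>(j, m)\<in>?A. t m j)"
    by (rule sum.reindex_bij_witness[of _ prod.swap prod.swap]) auto
  also have "(\<Sum>(j, m)\<in>?A. t j m) + (\<Sum>(j, m)\<in>?A. t m j) =
      (\<Sum>(j, m)\<in>?A. (- q) ^ (N j + M j m) * ((u j * v m - q * (u m * v j)) * f (J - {j, m})))"
    unfolding sum.distrib[symmetric]
  proof (rule sum.cong[OF refl], clarify)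
    fix j m assume jm: "j \<in> J" "m \<in> J" "j < m"
    \<comment> \<open>Deleting \<open>j\<close> lowers the number of columns below \<open>m\<close>
      by one, while deleting \<open>m\<close> leaves the number below \<open>j\<close>
      unchanged.\<close>
    have "N m = Suc (M j m)" "N j = M m j"
      unfolding N_def M_def using card_less_Diff(1)[OF J jm(1), of m] card_less_Diff(1)[OF J jm(2), of j] jm
      by simp_all
    then have "N m + M m j = Suc (N j + M j m)"
      by simp
    then have "t m j = (- q) ^ (N j + M j m) * (- q * (u m * v j * f (J - {j, m})))"
      unfolding t_def by (simp add: power_Suc2 mult.assoc insert_commute del: power_Suc)
    then show "t j m + t m j =
        (- q) ^ (N j + M j m) * ((u j * v m - q * (u m * v j)) * f (J - {j, m}))"
      unfolding t_def by (simp add: algebra_simps)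
  qed
  finally show ?thesis
    unfolding N_def M_def .
qed

lemma lmul_infinite: "infinite J \<Longrightarrow> lmul v f J = 0"
  by (simp add: lmul_def)

text \<open>Associativity of the exterior algebra. Both sides are sums over ordered pairs of
  distinct columns, \<open>j\<close> taken from \<open>u\<close> and \<open>m\<close> from
  \<open>v\<close>; the exponents agree because deleting \<open>j\<close> lowers the count above
  \<open>m\<close>, and deleting \<open>m\<close> the count below \<open>j\<close>, under the same
  condition \<open>m < j\<close>.\<close>

lemma lmul_rmul: "lmul u (rmul f v) J = rmul (lmul u f) v J"
proof (cases "finite J")
  case J: True
  have "lmul u (rmul f v) J = (\<Sum>j\<in>J. \<Sum>m\<in>J - {j}.
      (- q) ^ (card {k \<in> J. k < j} + card {k \<in> J - {j}. m < k}) * (u j * (f (J - {j, m}) * v m)))"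
    unfolding lmul_def rmul_def
    by (simp add: sum_distrib_left neg_q_power_left_commute[of "u j" for j] power_add mult.assoc Diff_insert2[symmetric])
  also have "\<dots> = (\<Sum>j\<in>J. \<Sum>m\<in>J - {j}.
      (- q) ^ (card {k \<in> J. m < k} + card {k \<in> J - {m}. k < j}) * (u j * (f (J - {j, m}) * v m)))"
  proof (intro sum.cong refl)
    fix j m assume jm: "j \<in> J" "m \<in> J - {j}"
    then have "card {k \<in> J. k < j} + card {k \<in> J - {j}. m < k} =
        card {k \<in> J. m < k} + card {k \<in> J - {m}. k < j}"
      using card_less_Diff(1)[OF J, of m j] card_less_Diff(2)[OF J, of j m] by auto
    then show "(- q) ^ (card {k \<in> J. k < j} + card {k \<in> J - {j}. m < k}) * (u j * (f (J - {j, m}) * v m)) =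
        (- q) ^ (card {k \<in> J. m < k} + card {k \<in> J - {m}. k < j}) * (u j * (f (J - {j, m}) * v m))"
      by simp
  qed
  also have "\<dots> = (\<Sum>m\<in>J. \<Sum>j\<in>J - {m}.
      (- q) ^ (card {k \<in> J. m < k} + card {k \<in> J - {m}. k < j}) * (u j * (f (J - {j, m}) * v m)))"
    using J by (simp add: sum.Sigma) (rule sum.reindex_bij_witness[of _ prod.swap prod.swap]; auto)
  also have "\<dots> = rmul (lmul u f) v J"
    unfolding lmul_def rmul_def
    by (simp add: sum_distrib_left sum_distrib_right power_add mult.assoc Diff_insert2[symmetric] insert_commute)
  finally show ?thesis .
qed (simp add: lmul_def rmul_def)

lemma lmul_ext_one: "lmul v ext_one J = rmul ext_one v J"
  unfolding lmul_def rmul_def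
proof (rule sum.cong[OF refl])
  fix j assume "j \<in> J"
  show "(- q) ^ card {m \<in> J. m < j} * (v j * ext_one (J - {j})) =
      (- q) ^ card {m \<in> J. j < m} * (ext_one (J - {j}) * v j)"
  proof (cases "J = {j}")
    case True
    then have "card {m \<in> J. m < j} = 0" "card {m \<in> J. j < m} = 0" by auto
    then show ?thesis unfolding True by (simp only: ext_one_def power_0) simp
  next
    case False
    then have "J - {j} \<noteq> {}" using \<open>j \<in> J\<close> by auto
    then show ?thesis by (simp add: ext_one_def)
  qed
qed

lemma qdet_zero_row: "i \<in> set is \<Longrightarrow> (\<And>j. x i j = 0) \<Longrightarrow> qdet x is J = 0"
  by (induction "is" arbitrary: J) (auto simp: lmul_def)

lemma qdet_zero_col: "j \<in> J \<Longrightarrow> (\<And>i. x i j = 0) \<Longrightarrow> qdet x is J = 0"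
proof (induction "is" arbitrary: J)
  case (Cons i "is")
  have "(- q) ^ card {m \<in> J. m < k} * (x i k * qdet x is (J - {k})) = 0" if "k \<in> J" for k
    using Cons by (cases "k = j") auto
  then show ?case by (simp add: lmul_def)
qed (auto simp: ext_one_def)

end

section \<open>Repeated and exchanged rows\<close>

context quantum_matrix
begin

text \<open>With equal rows the 2 by 2 expressions of \<open>lmul_lmul\<close> are
  \<open>x i j * x i m - q * (x i m * x i j)\<close>, which vanish by
  \<open>row_rel\<close>.\<close>

lemma lmul_square: "lmul (x i) (lmul (x i) f) J = 0"
proof (cases "finite J")
  case True
  show ?thesis
    unfolding lmul_lmul[OF True]
    by (rule sum.neutral) (auto simp: row_rel)
qed (rule lmul_infinite)

text \<open>By \<open>lmul_lmul\<close> it suffices to compare 2 by 2 minors; the one with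
  increasing rows is \<open>- p\<close> times the one with the rows exchanged.\<close>

lemma lmul_swap:
  assumes "r < i"
  shows "lmul (x r) (lmul (x i) f) J = - p * lmul (x i) (lmul (x r) f) J"
proof (cases "finite J")
  case True
  have "x r j * x i m - q * (x r m * x i j) = - p * (x i j * x r m - q * (x i m * x r j))"
    if "j < m" for j m
    using assms that by (simp add: order_rules coeff_rules algebra_simps)
  then show ?thesis
    unfolding lmul_lmul[OF True] sum_distrib_left
    by (intro sum.cong refl)
      (clarsimp simp: mult.assoc neg_q_power_left_commute[of p])
qed (simp add: lmul_infinite)

lemma lmul_lmuls:
  assumes "set is \<subseteq> {r<..}"
  shows "lmul (x r) (lmuls x is f) J = (- p) ^ length is * lmuls x is (lmul (x r) f) J"
  using assms
proof (induction "is" arbitrary: J)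
  case (Cons i "is")
  have "lmul (x r) (lmuls x (i # is) f) J = - p * lmul (x i) (lmul (x r) (lmuls x is f)) J"
    using Cons.prems by (simp add: lmul_swap)
  also have "lmul (x i) (lmul (x r) (lmuls x is f)) J =
      lmul (x i) (\<lambda>J. (- p) ^ length is * lmuls x is (lmul (x r) f) J) J"
    using Cons by (intro lmul_cong) simp
  also have "\<dots> = (- p) ^ length is * lmul (x i) (lmuls x is (lmul (x r) f)) J"
    by (rule lmul_scale) (rule neg_p_power_central)
  finally show ?case by (simp add: mult.assoc)
qed simp

end

section \<open>Minors of a matrix and of its Schur complement\<close>

locale pivoted = quantum_matrix q p x for q p :: "'b::ring_1" and x +
  fixes r c :: nat
  assumes row_zero: "i < r \<Longrightarrow> x i j = 0"
    and col_zero: "j < c \<Longrightarrow> x i j = 0"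
begin

abbreviation "a \<equiv> x r c"
abbreviation "z \<equiv> schur r c"

text \<open>Valid for \<open>j \<le> c\<close> as well, where \<open>z i j\<close> is zero: for
  \<open>j = c\<close> it is the column relation, and for \<open>j < c\<close> all terms vanish.
  Hence it applies to every term of a row expansion.\<close>

lemma pivot_mult: "r < i \<Longrightarrow> a * x i j = z i j + q * (x i c * x r j)"
  by (cases j c rule: linorder_cases) (simp_all add: schur_def col_zero col_rel)

lemma pivot_lmul:
  assumes "r < i"
  shows "a * lmul (x i) f J = lmul (z i) f J + q * (x i c * lmul (x r) f J)"
  unfolding lmul_def sum_distrib_left sum.distrib[symmetric]
proof (rule sum.cong[OF refl])
  fix j
  have "a * (x i j * f (J - {j})) = z i j * f (J - {j}) + q * (x i c * (x r j * f (J - {j})))"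
    using pivot_mult[OF assms, of j] by (simp add: mult.assoc[symmetric] distrib_right)
  then show "a * ((- q) ^ card {m \<in> J. m < j} * (x i j * f (J - {j}))) =
      (- q) ^ card {m \<in> J. m < j} * (z i j * f (J - {j})) +
      q * (x i c * ((- q) ^ card {m \<in> J. m < j} * (x r j * f (J - {j}))))"
    by (simp add: neg_q_power_left_commute[of q] neg_q_power_left_commute[of a]
        neg_q_power_left_commute[of "x i c"] distrib_left)
qed

lemma pivot_power_commute: "z i j * a ^ n = a ^ n * z i j"
  by (rule power_commuting_commutes[symmetric]) (simp add: schur_commute_pivot)

lemma lmul_repeated: "set is \<subseteq> {r<..} \<Longrightarrow> lmul (x r) (qdet x (is @ [r])) J = 0"
proof -
  assume "set is \<subseteq> {r<..}"
  then have "lmul (x r) (qdet x (is @ [r])) J =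
      (- p) ^ length is * lmuls x is (lmul (x r) (lmul (x r) ext_one)) J"
    by (simp add: lmul_lmuls)
  also have "lmul (x r) (lmul (x r) ext_one) = (\<lambda>_. 0)"
    by (simp add: lmul_square fun_eq_iff)
  also have "lmuls x is (\<lambda>_. 0) J = 0"
    by (induction "is" arbitrary: J) (simp_all add: lmul_def)
  finally show ?thesis by simp
qed

text \<open>Row \<open>r\<close> is put last so that every correction term of
  \<open>pivot_lmul\<close> contains this row twice and vanishes by \<open>lmul_repeated\<close>.
  Each factor \<open>a\<close> thus turns one row of \<open>x\<close> into a row of
  \<open>z\<close>, and the final row \<open>r\<close> becomes a multiplication from the
  right.\<close>

lemma pivot_qdet_append:
  assumes "set is \<subseteq> {r<..}"
  shows "a ^ length is * qdet x (is @ [r]) J = rmul (qdet z is) (x r) J"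
  using assms
proof (induction "is" arbitrary: J)
  case (Cons i "is")
  then have i: "r < i" and "is": "set is \<subseteq> {r<..}" by auto
  have "a ^ length (i # is) * qdet x ((i # is) @ [r]) J =
      a ^ length is * (a * lmul (x i) (qdet x (is @ [r])) J)"
    by (simp add: power_Suc2 mult.assoc del: power_Suc)
  also have "\<dots> = a ^ length is * lmul (z i) (qdet x (is @ [r])) J"
    using lmul_repeated[OF "is", of J] by (simp add: pivot_lmul[OF i])
  also have "\<dots> = lmul (z i) (\<lambda>J. a ^ length is * qdet x (is @ [r]) J) J"
    by (rule lmul_scale[symmetric]) (rule pivot_power_commute)
  also have "\<dots> = lmul (z i) (rmul (qdet z is) (x r)) J"
    using Cons.IH "is" by (intro lmul_cong) simp
  finally show ?case by (simp add: lmul_rmul)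
qed (simp add: lmul_ext_one)

lemma pivot_qdet_Cons:
  assumes "set is \<subseteq> {r<..}"
  shows "a ^ length is * qdet x (r # is) J = (- p) ^ length is * rmul (qdet z is) (x r) J"
proof -
  have "qdet x (r # is) J = (- p) ^ length is * qdet x (is @ [r]) J"
    using lmul_lmuls[OF assms, of ext_one J] by (simp add: qdet_def)
  then have "a ^ length is * qdet x (r # is) J = (- p) ^ length is * (a ^ length is * qdet x (is @ [r]) J)"
    by (simp only: neg_p_power_left_commute[of "a ^ length is"])
  then show ?thesis
    by (simp only: pivot_qdet_append[OF assms])
qed

lemma pivot_power_col:
  assumes "r < i"
  shows "a ^ n * x i c = q ^ n * (x i c * a ^ n)"
proof (induction n)
  case (Suc n)
  have "a ^ Suc n * x i c = a * (a ^ n * x i c)" by (simp add: mult.assoc)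
  also have "\<dots> = q ^ n * (a * x i c * a ^ n)"
    by (simp only: Suc q_power_left_commute[of a] mult.assoc)
  also have "a * x i c = q * (x i c * a)"
    using assms by (rule col_rel)
  finally show ?case
    by (simp only: mult.assoc power_Suc2[of q] power_Suc[of a])
qed simp

text \<open>Each factor \<open>a\<close> turns a row \<open>i\<close> into \<open>z i\<close> plus a
  multiple of row \<open>r\<close> by \<open>x i c\<close>. Since row \<open>r\<close> can occur
  only once, the sum runs over the single index that it replaces. Centrality of the coefficients is
  carried along because the induction moves the entries of \<open>z\<close> past them.\<close>

lemma pivot_qdet:
  assumes "sorted_wrt (<) is" "set is \<subseteq> {r<..}"
  shows "\<exists>u. (\<forall>i y. y * u i = u i * y) \<and> (\<forall>J. a ^ length is * qdet x is J =
    qdet z is J + (\<Sum>i\<in>set is. u i * (x i c * rmul (qdet z (remove1 i is)) (x r) J)))"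
  using assms
proof (induction "is")
  case (Cons i "is")
  then have i: "r < i" and "is": "set is \<subseteq> {r<..}" and ni: "\<And>l. l \<in> set is \<Longrightarrow> i < l" by auto
  from Cons obtain u where u: "\<And>i y. y * u i = u i * y" and
    IH: "\<And>J. a ^ length is * qdet x is J =
      qdet z is J + (\<Sum>i\<in>set is. u i * (x i c * rmul (qdet z (remove1 i is)) (x r) J))"
    by auto
  define n where "n = length is"
  have zx: "z i j * (u l * x l c) = q * (u l * x l c) * z i j" if "l \<in> set is" for j l
  proof -
    have "z i j * (u l * x l c) = u l * (z i j * x l c)"
      by (metis mult.assoc u)
    also have "z i j * x l c = q * (x l c * z i j)"
      using schur_commute_col[OF i ni[OF that]] by (simp only: q_p_cancel)
    finally show ?thesis
      by (simp only: q_left_commute[of "u l"] mult.assoc)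
  qed
  \<comment> \<open>For an old index, moving \<open>z i\<close> past \<open>x l c\<close>
    contributes a factor \<open>q\<close>. For the new index \<open>i\<close>, the factor
    \<open>q\<close> comes from \<open>pivot_lmul\<close>, \<open>q ^ n\<close> from moving
    \<open>a ^ n\<close> past \<open>x i c\<close>, and \<open>(- p) ^ n\<close> from
    \<open>pivot_qdet_Cons\<close>.\<close>
  define v where "v l = (if l = i then q ^ n * q * (- p) ^ n else q * u l)" for l
  have v: "y * v l = v l * y" for l y
  proof (cases "l = i")
    case True
    then show ?thesis
      unfolding v_def if_P[OF True] by (intro central_mult q_central q_power_central neg_p_power_central)
  next
    case False
    then show ?thesis
      unfolding v_def if_not_P[OF False] by (intro central_mult q_central u)
  qed
  have "a ^ length (i # is) * qdet x (i # is) J =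
      qdet z (i # is) J + (\<Sum>l\<in>set (i # is). v l * (x l c * rmul (qdet z (remove1 l (i # is))) (x r) J))" for J
  proof -
    have "a ^ length (i # is) * qdet x (i # is) J = a ^ n * (a * lmul (x i) (qdet x is) J)"
      by (simp add: n_def power_Suc2 mult.assoc del: power_Suc)
    also have "\<dots> = a ^ n * lmul (z i) (qdet x is) J + a ^ n * (q * (x i c * lmul (x r) (qdet x is) J))"
      by (simp add: pivot_lmul[OF i] distrib_left)
    also have "a ^ n * lmul (z i) (qdet x is) J = lmul (z i) (\<lambda>J. a ^ n * qdet x is J) J"
      by (rule lmul_scale[symmetric]) (rule pivot_power_commute)
    also have "\<dots> = lmul (z i) (qdet z is) J +
        (\<Sum>l\<in>set is. lmul (z i) (\<lambda>J. u l * x l c * rmul (qdet z (remove1 l is)) (x r) J) J)"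
      unfolding n_def IH lmul_add lmul_sum by (simp add: mult.assoc)
    also have "(\<Sum>l\<in>set is. lmul (z i) (\<lambda>J. u l * x l c * rmul (qdet z (remove1 l is)) (x r) J) J) =
        (\<Sum>l\<in>set is. v l * (x l c * rmul (qdet z (remove1 l (i # is))) (x r) J))"
    proof (rule sum.cong[OF refl])
      fix l assume l: "l \<in> set is"
      then have "l \<noteq> i" using ni by auto
      have "lmul (z i) (\<lambda>J. u l * x l c * rmul (qdet z (remove1 l is)) (x r) J) J =
          q * (u l * x l c) * lmul (z i) (rmul (qdet z (remove1 l is)) (x r)) J"
        using zx[OF l] by (rule lmul_scale)
      then show "lmul (z i) (\<lambda>J. u l * x l c * rmul (qdet z (remove1 l is)) (x r) J) J =
          v l * (x l c * rmul (qdet z (remove1 l (i # is))) (x r) J)"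
        using \<open>l \<noteq> i\<close> by (simp add: v_def lmul_rmul mult.assoc)
    qed
    also have "a ^ n * (q * (x i c * lmul (x r) (qdet x is) J)) =
        q ^ n * q * (x i c * (a ^ n * qdet x (r # is) J))"
    proof -
      have "a ^ n * (q * (x i c * lmul (x r) (qdet x is) J)) =
          q * (a ^ n * x i c * lmul (x r) (qdet x is) J)"
        by (simp only: q_left_commute[of "a ^ n"] mult.assoc)
      then show ?thesis
        by (simp only: pivot_power_col[OF i] mult.assoc q_power_left_commute[of q] qdet_simps)
    qed
    also have "\<dots> = v i * (x i c * rmul (qdet z is) (x r) J)"
    proof -
      have "x i c * ((- p) ^ n * y) = (- p) ^ n * (x i c * y)" for y
        by (rule neg_p_power_left_commute)
      then show ?thesis
        unfolding n_def pivot_qdet_Cons[OF "is"] by (simp only: v_def n_def mult.assoc if_True refl)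
    qed
    also have "lmul (z i) (qdet z is) J + (\<Sum>l\<in>set is. v l * (x l c * rmul (qdet z (remove1 l (i # is))) (x r) J)) +
        v i * (x i c * rmul (qdet z is) (x r) J) =
        qdet z (i # is) J + (\<Sum>l\<in>set (i # is). v l * (x l c * rmul (qdet z (remove1 l (i # is))) (x r) J))"
    proof -
      have "i \<notin> set is" using ni by auto
      then show ?thesis by (simp add: add.assoc add.commute)
    qed
    finally show ?thesis .
  qed
  then show ?case
    by (intro exI[of _ v] conjI allI v)
qed (auto intro!: exI[of _ "\<lambda>_. 1"])

end

section \<open>Echelon form\<close>

text \<open>One-sided, because the powers of the pivots are cancelled on the left of the minors. In
  a nontrivial ring it excludes 0, which keeps the leading minors out of \<open>P\<close>.\<close>

definition lreg :: "'b::ring_1 \<Rightarrow> bool" where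
  "lreg d \<longleftrightarrow> (\<forall>b. d * b = 0 \<longrightarrow> b = 0)"

lemma lregD: "lreg d \<Longrightarrow> d * b = 0 \<Longrightarrow> b = 0"
  unfolding lreg_def by blast

lemma lreg_one: "lreg 1"
  by (simp add: lreg_def)

lemma lreg_mult: "lreg d \<Longrightarrow> lreg e \<Longrightarrow> lreg (d * e)"
  unfolding lreg_def mult.assoc by blast

lemma lreg_power: "lreg d \<Longrightarrow> lreg (d ^ n)"
  by (induction n) (auto intro: lreg_one lreg_mult)

lemma lreg_nonzero: "lreg d \<Longrightarrow> d \<noteq> 0"
  unfolding lreg_def by (metis mult_1_right mult_zero_left zero_neq_one)

text \<open>If \<open>e * b = 0\<close>, then \<open>f * b = d * (e * b) = 0\<close>. So a minor is
  left regular as soon as some left multiple of it is.\<close>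

lemma lreg_left_factor:
  assumes "d * e = f" "lreg f"
  shows "lreg e"
  using assms unfolding lreg_def by (metis mult.assoc mult_zero_right)

text \<open>
  For index sets with at most \<open>length rs\<close> elements, some \<open>rs ! m\<close> has more than \<open>m\<close> elements of \<open>is\<close>
  below it if and only if the corresponding initial part of \<open>rs\<close> is not \<open>\<le>\<close> \<open>is\<close>.  Counting makes the
  effect of removing one index easy to control.
\<close>

definition exceeds :: "nat list \<Rightarrow> nat list \<Rightarrow> nat list \<Rightarrow> nat set \<Rightarrow> bool" where
  "exceeds rs cs is J \<longleftrightarrow> length is > length rs \<or>
     (\<exists>m<length rs. m < card {i \<in> set is. i < rs ! m} \<or> m < card {j \<in> J. j < cs ! m})"

lemma card_less_bound_Diff:
  fixes J :: "nat set"
  shows "card {j \<in> J. j < b} \<le> Suc (card {j \<in> J - {k}. j < b})"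
proof -
  have fin: "finite {j \<in> J - {k}. j < b}"
    by (rule finite_subset[of _ "{..<b}"]) auto
  have "card {j \<in> J. j < b} \<le> card (insert k {j \<in> J - {k}. j < b})"
    using fin by (intro card_mono) auto
  also have "\<dots> \<le> Suc (card {j \<in> J - {k}. j < b})"
    using fin by (simp add: card_insert_if)
  finally show ?thesis .
qed

text \<open>Dropping the first pivot lowers every threshold by one, and passing to
  \<open>is'\<close> and \<open>J'\<close> loses at most one index from each count. The threshold at
  position 0 is never violated, since no index lies below \<open>r\<close> or
  \<open>c\<close>.\<close>

lemma exceeds_tail:
  assumes "exceeds (r # rs) (c # cs) is J" "length rs = length cs" "set is \<subseteq> {r..}" "J \<subseteq> {c..}"
    and "length is \<le> Suc (length is')" "set is - {i} \<subseteq> set is'" "J - {j} \<subseteq> J'"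
  shows "exceeds rs cs is' J'"
  using assms(1) unfolding exceeds_def
proof (elim disjE exE conjE)
  assume "length (r # rs) < length is"
  then show "length rs < length is' \<or>
      (\<exists>m<length rs. m < card {i \<in> set is'. i < rs ! m} \<or> m < card {j \<in> J'. j < cs ! m})"
    using assms(5) by simp
next
  fix m assume m: "m < length (r # rs)" "m < card {i \<in> set is. i < (r # rs) ! m}"
  have "m \<noteq> 0"
  proof
    assume "m = 0"
    with m(2) have "{i \<in> set is. i < r} \<noteq> {}"
      by (metis card.empty less_nat_zero_code nth_Cons_0)
    with assms(3) show False by force
  qed
  then obtain k where k: "m = Suc k" "k < length rs"
    using m(1) by (cases m) auto
  have "card {l \<in> set is. l < rs ! k} \<le> Suc (card {l \<in> set is - {i}. l < rs ! k})"
    by (rule card_less_bound_Diff)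
  also have "card {l \<in> set is - {i}. l < rs ! k} \<le> card {l \<in> set is'. l < rs ! k}"
    using assms(6) by (intro card_mono) auto
  finally show "length rs < length is' \<or>
      (\<exists>m<length rs. m < card {i \<in> set is'. i < rs ! m} \<or> m < card {j \<in> J'. j < cs ! m})"
    using m k by auto
next
  fix m assume m: "m < length (r # rs)" "m < card {j \<in> J. j < (c # cs) ! m}"
  have "m \<noteq> 0"
  proof
    assume "m = 0"
    with m(2) have "{j \<in> J. j < c} \<noteq> {}"
      by (metis card.empty less_nat_zero_code nth_Cons_0)
    with assms(4) show False by force
  qed
  then obtain k where k: "m = Suc k" "k < length rs"
    using m(1) by (cases m) auto
  have "card {l \<in> J. l < cs ! k} \<le> Suc (card {l \<in> J - {j}. l < cs ! k})"
    by (rule card_less_bound_Diff)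
  also have "card {l \<in> J - {j}. l < cs ! k} \<le> card {l \<in> J'. l < cs ! k}"
    using assms(7) by (intro card_mono finite_subset[of "{l \<in> J'. l < cs ! k}" "{..<cs ! k}"]) auto
  finally show "length rs < length is' \<or>
      (\<exists>m<length rs. m < card {i \<in> set is'. i < rs ! m} \<or> m < card {j \<in> J'. j < cs ! m})"
    using m k by auto
qed

context quantum_parameter
begin

text \<open>The clauses about nonzero entries locate the pivots: for a matrix extended by zeros they
  force them into its index range, and for a Schur complement beyond \<open>r\<close> and
  \<open>c\<close>. The last two clauses become the conditions on \<open>D_set\<close> and on
  \<open>K_ideal\<close>.\<close>

definition echelon :: "(nat \<Rightarrow> nat \<Rightarrow> 'b) \<Rightarrow> nat list \<Rightarrow> nat list \<Rightarrow> bool" where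
  "echelon x rs cs \<longleftrightarrow> sorted_wrt (<) rs \<and> sorted_wrt (<) cs \<and> length rs = length cs \<and>
     (\<forall>i\<in>set rs. \<exists>j. x i j \<noteq> 0) \<and> (\<forall>j\<in>set cs. \<exists>i. x i j \<noteq> 0) \<and>
     (\<forall>l\<le>length rs. lreg (qdet x (take l rs) (set (take l cs)))) \<and>
     (\<forall>is J. sorted_wrt (<) is \<longrightarrow> exceeds rs cs is J \<longrightarrow> qdet x is J = 0)"

lemma echelon_zero: "(\<And>i j. x i j = 0) \<Longrightarrow> echelon x [] []"
proof -
  assume x: "\<And>i j. x i j = 0"
  have "qdet x is J = 0" if "is \<noteq> []" for "is" J
    using qdet_zero_row[of "hd is" "is" x J] that x by auto
  then show ?thesis
    by (auto simp: echelon_def exceeds_def lreg_one ext_one_def)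
qed

end

context pivoted
begin

lemma schur_support:
  assumes "z i j \<noteq> 0"
  shows "\<exists>j. x i j \<noteq> 0" "\<exists>i. x i j \<noteq> 0"
proof -
  have "x i j \<noteq> 0 \<or> x i c \<noteq> 0" "x i j \<noteq> 0 \<or> x r j \<noteq> 0"
    using assms unfolding schur_def by (metis diff_zero mult_zero_left mult_zero_right)+
  then show "\<exists>j. x i j \<noteq> 0" "\<exists>i. x i j \<noteq> 0" by blast+
qed

text \<open>A minor beyond the pivots of \<open>x\<close> is expressed by minors of \<open>z\<close>
  with at most one row and one column fewer, and \<open>exceeds_tail\<close> places these beyond the
  pivots of \<open>z\<close>. A leading minor reduces to one leading minor of \<open>z\<close>, up
  to \<open>a\<close> and units.\<close>

lemma echelon_Cons:
  assumes a: "lreg a" and ech: "echelon z rs cs"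
  shows "echelon x (r # rs) (c # cs)"
proof -
  have len: "length rs = length cs" using ech by (simp add: echelon_def)
  have rs: "set rs \<subseteq> {r<..}" and cs: "set cs \<subseteq> {c<..}"
    using ech by (force simp: echelon_def schur_def split: if_splits)+
  have x_row: "\<exists>j. x i j \<noteq> 0" if "z i j \<noteq> 0" for i j
    using that by (rule schur_support)
  have x_col: "\<exists>i. x i j \<noteq> 0" if "z i j \<noteq> 0" for i j
    using that by (rule schur_support)
  have a0: "a \<noteq> 0" using a by (rule lreg_nonzero)
  have z_col: "qdet z is J = 0" if "c \<in> J" for "is" J
    using that by (rule qdet_zero_col) (simp add: schur_def)
  have reg: "lreg (qdet x (take l (r # rs)) (set (take l (c # cs))))" if "l \<le> length (r # rs)" for l
  proof (cases l)
    case 0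
    then show ?thesis by (simp add: ext_one_def lreg_one)
  next
    case (Suc m)
    define ks where "ks = take m rs"
    define K where "K = set (take m cs)"
    have ks: "set ks \<subseteq> {r<..}" and K: "finite K" "c \<notin> K"
      using rs cs set_take_subset[of m rs] set_take_subset[of m cs] by (auto simp: ks_def K_def)
    define e where "e = card {k \<in> insert c K. c < k}"
    \<comment> \<open>Column \<open>c\<close> of \<open>z\<close> is zero, so only the term that
      takes column \<open>c\<close> from row \<open>r\<close> survives.\<close>
    have "rmul (qdet z ks) (x r) (insert c K) = (- q) ^ e * (qdet z ks (insert c K - {c}) * a)"
      unfolding rmul_def e_def
    proof (rule trans[OF sum.remove[of _ c]])
      show "(- q) ^ card {k \<in> insert c K. c < k} * (qdet z ks (insert c K - {c}) * a) +
          (\<Sum>j\<in>insert c K - {c}. (- q) ^ card {k \<in> insert c K. j < k} * (qdet z ks (insert c K - {j}) * x r j)) =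
          (- q) ^ card {k \<in> insert c K. c < k} * (qdet z ks (insert c K - {c}) * a)"
        using z_col[of "insert c K - {j}" ks for j] by (simp add: sum.neutral)
    qed (use K in auto)
    then have eq: "a ^ length ks * qdet x (r # ks) (insert c K) =
        (- p) ^ length ks * (- q) ^ e * (qdet z ks K * a)"
      using pivot_qdet_Cons[OF ks, of "insert c K"] K by (simp add: mult.assoc)
    have "lreg (qdet z ks K)"
      using ech that Suc by (simp add: echelon_def ks_def K_def)
    moreover have "lreg ((- p) ^ length ks)" "lreg ((- q) ^ e)"
      by (rule lreg_left_factor[OF neg_power_q_p(1) lreg_one] lreg_left_factor[OF neg_power_q_p(2) lreg_one])+
    ultimately have "lreg ((- p) ^ length ks * (- q) ^ e * (qdet z ks K * a))"
      using a by (intro lreg_mult)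
    with eq have "lreg (qdet x (r # ks) (insert c K))"
      by (rule lreg_left_factor)
    then show ?thesis
      by (simp add: Suc ks_def K_def)
  qed
  have zero: "qdet x is J = 0" if "is": "sorted_wrt (<) is" and exc: "exceeds (r # rs) (c # cs) is J" for "is" J
  proof (cases "set is \<subseteq> {r..} \<and> J \<subseteq> {c..}")
    case False
    then show ?thesis
      using qdet_zero_row[of _ "is" x J] qdet_zero_col[of _ J x "is"] row_zero col_zero by fastforce
  next
    case True
    then have "set is \<subseteq> {r..}" and J: "J \<subseteq> {c..}" by auto
    note tail = exceeds_tail[OF exc len this]
    have z0: "qdet z is' J' = 0"
      if "sorted_wrt (<) is'" "length is \<le> Suc (length is')" "set is - {i} \<subseteq> set is'" "J - {j} \<subseteq> J'" for is' J' i j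
      using ech tail[OF that(2-4)] that(1) by (simp add: echelon_def)
    have r0: "rmul (qdet z is') (x r) J = 0"
      if "sorted_wrt (<) is'" "length is \<le> Suc (length is')" "set is - {i} \<subseteq> set is'" for is' i
      unfolding rmul_def using z0[OF that order_refl] by (intro sum.neutral ballI) simp
    show ?thesis
    \<comment> \<open>Without row \<open>r\<close>, minors of \<open>z\<close> on \<open>is\<close>
      and on \<open>is\<close> with one row removed occur; with row \<open>r\<close>, which then
      comes first, those on the remaining rows.\<close>
    proof (cases "r \<in> set is")
      case False
      then have rr: "set is \<subseteq> {r<..}"
        using \<open>set is \<subseteq> {r..}\<close> by (force simp: le_less)
      from pivot_qdet[OF "is" rr] obtain u where
        "a ^ length is * qdet x is J =
          qdet z is J + (\<Sum>i\<in>set is. u i * (x i c * rmul (qdet z (remove1 i is)) (x r) J))"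
        by blast
      moreover have "qdet z is J = 0"
        by (rule z0[OF "is"]) auto
      moreover have "rmul (qdet z (remove1 i is)) (x r) J = 0" if "i \<in> set is" for i
        using "is" that
        by (intro r0[of _ i]) (auto simp: sorted_remove1 length_remove1 strict_sorted_iff set_remove1_eq)
      ultimately have "a ^ length is * qdet x is J = 0"
        by simp
      then show ?thesis
        using lreg_power[OF a] by (rule lregD[rotated])
    next
      case r_in: True
      then obtain is' where is': "is = r # is'"
        using "is" \<open>set is \<subseteq> {r..}\<close> by (cases "is") force+
      then have rr: "set is' \<subseteq> {r<..}" and sorted: "sorted_wrt (<) is'"
        using "is" by auto
      have "a ^ length is' * qdet x is J = 0"
        using pivot_qdet_Cons[OF rr, of J] r0[OF sorted, of r] by (simp add: is')
      then show ?thesis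
        using lreg_power[OF a] by (rule lregD[rotated])
    qed
  qed
  have "\<exists>j. x i j \<noteq> 0" if "i \<in> set (r # rs)" for i
    using that a0 x_row ech by (auto simp: echelon_def)
  moreover have "\<exists>i. x i j \<noteq> 0" if "j \<in> set (c # cs)" for j
    using that a0 x_col ech by (auto simp: echelon_def)
  ultimately show ?thesis
    using rs cs len reg zero ech unfolding echelon_def by auto
qed

end

section \<open>Elimination by induction\<close>

context quantum_parameter
begin

text \<open>The first nonzero row and the first nonzero column are found separately, so their common
  entry might vanish. The witnesses \<open>k\<close> and \<open>l\<close> are what its regularity is
  derived from.\<close>

lemma pivoted_Least:
  assumes "quantum_matrix q p x" "x i j \<noteq> 0"
  obtains r c k l where "pivoted q p x r c" "x r k \<noteq> 0" "x l c \<noteq> 0"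
proof -
  define r where "r = (LEAST i. \<exists>j. x i j \<noteq> 0)"
  define c where "c = (LEAST j. \<exists>i. x i j \<noteq> 0)"
  have "\<exists>k. x r k \<noteq> 0"
    unfolding r_def by (rule LeastI[of _ i]) (use assms in blast)
  moreover have "\<exists>l. x l c \<noteq> 0"
    unfolding c_def by (rule LeastI[of _ j]) (use assms in blast)
  moreover have "pivoted q p x r c"
    using assms(1) not_less_Least[of _ "\<lambda>i. \<exists>j. x i j \<noteq> 0"] not_less_Least[of _ "\<lambda>j. \<exists>i. x i j \<noteq> 0"]
    unfolding pivoted_def pivoted_axioms_def r_def c_def by blast
  ultimately show ?thesis using that by blast
qed

text \<open>The invariant \<open>I\<close> lets domains and prime rings share one induction on the
  number of nonzero rows. This number drops because row \<open>r\<close> is nonzero in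
  \<open>x\<close> and zero in the Schur complement.\<close>

lemma echelon_exists:
  assumes qm: "\<And>x. I x \<Longrightarrow> quantum_matrix q p x"
    and fin: "\<And>x. I x \<Longrightarrow> finite {i. \<exists>j. x i j \<noteq> 0}"
    and reg: "\<And>x r c k l. I x \<Longrightarrow> pivoted q p x r c \<Longrightarrow> x r k \<noteq> 0 \<Longrightarrow> x l c \<noteq> 0 \<Longrightarrow> lreg (x r c)"
    and step: "\<And>x r c. I x \<Longrightarrow> pivoted q p x r c \<Longrightarrow> lreg (x r c) \<Longrightarrow> I (quantum_matrix.schur q x r c)"
  shows "I x \<Longrightarrow> \<exists>rs cs. echelon x rs cs"
proof (induction "card {i. \<exists>j. x i j \<noteq> 0}" arbitrary: x rule: less_induct)
  case less
  show ?case
  proof (cases "\<exists>i j. x i j \<noteq> 0")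
    case False
    then show ?thesis using echelon_zero by blast
  next
    case True
    then obtain r c k l where piv: "pivoted q p x r c" and k: "x r k \<noteq> 0" and l: "x l c \<noteq> 0"
      using pivoted_Least[OF qm[OF less.prems]] by blast
    interpret pivoted q p x r c by (rule piv)
    have a: "lreg (x r c)" using reg[OF less.prems piv k l] .
    have Iz: "I z" using step[OF less.prems piv a] .
    have "{i. \<exists>j. z i j \<noteq> 0} \<subset> {i. \<exists>j. x i j \<noteq> 0}"
    proof (rule psubsetI)
      show "{i. \<exists>j. z i j \<noteq> 0} \<subseteq> {i. \<exists>j. x i j \<noteq> 0}"
        using schur_support(1) by blast
      have "r \<notin> {i. \<exists>j. z i j \<noteq> 0}" by (simp add: schur_def)
      then show "{i. \<exists>j. z i j \<noteq> 0} \<noteq> {i. \<exists>j. x i j \<noteq> 0}"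
        using k by blast
    qed
    then have "card {i. \<exists>j. z i j \<noteq> 0} < card {i. \<exists>j. x i j \<noteq> 0}"
      by (rule psubset_card_mono[OF fin[OF less.prems]])
    then obtain rs cs where "echelon z rs cs"
      using less.hyps Iz by blast
    then show ?thesis
      using echelon_Cons[OF a] by blast
  qed
qed

theorem echelon_domain:
  assumes dom: "\<And>u v :: 'b. u * v = 0 \<Longrightarrow> u = 0 \<or> v = 0"
    and "quantum_matrix q p x" "finite {i. \<exists>j. x i j \<noteq> 0}"
  shows "\<exists>rs cs. echelon x rs cs"
proof (rule echelon_exists[of "\<lambda>x. quantum_matrix q p x \<and> finite {i. \<exists>j. x i j \<noteq> 0}"])
  fix x r c k l
  assume x: "quantum_matrix q p x \<and> finite {i. \<exists>j. x i j \<noteq> 0}" and piv: "pivoted q p x r c"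
    and k: "x r k \<noteq> 0" and l: "x l c \<noteq> 0"
  interpret pivoted q p x r c by (rule piv)
  have "a \<noteq> 0"
  proof
    assume a: "a = 0"
    then have "c < k" using col_zero k by (metis nat_neq_iff)
    moreover have "r < l" using row_zero l a by (metis nat_neq_iff)
    ultimately have "(q - p) * (x r k * x l c) = 0"
      using cross_rel[of r l c k] a by simp
    then show False
      using diff_cancel dom k l by blast
  qed
  then show "lreg a"
    unfolding lreg_def using dom by blast
next
  fix x r c
  assume x: "quantum_matrix q p x \<and> finite {i. \<exists>j. x i j \<noteq> 0}" and piv: "pivoted q p x r c"
  interpret pivoted q p x r c by (rule piv)
  have "{i. \<exists>j. z i j \<noteq> 0} \<subseteq> {i. \<exists>j. x i j \<noteq> 0}"
    using schur_support(1) by blast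
  then show "quantum_matrix q p z \<and> finite {i. \<exists>j. z i j \<noteq> 0}"
    using x quantum_matrix_schur finite_subset by blast
qed (use assms in auto)

end

section \<open>Pivots in prime rings\<close>

text \<open>Closure under negation is the case \<open>y = - 1\<close>.\<close>

definition right_ideal :: "'b::ring_1 set \<Rightarrow> bool" where
  "right_ideal N \<longleftrightarrow> 0 \<in> N \<and> (\<forall>u\<in>N. \<forall>v\<in>N. u + v \<in> N) \<and> (\<forall>u\<in>N. \<forall>y. u * y \<in> N)"

lemma right_idealI:
  assumes "0 \<in> N" "\<And>u v. u \<in> N \<Longrightarrow> v \<in> N \<Longrightarrow> u + v \<in> N" "\<And>u y. u \<in> N \<Longrightarrow> u * y \<in> N"
  shows "right_ideal N"
  using assms by (simp add: right_ideal_def)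

context quantum_parameter
begin

definition central_unit :: "'b \<Rightarrow> bool" where
  "central_unit s \<longleftrightarrow> (\<forall>y. y * s = s * y) \<and> (\<exists>t. t * s = 1)"

text \<open>One factor serves all entries; since the entries of a Schur complement are homogeneous
  of degree two in \<open>x\<close>, the property passes to them with factor
  \<open>s * s\<close>.\<close>

definition skew_commutes :: "'b \<Rightarrow> (nat \<Rightarrow> nat \<Rightarrow> 'b) \<Rightarrow> bool" where
  "skew_commutes t x \<longleftrightarrow> (\<exists>s. central_unit s \<and> (\<forall>i j. t * x i j = s * (x i j * t)))"

lemma central_unit_cancel: "central_unit s \<Longrightarrow> s * y = 0 \<Longrightarrow> y = 0"
  unfolding central_unit_def by (metis mult.assoc mult_1_left mult_zero_right)

lemma central_unit_mult: "central_unit s \<Longrightarrow> central_unit t \<Longrightarrow> central_unit (s * t)"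
proof -
  assume "central_unit s" "central_unit t"
  then obtain s' t' where s: "\<And>y. y * s = s * y" "s' * s = 1" and t: "\<And>y. y * t = t * y" "t' * t = 1"
    unfolding central_unit_def by blast
  have "t' * s' * (s * t) = t' * ((s' * s) * t)" by (simp only: mult.assoc)
  then have "t' * s' * (s * t) = 1" by (simp add: s(2) t(2))
  then show ?thesis
    unfolding central_unit_def using central_mult[OF s(1) t(1)] by blast
qed

lemma central_unit_left_commute: "central_unit s \<Longrightarrow> y * (s * z) = s * (y * z)"
  unfolding central_unit_def by (metis mult.assoc)

lemma central_unit_one: "central_unit 1"
  by (simp add: central_unit_def)

lemma central_unit_q: "central_unit q" and central_unit_p: "central_unit p"
  unfolding central_unit_def using q_p p_q q_central p_central by blast+

lemma central_unit_power: "central_unit s \<Longrightarrow> central_unit (s ^ n)"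
  by (induction n) (auto intro: central_unit_one central_unit_mult)

lemma skew_power:
  fixes t a s :: 'b
  assumes s: "central_unit s" and t: "t * a = s * (a * t)"
  shows "t * a ^ n = s ^ n * (a ^ n * t)"
proof (induction n)
  case (Suc n)
  have "t * a ^ Suc n = t * a * a ^ n" by (simp add: mult.assoc)
  also have "\<dots> = s * (a * (t * a ^ n))" by (simp only: t mult.assoc)
  also have "\<dots> = s * (s ^ n * (a * (a ^ n * t)))"
    unfolding Suc by (simp only: central_unit_left_commute[OF central_unit_power[OF s], of a])
  finally show ?case by (simp only: mult.assoc power_Suc)
qed simp

lemma skew_commutes_zero: "skew_commutes 0 x"
  unfolding skew_commutes_def using central_unit_one by (intro exI[of _ 1]) simp

end

section \<open>Commutation with earlier pivot rows and columns\<close>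

lemma (in quantum_matrix) quantum_matrix_transpose: "quantum_matrix q p (\<lambda>i j. x j i)"
proof unfold_locales
  fix i l j m :: nat
  show "i < l \<Longrightarrow> x j i * x j l = q * (x j l * x j i)" by (rule row_rel)
  show "j < m \<Longrightarrow> x j i * x m i = q * (x m i * x j i)" by (rule col_rel)
  show "i < l \<Longrightarrow> m < j \<Longrightarrow> x j i * x m l = x m l * x j i" by (rule commute_rel[symmetric])
  assume "i < l" "j < m"
  then show "x j i * x m l - x m l * x j i = (q - p) * (x m i * x j l)"
    using cross_rel[of j m i l] commute_rel[of j m i l] by simp
qed

text \<open>
  A column family behaves like an additional column to the left of \<^term>\<open>x\<close>, up to the factor
  \<^term>\<open>s\<close>.  The entries of the columns of the earlier pivots are such families.
\<close>

locale column_family = quantum_matrix q p x for q p :: "'b::ring_1" and x +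
  fixes s :: 'b and g :: "nat \<Rightarrow> 'b"
  assumes s_unit: "central_unit s"
    and family_less: "i < k \<Longrightarrow> g k * x i j = s * (x i j * g k)"
    and family_same: "g k * x k j = s * (q * (x k j * g k))"
    and family_greater: "k < i \<Longrightarrow> g k * x i j = s * (x i j * g k + (q - p) * (x k j * g i))"
begin

lemma family_assoc:
  "i < k \<Longrightarrow> g k * (x i j * y) = s * (x i j * (g k * y))"
  "g k * (x k j * y) = s * (q * (x k j * (g k * y)))"
  "k < i \<Longrightarrow> g k * (x i j * y) = s * (x i j * (g k * y) + (q - p) * (x k j * (g i * y)))"
proof -
  show "i < k \<Longrightarrow> g k * (x i j * y) = s * (x i j * (g k * y))"
    "g k * (x k j * y) = s * (q * (x k j * (g k * y)))"
    by (simp_all only: mult.assoc[symmetric] family_less family_same)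
  assume "k < i"
  then have "g k * (x i j * y) = s * (x i j * g k + (q - p) * (x k j * g i)) * y"
    by (simp only: family_greater[symmetric] mult.assoc)
  then show "g k * (x i j * y) = s * (x i j * (g k * y) + (q - p) * (x k j * (g i * y)))"
    by (simp only: mult.assoc distrib_right)
qed

lemma s_rules:
  "x i j * s = s * x i j" "x i j * (s * y) = s * (x i j * y)"
  "g k * s = s * g k" "g k * (s * y) = s * (g k * y)"
  "q * s = s * q" "q * (s * y) = s * (q * y)" "p * s = s * p" "p * (s * y) = s * (p * y)"
  "g k * q = q * g k" "g k * (q * y) = q * (g k * y)" "g k * p = p * g k" "g k * (p * y) = p * (g k * y)"
proof -
  have "y * s = s * y" for y using s_unit unfolding central_unit_def by blast
  then show "x i j * s = s * x i j" "g k * s = s * g k" "q * s = s * q" "p * s = s * p" by blast+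
qed (rule central_unit_left_commute[OF s_unit] q_central p_central q_left_commute p_left_commute)+

lemmas family_rules = family_less family_same family_greater family_assoc s_rules normal_order

end

context quantum_parameter
begin

text \<open>Entries of earlier pivot columns start as members of a column family, those of earlier
  pivot rows as members of a column family of the transpose; once the pivots reach or pass its
  index, a member becomes skew-commuting. The class is closed under passing to the Schur
  complement.\<close>

definition admissible :: "'b \<Rightarrow> (nat \<Rightarrow> nat \<Rightarrow> 'b) \<Rightarrow> bool" where
  "admissible t x \<longleftrightarrow> skew_commutes t x \<or> (\<exists>s g k. column_family q p x s g \<and> t = g k) \<or>
     (\<exists>s g k. column_family q p (\<lambda>i j. x j i) s g \<and> t = g k)"

lemma admissible_transpose: "admissible t x \<Longrightarrow> admissible t (\<lambda>i j. x j i)"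
  unfolding admissible_def skew_commutes_def by auto

end

context pivoted
begin

lemma pivoted_transpose: "pivoted q p (\<lambda>i j. x j i) c r"
  unfolding pivoted_def pivoted_axioms_def
  using quantum_matrix_transpose row_zero col_zero by blast

lemma schur_transpose: "quantum_matrix.schur q (\<lambda>i j. x j i) c r i j = z j i"
proof -
  interpret T: pivoted q p "\<lambda>i j. x j i" c r by (rule pivoted_transpose)
  have "x r i * x j c = x j c * x r i" if "r < j" "c < i"
    using that by (simp only: order_rules(3) mult_1_left)
  then show ?thesis
    by (cases "r < j \<and> c < i") (auto simp: T.schur_def schur_def)
qed

text \<open>For \<open>k < r\<close> the correction in \<open>family_greater\<close> contains row
  \<open>k\<close> of \<open>x\<close>, which is zero. For \<open>k = r\<close> the corrections of
  the two products in \<open>z i j\<close> cancel, leaving an additional factor \<open>q\<close>.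
  For \<open>r < k\<close> the family relations persist with \<open>s * s\<close>, as
  \<open>z\<close> is quadratic in \<open>x\<close>.\<close>

lemma family_schur:
  assumes "column_family q p x s g"
  shows "skew_commutes (g k) z \<or> (\<exists>s' g'. column_family q p z s' g' \<and> g k = g' k)"
proof -
  interpret column_family q p x s g by (rule assms)
  consider "k < r" | "k = r" | "r < k" by linarith
  then show ?thesis
  proof cases
    case 1
    then have "g k * z i j = s * s * (z i j * g k)" for i j
      by (cases "r < i \<and> c < j") (auto simp: schur_def family_rules row_zero)
    moreover have "central_unit (s * s)" using s_unit central_unit_mult by blast
    ultimately have "skew_commutes (g k) z" unfolding skew_commutes_def by blast
    then show ?thesis ..
  next
    case 2
    then have "g k * z i j = s * s * q * (z i j * g k)" for i j
      by (cases "r < i \<and> c < j") (auto simp: schur_def family_rules)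
    moreover have "central_unit (s * s * q)" using s_unit central_unit_q central_unit_mult by blast
    ultimately have "skew_commutes (g k) z" unfolding skew_commutes_def by blast
    then show ?thesis ..
  next
    case 3
    interpret Z: quantum_matrix q p z by (rule quantum_matrix_schur)
    \<comment> \<open>The element \<open>g r\<close> passes \<open>z\<close> with the additional
      factor \<open>q\<close>, which does not fit the family relations; the family is therefore cut
      off up to \<open>r\<close>.\<close>
    define h where "h k = (if r < k then g k else 0)" for k
    have "column_family q p z (s * s) h"
    proof unfold_locales
      show "central_unit (s * s)" using s_unit central_unit_mult by blast
      show "h k * z i j = s * s * (z i j * h k)" if "i < k" for i j k
        using that by (cases "r < i"; cases "c < j") (simp_all add: h_def schur_def family_rules)
      show "h k * z k j = s * s * (q * (z k j * h k))" for j k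
        by (cases "r < k"; cases "c < j") (simp_all add: h_def schur_def family_rules)
      show "h k * z i j = s * s * (z i j * h k + (q - p) * (z k j * h i))" if "k < i" for i j k
        using that by (cases "r < k"; cases "c < j") (simp_all add: h_def schur_def family_rules)
    qed
    moreover have "g k = h k" using 3 by (simp add: h_def)
    ultimately show ?thesis by blast
  qed
qed

lemma skew_commutes_schur:
  assumes "skew_commutes t x"
  shows "skew_commutes t z"
proof -
  from assms obtain s where s: "central_unit s" and t: "\<And>i j. t * x i j = s * (x i j * t)"
    unfolding skew_commutes_def by blast
  have ts: "t * (x i j * y) = s * (x i j * (t * y))" for i j y
    by (simp only: mult.assoc[symmetric] t)
  note sc = central_unit_left_commute[OF s, of "x i j" for i j] central_unit_left_commute[OF s, of q]
    q_left_commute[of t]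
  have "t * z i j = s * s * (z i j * t)" for i j
    by (simp add: schur_def t ts sc algebra_simps)
  moreover have "central_unit (s * s)" using s central_unit_mult by blast
  ultimately show ?thesis unfolding skew_commutes_def by blast
qed

lemma admissible_schur:
  assumes "admissible t x"
  shows "admissible t z"
  using assms unfolding admissible_def
proof (elim disjE exE conjE)
  assume "skew_commutes t x"
  then have "skew_commutes t z" by (rule skew_commutes_schur)
  then show "skew_commutes t z \<or> (\<exists>s g k. column_family q p z s g \<and> t = g k) \<or>
     (\<exists>s g k. column_family q p (\<lambda>i j. z j i) s g \<and> t = g k)" ..
next
  fix s g k assume "column_family q p x s g" "t = g k"
  then show "skew_commutes t z \<or> (\<exists>s g k. column_family q p z s g \<and> t = g k) \<or>
     (\<exists>s g k. column_family q p (\<lambda>i j. z j i) s g \<and> t = g k)"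
    using family_schur by blast
next
  fix s g k assume fam: "column_family q p (\<lambda>i j. x j i) s g" "t = g k"
  interpret T: pivoted q p "\<lambda>i j. x j i" c r by (rule pivoted_transpose)
  have "T.schur c r = (\<lambda>i j. z j i)"
    by (simp add: fun_eq_iff schur_transpose)
  then have "skew_commutes t (\<lambda>i j. z j i) \<or> (\<exists>s' g'. column_family q p (\<lambda>i j. z j i) s' g' \<and> t = g' k)"
    using T.family_schur[OF fam(1), of k] fam(2) by simp
  then show "skew_commutes t z \<or> (\<exists>s g k. column_family q p z s g \<and> t = g k) \<or>
     (\<exists>s g k. column_family q p (\<lambda>i j. z j i) s g \<and> t = g k)"
    unfolding skew_commutes_def by blast
qed

text \<open>A correction term would arise only from an index before that of the pivot, and it
  contains an entry of a zero row or a zero column of \<open>x\<close>.\<close>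

lemma admissible_pivot:
  assumes "admissible t x"
  shows "\<exists>s. central_unit s \<and> t * a = s * (a * t)"
  using assms unfolding admissible_def
proof (elim disjE exE conjE)
  fix s g k assume "column_family q p x s g" and t: "t = g k"
  then interpret column_family q p x s g by simp
  consider "k < r" | "k = r" | "r < k" by linarith
  then show ?thesis
  proof cases
    case 2
    then show ?thesis
      using s_unit central_unit_q central_unit_mult t family_same[of r c] by (metis mult.assoc)
  qed (use s_unit t family_less[of r k c] family_greater[of k r c] row_zero[of k c] in auto)
next
  fix s g k assume "column_family q p (\<lambda>i j. x j i) s g" and t: "t = g k"
  then interpret T: column_family q p "\<lambda>i j. x j i" s g by simp
  consider "k < c" | "k = c" | "c < k" by linarith
  then show ?thesis
  proof cases
    case 2
    then show ?thesis
      using T.s_unit central_unit_q central_unit_mult t T.family_same[of c r] by (metis mult.assoc)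
  qed (use T.s_unit t T.family_less[of c k r] T.family_greater[of k c r] col_zero[of k r] in auto)
qed (auto simp: skew_commutes_def)

lemma admissible_column:
  assumes adm: "admissible t x" and b: "\<And>i. x i c * b = 0"
  shows "x i c * (t * b) = 0"
  using adm unfolding admissible_def
proof (elim disjE exE conjE)
  assume "skew_commutes t x"
  then obtain s where s: "central_unit s" and t: "\<And>i j. t * x i j = s * (x i j * t)"
    unfolding skew_commutes_def by blast
  have "s * (x i c * (t * b)) = t * (x i c * b)"
    using t[of i c] by (simp only: mult.assoc[symmetric])
  then have "s * (x i c * (t * b)) = 0" by (simp add: b)
  then show ?thesis by (rule central_unit_cancel[OF s])
next
  fix s g k assume "column_family q p x s g" and t: "t = g k"
  then interpret column_family q p x s g by simp
  \<comment> \<open>Proved for all indices because the case \<open>k < i\<close> reduces to it: the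
    correction there is a multiple of \<open>x k c * (g i * b)\<close>, with the roles of
    \<open>i\<close> and \<open>k\<close> exchanged.\<close>
  have less: "x i c * (g k * b) = 0" if "i < k" for i k
    by (rule central_unit_cancel[OF s_unit]) (simp add: family_assoc(1)[OF that, symmetric] b)
  have same: "x k c * (g k * b) = 0" for k
    by (rule central_unit_cancel[OF central_unit_q], rule central_unit_cancel[OF s_unit])
      (simp add: family_assoc(2)[symmetric] b)
  have "x i c * (g k * b) = 0" if "k < i"
    by (rule central_unit_cancel[OF s_unit])
      (use family_assoc(3)[OF that, of c b] b less[OF that] in simp)
  then show ?thesis
    using less same t by (cases i k rule: linorder_cases) auto
next
  fix s g k assume "column_family q p (\<lambda>i j. x j i) s g" and t: "t = g k"
  then interpret T: column_family q p "\<lambda>i j. x j i" s g by simp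
  show ?thesis
  proof (cases c k rule: linorder_cases)
    case less
    show ?thesis
      unfolding t by (rule central_unit_cancel[OF T.s_unit])
        (simp add: T.family_assoc(1)[OF less, symmetric] b)
  next
    case equal
    show ?thesis
      unfolding t by (rule central_unit_cancel[OF central_unit_q], rule central_unit_cancel[OF T.s_unit])
        (simp add: equal[symmetric] T.family_assoc(2)[symmetric] b)
  next
    case greater
    show ?thesis
      unfolding t by (rule central_unit_cancel[OF T.s_unit])
        (use T.family_assoc(3)[OF greater, of i b] b col_zero[OF greater] in simp)
  qed
qed

end

section \<open>Two-sidedness of annihilators after several eliminations\<close>

context quantum_parameter
begin

text \<open>
  Instead of inverting the earlier pivots, which form \<^term>\<open>D\<close>, only right ideals saturated
  with respect to them are considered.
\<close>

definition controls :: "'b set \<Rightarrow> 'b set \<Rightarrow> (nat \<Rightarrow> nat \<Rightarrow> 'b) \<Rightarrow> bool" where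
  "controls D T x \<longleftrightarrow> (\<forall>N. right_ideal N \<longrightarrow> (\<forall>d\<in>D. \<forall>b. d * b \<in> N \<longrightarrow> b \<in> N) \<longrightarrow>
     (\<forall>t\<in>T. \<forall>b\<in>N. t * b \<in> N) \<longrightarrow> (\<forall>i j. \<forall>b\<in>N. x i j * b \<in> N) \<longrightarrow> (\<forall>y. \<forall>b\<in>N. y * b \<in> N))"

lemma controlsI:
  assumes "\<And>N y b. right_ideal N \<Longrightarrow> (\<And>d b. d \<in> D \<Longrightarrow> d * b \<in> N \<Longrightarrow> b \<in> N) \<Longrightarrow>
    (\<And>t b. t \<in> T \<Longrightarrow> b \<in> N \<Longrightarrow> t * b \<in> N) \<Longrightarrow> (\<And>i j b. b \<in> N \<Longrightarrow> x i j * b \<in> N) \<Longrightarrow> b \<in> N \<Longrightarrow> y * b \<in> N"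
  shows "controls D T x"
  unfolding controls_def
proof (intro allI impI ballI)
  fix N y b
  assume N: "right_ideal N" "\<forall>d\<in>D. \<forall>b. d * b \<in> N \<longrightarrow> b \<in> N" "\<forall>t\<in>T. \<forall>b\<in>N. t * b \<in> N"
    "\<forall>i j. \<forall>b\<in>N. x i j * b \<in> N" "b \<in> N"
  show "y * b \<in> N"
  proof (rule assms[OF N(1) _ _ _ N(5)])
    show "b \<in> N" if "d \<in> D" "d * b \<in> N" for d b using N(2) that by blast
    show "t * b \<in> N" if "t \<in> T" "b \<in> N" for t b using N(3) that by blast
    show "x i j * b \<in> N" if "b \<in> N" for i j b using N(4) that by blast
  qed
qed

lemma controlsD:
  assumes "controls D T x" "right_ideal N"
    and "\<And>d b. d \<in> D \<Longrightarrow> d * b \<in> N \<Longrightarrow> b \<in> N"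
    and "\<And>t b. t \<in> T \<Longrightarrow> b \<in> N \<Longrightarrow> t * b \<in> N"
    and "\<And>i j b. b \<in> N \<Longrightarrow> x i j * b \<in> N"
    and "b \<in> N"
  shows "y * b \<in> N"
proof -
  note N = assms(1)[unfolded controls_def, rule_format, OF assms(2)]
  show ?thesis
  proof (rule N[OF _ _ _ assms(6)])
    show "b \<in> N" if "d \<in> D" "d * b \<in> N" for d b using that by (rule assms(3))
    show "t * b \<in> N" if "t \<in> T" "b \<in> N" for t b using that by (rule assms(4))
    show "x i j * b \<in> N" if "b \<in> N" for i j b using that by (rule assms(5))
  qed
qed

text \<open>\<open>D\<close> collects the earlier pivots and \<open>T\<close> the entries of their
  rows and columns; both are empty at the start. They are hidden by quantifiers because later
  arguments use only how they commute with \<open>x\<close>.\<close>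

definition generating :: "(nat \<Rightarrow> nat \<Rightarrow> 'b) \<Rightarrow> bool" where
  "generating x \<longleftrightarrow> quantum_matrix q p x \<and> (\<exists>D T.
     (\<forall>d\<in>D. lreg d \<and> skew_commutes d x) \<and> (\<forall>t\<in>T. admissible t x) \<and> controls D T x)"

lemma generating_left_ideal:
  assumes "generating x" "right_ideal N"
    and "\<And>d b. lreg d \<Longrightarrow> skew_commutes d x \<Longrightarrow> d * b \<in> N \<Longrightarrow> b \<in> N"
    and "\<And>t b. admissible t x \<Longrightarrow> b \<in> N \<Longrightarrow> t * b \<in> N"
    and "\<And>i j b. b \<in> N \<Longrightarrow> x i j * b \<in> N"
    and "b \<in> N"
  shows "y * b \<in> N"
proof -
  from assms(1) obtain D T where D: "\<forall>d\<in>D. lreg d \<and> skew_commutes d x" and T: "\<forall>t\<in>T. admissible t x"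
    and ctl: "controls D T x"
    unfolding generating_def by blast
  show ?thesis
    using ctl assms(2)
  proof (rule controlsD)
    show "b \<in> N" if "d \<in> D" "d * b \<in> N" for d b using D that assms(3) by blast
    show "t * b \<in> N" if "t \<in> T" "b \<in> N" for t b using T that assms(4) by blast
  qed (use assms(5,6) in auto)
qed

lemma generating_transpose:
  assumes "generating x"
  shows "generating (\<lambda>i j. x j i)"
proof -
  from assms obtain D T where x: "quantum_matrix q p x"
    and D: "\<forall>d\<in>D. lreg d \<and> skew_commutes d x" and T: "\<forall>t\<in>T. admissible t x"
    and ctl: "controls D T x"
    unfolding generating_def by blast
  have "\<forall>d\<in>D. lreg d \<and> skew_commutes d (\<lambda>i j. x j i)"
    using D unfolding skew_commutes_def by blast
  moreover have "\<forall>t\<in>T. admissible t (\<lambda>i j. x j i)" using T admissible_transpose by blast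
  moreover have "controls D T (\<lambda>i j. x j i)"
    using ctl unfolding controls_def by (simp only: all_comm[of "\<lambda>i j. \<forall>b\<in>N. x j i * b \<in> N" for N])
  ultimately show ?thesis
    unfolding generating_def using quantum_matrix.quantum_matrix_transpose[OF x]
    by (intro conjI exI[of _ D] exI[of _ T])
qed

end

context pivoted
begin

text \<open>Below the pivot, column \<open>c\<close> is a column family for \<open>z\<close> with
  factor \<open>p\<close>; in \<open>family_same\<close> the product \<open>p * q = 1\<close>
  reflects that \<open>x i c\<close> commutes with \<open>z i j\<close>. The pivot itself commutes
  with \<open>z\<close>, and the entries above it are zero.\<close>

lemma admissible_column_entry: "admissible (x k c) z"
proof (cases k r rule: linorder_cases)
  case less
  then show ?thesis
    by (simp add: row_zero admissible_def skew_commutes_zero)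
next
  case equal
  have "a * z i j = 1 * (z i j * a)" for i j
    by (simp add: schur_commute_pivot)
  then show ?thesis
    unfolding equal admissible_def skew_commutes_def using central_unit_one by blast
next
  case greater
  interpret Z: quantum_matrix q p z by (rule quantum_matrix_schur)
  have "column_family q p z p (\<lambda>k. if r < k then x k c else 0)"
  proof unfold_locales
    show "central_unit p" by (rule central_unit_p)
  next
    fix i k j :: nat assume "i < k"
    then show "(if r < k then x k c else 0) * z i j = p * (z i j * (if r < k then x k c else 0))"
      using schur_commute_col[of r i k c j] by (cases "r < i") (auto simp: schur_def)
  next
    fix k j
    show "(if r < k then x k c else 0) * z k j = p * (q * (z k j * (if r < k then x k c else 0)))"
      by (simp add: q_p_cancel schur_commute_col_same)
  next
    fix i k j :: nat assume "k < i"
    then show "(if r < k then x k c else 0) * z i j = p * (z i j * (if r < k then x k c else 0) +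
        (q - p) * (z k j * (if r < i then x i c else 0)))"
      using schur_commute_col_above[of r k i c j] by (cases "r < k") (auto simp: schur_def)
  qed
  then show ?thesis
    using greater unfolding admissible_def
    by (intro disjI2 disjI1 exI[of _ p] exI[of _ "\<lambda>k. if r < k then x k c else 0"] exI[of _ k]) simp
qed

lemma admissible_row_entry: "admissible (x r k) z"
proof -
  interpret T: pivoted q p "\<lambda>i j. x j i" c r by (rule pivoted_transpose)
  have "T.schur c r = (\<lambda>i j. z j i)"
    by (simp add: fun_eq_iff schur_transpose)
  then show ?thesis
    using admissible_transpose[OF T.admissible_column_entry[of k]] by simp
qed

text \<open>If \<open>N\<close> is stable under \<open>z\<close> and under the entries of row
  \<open>r\<close> and column \<open>c\<close>, then \<open>a * (x i j * b)\<close> lies in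
  \<open>N\<close> by \<open>pivot_mult\<close>, and saturation with respect to \<open>a\<close>
  yields \<open>x i j * b\<close>. Accordingly \<open>a\<close> joins \<open>D\<close>, and its row
  and column join \<open>T\<close>.\<close>

lemma generating_schur:
  assumes gen: "generating x" and reg: "lreg a"
  shows "generating z"
proof -
  from gen obtain D T where D: "\<forall>d\<in>D. lreg d \<and> skew_commutes d x" and T: "\<forall>t\<in>T. admissible t x"
    and ctl: "controls D T x"
    unfolding generating_def by blast
  have skew_a: "skew_commutes a z"
    unfolding skew_commutes_def using central_unit_one
    by (intro exI[of _ 1]) (simp add: schur_commute_pivot)
  define D' where "D' = insert a D"
  define T' where "T' = T \<union> range (\<lambda>k. x k c) \<union> range (x r)"
  show ?thesis
    unfolding generating_def
  proof (rule conjI[OF quantum_matrix_schur], rule exI[of _ D'], rule exI[of _ T'], intro conjI ballI)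
    fix d assume "d \<in> D'"
    then show "lreg d" "skew_commutes d z"
      using D reg skew_commutes_schur skew_a by (auto simp: D'_def)
  next
    fix t assume "t \<in> T'"
    then show "admissible t z"
      using T admissible_schur admissible_column_entry admissible_row_entry by (auto simp: T'_def)
  next
    show "controls D' T' z"
    proof (rule controlsI)
      fix N y b
      assume N: "right_ideal N" and D': "\<And>d b. d \<in> D' \<Longrightarrow> d * b \<in> N \<Longrightarrow> b \<in> N"
        and T': "\<And>t b. t \<in> T' \<Longrightarrow> b \<in> N \<Longrightarrow> t * b \<in> N" and Z: "\<And>i j b. b \<in> N \<Longrightarrow> z i j * b \<in> N"
        and "b \<in> N"
      have x_closed: "x i j * b \<in> N" if "b \<in> N" for i j b
      proof -
        consider "i < r \<or> j < c" | "i = r \<or> j = c" | "r < i" "c < j" by linarith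
        then show ?thesis
        proof cases
          case 1
          then show ?thesis
            using N row_zero col_zero by (auto simp: right_ideal_def)
        next
          case 2
          then show ?thesis using T'[of "x i j" b] that by (auto simp: T'_def)
        next
          case 3
          have "x i c * (x r j * b) \<in> N" by (intro T' that) (auto simp: T'_def)
          then have "x i c * (x r j * b) * q \<in> N" using N by (simp add: right_ideal_def)
          then have "q * (x i c * x r j) * b \<in> N" by (simp only: q_central mult.assoc)
          moreover have "z i j * b \<in> N" using that by (rule Z)
          ultimately have "(z i j + q * (x i c * x r j)) * b \<in> N"
            using N by (simp add: right_ideal_def distrib_right)
          then have "a * (x i j * b) \<in> N"
            unfolding pivot_mult[OF 3(1), of j, symmetric] mult.assoc .
          then show ?thesis by (rule D'[rotated]) (simp add: D'_def)
        qed
      qed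
      show "y * b \<in> N"
        using ctl N
      proof (rule controlsD)
        show "b \<in> N" if "d \<in> D" "d * b \<in> N" for d b by (rule D'[OF _ that(2)]) (simp add: D'_def that)
        show "t * b \<in> N" if "t \<in> T" "b \<in> N" for t b by (rule T'[OF _ that(2)]) (simp add: T'_def that)
      qed (use x_closed \<open>b \<in> N\<close> in auto)
    qed
  qed
qed

text \<open>Moving \<open>x i c\<close> to the right past \<open>x k m\<close> produces only terms
  ending in an entry of column \<open>c\<close>, so the annihilator is stable under the entries. It
  is saturated because a regular \<open>d\<close> that skew-commutes with \<open>x\<close> can be
  moved to the left of \<open>x i c\<close> and cancelled.\<close>

lemma column_annihilator:
  assumes gen: "generating x" and prime: "\<And>u v :: 'b. (\<And>y. u * y * v = 0) \<Longrightarrow> u = 0 \<or> v = 0"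
    and l: "x l c \<noteq> 0" and b: "\<And>i. x i c * b = 0"
  shows "b = 0"
proof -
  define N where "N = {b. \<forall>i. x i c * b = 0}"
  have N: "right_ideal N"
    by (rule right_idealI) (simp_all add: N_def distrib_left mult.assoc[symmetric])
  have left: "y * b \<in> N" for y
    using gen N
  proof (rule generating_left_ideal)
    fix d b assume d: "lreg d" "skew_commutes d x" "d * b \<in> N"
    from d(2) obtain s where s: "central_unit s" and t: "\<And>i j. d * x i j = s * (x i j * d)"
      unfolding skew_commutes_def by blast
    have "d * (x i c * b) = 0" for i
      using d(3) unfolding mult.assoc[symmetric] t by (simp add: N_def mult.assoc)
    then show "b \<in> N"
      unfolding N_def using d(1) lregD by blast
  next
    fix t b assume "admissible t x" "b \<in> N"
    then show "t * b \<in> N" using admissible_column by (simp add: N_def)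
  next
    fix k m b assume "b \<in> N"
    then have b: "\<And>i. x i c * b = 0" by (simp add: N_def)
    have "x i c * (x k m * b) = 0" for i
    proof (cases m c rule: linorder_cases)
      case less
      then show ?thesis by (simp add: col_zero)
    next
      case equal
      then show ?thesis by (simp add: b)
    next
      case greater
      show ?thesis
      proof (cases i k rule: linorder_cases)
        case less
        have "x i c * x k m = x k m * x i c + (q - p) * (x i m * x k c)"
          using cross_rel[OF less greater] by (simp add: algebra_simps)
        then have "x i c * (x k m * b) = x k m * (x i c * b) + (q - p) * (x i m * (x k c * b))"
          by (simp only: mult.assoc[symmetric] distrib_right)
        then show ?thesis by (simp add: b)
      next
        case equal
        have "x i c * (x i m * b) = q * (x i m * (x i c * b))"
          by (simp only: mult.assoc[symmetric] row_rel[OF greater])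
        then show ?thesis by (simp add: b equal)
      next
        case greater': greater
        show ?thesis
          unfolding order_rules_assoc(3)[OF greater' greater] by (simp add: b)
      qed
    qed
    then show "x k m * b \<in> N" by (simp add: N_def)
  next
    show "b \<in> N" using b by (simp add: N_def)
  qed
  have "x l c * y * b = 0" for y
    using left[of y] by (simp add: N_def mult.assoc)
  then show ?thesis using prime l by blast
qed

lemma row_annihilator:
  assumes "generating x" "\<And>u v :: 'b. (\<And>y. u * y * v = 0) \<Longrightarrow> u = 0 \<or> v = 0"
    and "x r l \<noteq> 0" "\<And>j. x r j * b = 0"
  shows "b = 0"
proof -
  interpret T: pivoted q p "\<lambda>i j. x j i" c r by (rule pivoted_transpose)
  show ?thesis
    using T.column_annihilator[OF generating_transpose[OF assms(1)] assms(2-4)] by blast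
qed

text \<open>With \<open>y = x r j * x i c\<close> one has \<open>a * y = q ^ 2 * (y * a)\<close>.
  Commuting one factor \<open>a\<close> at a time therefore collects \<open>q - p\<close> times the
  sum of \<open>q ^ (2 * k)\<close> over \<open>k \<le> m\<close>, which is
  \<open>p * (q ^ (2 * Suc m) - 1)\<close>.\<close>

lemma pivot_power_entry:
  assumes "r < i" "c < j"
  shows "a ^ Suc m * x i j = x i j * a ^ Suc m + p * (q ^ (2 * Suc m) - 1) * (x r j * x i c * a ^ m)"
proof (induction m)
  case 0
  have "p * (q\<^sup>2 - 1) = q - p"
    by (simp add: power2_eq_square algebra_simps q_p_cancel)
  moreover have "a * x i j = x i j * a + (q - p) * (x r j * x i c)"
    using cross_rel[OF assms] by (simp add: algebra_simps)
  ultimately show ?case by simp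
next
  case (Suc m)
  define y where "y = x r j * x i c"
  define A where "A = a ^ Suc m"
  define Q where "Q = q ^ (2 * Suc m)"
  have A: "a * a ^ m = A" "a ^ Suc (Suc m) = a * A" by (simp_all add: A_def)
  have Q: "q ^ (2 * Suc (Suc m)) = q * q * Q" by (simp add: Q_def mult.assoc)
  have Q_central: "u * Q = Q * u" "u * (Q * v) = Q * (u * v)" for u v
    unfolding Q_def by (rule q_power_central q_power_left_commute)+
  have ay: "a * y = q * (q * (y * a))"
    using assms unfolding y_def by (simp add: normal_order)
  have ax: "a * x i j = x i j * a + (q - p) * y"
    using cross_rel[OF assms] by (simp add: algebra_simps y_def)
  have "a ^ Suc (Suc m) * x i j = a * (x i j * A + p * (Q - 1) * (y * a ^ m))"
    using Suc by (simp add: A_def Q_def y_def mult.assoc)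
  also have "\<dots> = a * x i j * A + p * ((Q - 1) * (a * y * a ^ m))"
  proof -
    have "a * (p * (Q - 1) * (y * a ^ m)) = p * ((Q - 1) * (a * (y * a ^ m)))"
      by (simp add: algebra_simps Q_central[of a] p_left_commute[of a])
    then show ?thesis by (simp add: distrib_left mult.assoc)
  qed
  also have "\<dots> = x i j * (a * A) + ((q - p) + p * ((Q - 1) * (q * q))) * (y * A)"
    unfolding ax ay by (simp add: distrib_right mult.assoc A(1))
  also have "(q - p) + p * ((Q - 1) * (q * q)) = p * (q * q * Q - 1)"
    by (simp add: algebra_simps q_p_cancel Q_central[of q])
  finally show ?case
    unfolding A(2) Q A_def y_def by simp
qed

lemma pivot_power_row:
  assumes "c < j"
  shows "a ^ n * x r j = q ^ n * (x r j * a ^ n)"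
proof -
  interpret T: pivoted q p "\<lambda>i j. x j i" c r by (rule pivoted_transpose)
  show ?thesis using T.pivot_power_col[OF assms] .
qed

lemma pivot_regular:
  assumes gen: "generating x" and prime: "\<And>u v :: 'b. (\<And>y. u * y * v = 0) \<Longrightarrow> u = 0 \<or> v = 0"
    and noeth: "\<And>F :: nat \<Rightarrow> 'b set. (\<And>n. right_ideal (F n)) \<Longrightarrow> (\<And>n. F n \<subseteq> F (Suc n)) \<Longrightarrow> \<exists>K. \<forall>n\<ge>K. F n = F K"
    and root: "\<And>m. \<exists>w. w * (q ^ (2 * Suc m) - 1) = 1"
    and k: "x r k \<noteq> 0" and l: "x l c \<noteq> 0"
  shows "lreg a"
proof (rule ccontr)
  assume "\<not> lreg a"
  then obtain b where b: "a * b = 0" "b \<noteq> 0" by (auto simp: lreg_def)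
  define F where "F n = {b. a ^ n * b = 0}" for n
  have F: "right_ideal (F n)" for n
    by (rule right_idealI) (simp_all add: F_def distrib_left mult.assoc[symmetric])
  have F_Suc: "F n \<subseteq> F (Suc n)" for n
    by (auto simp: F_def mult.assoc)
  obtain K where "\<forall>n\<ge>K. F n = F K"
    using noeth[of F, OF F F_Suc] by (elim exE)
  then have K: "F n = F K" if "n \<ge> K" for n
    using that by blast
  define N where "N = (\<Union>n. F n)"
  have N_K: "N = F K"
  proof
    have "F n \<subseteq> F K" for n
    proof (cases "n \<le> K")
      case True
      show ?thesis by (rule lift_Suc_mono_le[of F, OF F_Suc True])
    next
      case False
      then show ?thesis using K[of n] by simp
    qed
    then show "N \<subseteq> F K" by (auto simp: N_def)
  qed (auto simp: N_def)
  have left: "y * b \<in> N" for y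
    using gen F[of K, folded N_K]
  proof (rule generating_left_ideal)
    fix d b assume d: "lreg d" "skew_commutes d x" "d * b \<in> N"
    from d(2) obtain s where s: "central_unit s" and t: "\<And>i j. d * x i j = s * (x i j * d)"
      unfolding skew_commutes_def by blast
    have "d * (a ^ n * b) = 0" if "a ^ n * (d * b) = 0" for n
    proof -
      have "d * (a ^ n * b) = s ^ n * (a ^ n * (d * b))"
        using skew_power[OF s t] by (simp only: mult.assoc[symmetric])
      then show ?thesis using that by simp
    qed
    then have "a ^ n * b = 0" if "a ^ n * (d * b) = 0" for n
      using lregD[OF d(1)] that by blast
    then show "b \<in> N" using d(3) by (auto simp: N_def F_def)
  next
    fix t b assume "admissible t x" and bN: "b \<in> N"
    then obtain s where s: "central_unit s" and t: "t * a = s * (a * t)"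
      using admissible_pivot by blast
    have "t * a ^ K = s ^ K * (a ^ K * t)" using s t by (rule skew_power)
    then have "s ^ K * (a ^ K * (t * b)) = t * (a ^ K * b)"
      by (simp only: mult.assoc[symmetric])
    also have "\<dots> = 0" using bN by (simp add: N_K F_def)
    finally have "a ^ K * (t * b) = 0"
      by (rule central_unit_cancel[OF central_unit_power[OF s]])
    then show "t * b \<in> N" by (simp add: N_K F_def)
  next
    fix i j b assume "b \<in> N"
    then have b: "a ^ K * b = 0" by (simp add: N_K F_def)
    then have b': "a ^ Suc K * b = 0" by (simp add: mult.assoc)
    \<comment> \<open>The exponent \<open>Suc K\<close> leaves a factor \<open>a ^ K\<close> in
      front of \<open>b\<close> in the correction term of \<open>pivot_power_entry\<close>, and this
      already annihilates \<open>b\<close>.\<close>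
    have "a ^ Suc K * (x i j * b) = 0"
    proof -
      consider "i < r \<or> j < c" | "i = r" "j = c" | "i = r" "c < j" | "r < i" "j = c" | "r < i" "c < j" by linarith
      then show ?thesis
      proof cases
        case 1
        then show ?thesis using row_zero col_zero by auto
      next
        case 2
        have "a ^ Suc K * (a * b) = a * (a ^ Suc K * b)"
          by (simp only: mult.assoc[symmetric] power_commutes)
        then show ?thesis using 2 b' by simp
      next
        case 3
        have "a ^ Suc K * (x i j * b) = q ^ Suc K * (x i j * (a ^ Suc K * b))"
          using pivot_power_row[OF 3(2), of "Suc K"] unfolding 3(1) by (simp only: mult.assoc[symmetric])
        then show ?thesis using b' by simp
      next
        case 4
        have "a ^ Suc K * (x i j * b) = q ^ Suc K * (x i j * (a ^ Suc K * b))"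
          using pivot_power_col[OF 4(1), of "Suc K"] unfolding 4(2) by (simp only: mult.assoc[symmetric])
        then show ?thesis using b' by simp
      next
        case 5
        have "a ^ Suc K * (x i j * b) =
            x i j * (a ^ Suc K * b) + p * (q ^ (2 * Suc K) - 1) * (x r j * x i c * (a ^ K * b))"
          using pivot_power_entry[OF 5, of K] by (simp only: mult.assoc[symmetric] distrib_right)
        then show ?thesis using b b' by simp
      qed
    qed
    then have "x i j * b \<in> F (Suc K)" by (simp add: F_def)
    then show "x i j * b \<in> N" by (auto simp: N_def)
  next
    show "b \<in> N" using b by (auto simp: N_def F_def intro: exI[of _ 1])
  qed
  have "a ^ K * y * b = 0" for y
    using left[of y] by (simp add: N_K F_def mult.assoc)
  then have "a ^ K = 0" using prime b(2) by blast
  \<comment> \<open>The least exponent is a successor, because \<open>a ^ 0 = 1\<close> is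
    nonzero.\<close>
  then have nil: "a ^ (LEAST n. a ^ n = 0) = 0" by (rule LeastI)
  moreover have "(LEAST n. a ^ n = 0) \<noteq> 0"
    using nil by (intro notI) simp
  ultimately obtain m where m: "a ^ Suc m = 0" "(LEAST n. a ^ n = 0) = Suc m"
    by (metis not0_implies_Suc)
  then have am: "a ^ m \<noteq> 0"
    using not_less_Least[of m "\<lambda>n. a ^ n = 0"] by simp
  have "x r j * (x i c * a ^ m) = 0" for i j
  proof -
    consider "i < r \<or> j < c" | "i = r" | "r < i" "j = c" | "r < i" "c < j" by linarith
    then show ?thesis
    proof cases
      case 1
      then show ?thesis using row_zero col_zero by auto
    next
      case 2
      then show ?thesis using m(1) by simp
    next
      case 3
      have "a * x i c = q * (x i c * a)" using 3(1) by (rule col_rel)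
      then have "a * (x i c * a ^ m) = q * (x i c * a ^ Suc m)"
        by (simp only: mult.assoc[symmetric] power_Suc)
      then show ?thesis using 3 m(1) by simp
    next
      case 4
      \<comment> \<open>Both terms with \<open>a ^ Suc m\<close> vanish, which leaves the correction
        alone; its coefficient is cancelled by \<open>root\<close>, the form taken here by the
        condition that \<open>q\<close> is not a root of unity.\<close>
      have "0 = p * ((q ^ (2 * Suc m) - 1) * (x r j * x i c * a ^ m))"
        using pivot_power_entry[OF 4, of m]
        by (simp only: m(1) mult_zero_left mult_zero_right add_0_left mult.assoc)
      then have "p * ((q ^ (2 * Suc m) - 1) * (x r j * x i c * a ^ m)) = 0" by (rule sym)
      then have "(q ^ (2 * Suc m) - 1) * (x r j * x i c * a ^ m) = 0"
        using central_unit_cancel[OF central_unit_p] by blast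
      then show ?thesis
        using root[of m] by (metis mult.assoc mult_1_left mult_zero_right)
    qed
  qed
  then have "x i c * a ^ m = 0" for i
    using row_annihilator[OF gen prime k] by blast
  then have "a ^ m = 0"
    using column_annihilator[OF gen prime l] by blast
  with am show False by simp
qed

end

context quantum_parameter
begin

theorem echelon_prime:
  assumes prime: "\<And>u v :: 'b. (\<And>y. u * y * v = 0) \<Longrightarrow> u = 0 \<or> v = 0"
    and noeth: "\<And>F :: nat \<Rightarrow> 'b set. (\<And>n. right_ideal (F n)) \<Longrightarrow> (\<And>n. F n \<subseteq> F (Suc n)) \<Longrightarrow> \<exists>K. \<forall>n\<ge>K. F n = F K"
    and root: "\<And>m. \<exists>w. w * (q ^ (2 * Suc m) - 1) = 1"
    and x: "quantum_matrix q p x" "finite {i. \<exists>j. x i j \<noteq> 0}"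
    and gen: "\<And>N. right_ideal N \<Longrightarrow> (\<And>i j b. b \<in> N \<Longrightarrow> x i j * b \<in> N) \<Longrightarrow> (\<And>y b. b \<in> N \<Longrightarrow> y * b \<in> N)"
  shows "\<exists>rs cs. echelon x rs cs"
proof (rule echelon_exists[of "\<lambda>x. generating x \<and> finite {i. \<exists>j. x i j \<noteq> 0}"])
  show "generating x \<and> finite {i. \<exists>j. x i j \<noteq> 0}"
  proof
    \<comment> \<open>Before the first elimination the entries of \<open>x\<close> alone test
      two-sidedness.\<close>
    have "controls {} {} x"
      by (rule controlsI) (use gen in blast)
    then show "generating x"
      unfolding generating_def using x by blast
  qed (rule x)
next
  fix x r c k l
  assume x: "generating x \<and> finite {i. \<exists>j. x i j \<noteq> 0}" and "pivoted q p x r c"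
    and k: "x r k \<noteq> 0" and l: "x l c \<noteq> 0"
  then interpret pivoted q p x r c by simp
  show "lreg a"
    using pivot_regular[OF _ prime noeth root k l] x by blast
next
  fix x r c
  assume x: "generating x \<and> finite {i. \<exists>j. x i j \<noteq> 0}" and "pivoted q p x r c" and a: "lreg (x r c)"
  then interpret pivoted q p x r c by simp
  have "{i. \<exists>j. z i j \<noteq> 0} \<subseteq> {i. \<exists>j. x i j \<noteq> 0}"
    using schur_support(1) by blast
  then show "generating z \<and> finite {i. \<exists>j. z i j \<noteq> 0}"
    using x a generating_schur finite_subset by blast
qed (auto simp: generating_def)

end

section \<open>Right Noetherian rings\<close>

text \<open>Scalars and negatives are supplied by the generators: in the applications
  \<open>G\<close> contains 0, 1 and \<open>- 1\<close>.\<close>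

inductive_set alg :: "'b::ring_1 set \<Rightarrow> 'b set" for G where
  base: "g \<in> G \<Longrightarrow> g \<in> alg G"
| add: "u \<in> alg G \<Longrightarrow> v \<in> alg G \<Longrightarrow> u + v \<in> alg G"
| mult: "u \<in> alg G \<Longrightarrow> v \<in> alg G \<Longrightarrow> u * v \<in> alg G"

text \<open>Relative to a set, because the rings arising as entries are adjoined one by one are
  subrings of a single type.\<close>

definition right_ideal_in :: "'b::ring_1 set \<Rightarrow> 'b set \<Rightarrow> bool" where
  "right_ideal_in R I \<longleftrightarrow> I \<subseteq> R \<and> 0 \<in> I \<and> (\<forall>u\<in>I. \<forall>v\<in>I. u + v \<in> I) \<and> (\<forall>u\<in>I. \<forall>r\<in>R. u * r \<in> I)"

definition right_noetherian :: "'b::ring_1 set \<Rightarrow> bool" where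
  "right_noetherian R \<longleftrightarrow> (\<forall>F :: nat \<Rightarrow> 'b set. (\<forall>n. right_ideal_in R (F n)) \<longrightarrow> (\<forall>n. F n \<subseteq> F (Suc n)) \<longrightarrow>
     (\<exists>K. \<forall>n\<ge>K. F n = F K))"

lemma right_noetherianD:
  assumes "right_noetherian R" "\<And>n. right_ideal_in R (F n)" "\<And>n. F n \<subseteq> F (Suc n)"
  obtains K where "\<And>n. n \<ge> K \<Longrightarrow> F n = F K"
  using assms unfolding right_noetherian_def by metis

text \<open>This is the condition \<open>R x + R = x R + R\<close>, under which Hilbert's basis
  theorem holds. In contrast to an Ore extension, \<open>x\<close> may satisfy relations over
  \<open>R\<close>, as happens in a quotient of the quantum matrix algebra.\<close>

locale normalizing_extension =
  fixes R :: "'b::ring_1 set" and x :: 'b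
  assumes zero_R: "0 \<in> R" and one_R: "1 \<in> R" and uminus_R: "- 1 \<in> R"
    and add_R: "r \<in> R \<Longrightarrow> s \<in> R \<Longrightarrow> r + s \<in> R"
    and mult_R: "r \<in> R \<Longrightarrow> s \<in> R \<Longrightarrow> r * s \<in> R"
    and x_left: "r \<in> R \<Longrightarrow> \<exists>s\<in>R. \<exists>t\<in>R. x * r = s * x + t"
    and x_right: "r \<in> R \<Longrightarrow> \<exists>s\<in>R. \<exists>t\<in>R. r * x = x * s + t"
begin

text \<open>Since \<open>x\<close> may satisfy relations, elements have no well-defined degree; what
  is recorded is that some expression of degree less than \<open>d\<close> exists.\<close>

primrec below :: "nat \<Rightarrow> 'b set" where
  "below 0 = {0}"
| "below (Suc d) = {u + r * x ^ d | u r. u \<in> below d \<and> r \<in> R}"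

definition extension :: "'b set" where
  "extension = (\<Union>d. below d)"

lemma below_SucI: "u \<in> below d \<Longrightarrow> r \<in> R \<Longrightarrow> u + r * x ^ d \<in> below (Suc d)"
  by auto

lemma below_SucE:
  assumes "w \<in> below (Suc d)"
  obtains u r where "w = u + r * x ^ d" "u \<in> below d" "r \<in> R"
  using assms by auto

declare below.simps(2) [simp del]

lemma zero_below: "0 \<in> below d"
proof (induction d)
  case (Suc d)
  then show ?case using below_SucI[OF Suc zero_R] by simp
qed simp

lemma below_Suc: "u \<in> below d \<Longrightarrow> u \<in> below (Suc d)"
  using below_SucI[of u d 0] zero_R by simp

lemma below_mono: "d \<le> e \<Longrightarrow> below d \<subseteq> below e"
  by (rule lift_Suc_mono_le[of below]) (auto intro: below_Suc)

lemma below_add: "u \<in> below d \<Longrightarrow> v \<in> below d \<Longrightarrow> u + v \<in> below d"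
proof (induction d arbitrary: u v)
  case (Suc d)
  from Suc.prems(1) obtain u' r where u: "u = u' + r * x ^ d" "u' \<in> below d" "r \<in> R" by (rule below_SucE)
  from Suc.prems(2) obtain v' s where v: "v = v' + s * x ^ d" "v' \<in> below d" "s \<in> R" by (rule below_SucE)
  have "u + v = (u' + v') + (r + s) * x ^ d"
    by (simp add: u v algebra_simps)
  then show ?case
    using below_SucI[OF Suc.IH[OF u(2) v(2)] add_R[OF u(3) v(3)]] by simp
qed simp

lemma below_left: "u \<in> below d \<Longrightarrow> s \<in> R \<Longrightarrow> s * u \<in> below d"
proof (induction d arbitrary: u)
  case (Suc d)
  from Suc.prems(1) obtain u' r where u: "u = u' + r * x ^ d" "u' \<in> below d" "r \<in> R" by (rule below_SucE)
  have "s * u = s * u' + (s * r) * x ^ d"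
    by (simp add: u distrib_left mult.assoc)
  then show ?case
    using below_SucI[OF Suc.IH[OF u(2) Suc.prems(2)] mult_R[OF Suc.prems(2) u(3)]] by simp
qed simp

lemma below_uminus: "u \<in> below d \<Longrightarrow> - u \<in> below d"
  using below_left[of u d "- 1"] uminus_R by simp

lemma below_x_right: "u \<in> below d \<Longrightarrow> u * x \<in> below (Suc d)"
proof (induction d arbitrary: u)
  case 0
  then show ?case by (simp add: zero_below)
next
  case (Suc d)
  from Suc.prems obtain u' r where u: "u = u' + r * x ^ d" "u' \<in> below d" "r \<in> R" by (rule below_SucE)
  have "u * x = u' * x + r * x ^ Suc d"
    by (simp only: u distrib_right mult.assoc power_Suc2)
  then show ?case
    using below_SucI[OF Suc.IH[OF u(2)] u(3)] by simp
qed

lemma below_x_left: "u \<in> below d \<Longrightarrow> x * u \<in> below (Suc d)"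
proof (induction d arbitrary: u)
  case 0
  then show ?case by (simp add: zero_below)
next
  case (Suc d)
  from Suc.prems obtain u' r where u: "u = u' + r * x ^ d" "u' \<in> below d" "r \<in> R" by (rule below_SucE)
  obtain s t where st: "s \<in> R" "t \<in> R" "x * r = s * x + t" using x_left[OF u(3)] by blast
  have "x * u = x * u' + x * r * x ^ d"
    by (simp only: u distrib_left mult.assoc)
  also have "\<dots> = (x * u' + t * x ^ d) + s * x ^ Suc d"
    by (simp only: st(3) distrib_right mult.assoc power_Suc ac_simps)
  finally have eq: "x * u = (x * u' + t * x ^ d) + s * x ^ Suc d" .
  have "t * x ^ d \<in> below (Suc d)"
    using below_SucI[OF zero_below st(2)] by simp
  then show ?case
    unfolding eq by (intro below_SucI below_add Suc.IH u(2) st(1))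
qed

lemma power_right: "r \<in> R \<Longrightarrow> x ^ d * r \<in> below (Suc d)"
proof (induction d)
  case 0
  then show ?case using below_SucI[OF zero_below, of r 0] by simp
next
  case (Suc d)
  then show ?case using below_x_left[OF Suc.IH] by (simp add: mult.assoc)
qed

lemma below_right: "u \<in> below d \<Longrightarrow> s \<in> R \<Longrightarrow> u * s \<in> below d"
proof (induction d arbitrary: u)
  case (Suc d)
  from Suc.prems obtain u' r where u: "u = u' + r * x ^ d" "u' \<in> below d" "r \<in> R" by (auto elim: below_SucE)
  have "u * s = u' * s + r * (x ^ d * s)"
    by (simp only: u distrib_right mult.assoc)
  then show ?case
    using below_add[OF below_Suc[OF Suc.IH[OF u(2) Suc.prems(2)]] below_left[OF power_right[OF Suc.prems(2)] u(3)]]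
    by simp
qed simp

lemma below_power: "u \<in> below d \<Longrightarrow> u * x ^ e \<in> below (d + e)"
proof (induction e)
  case (Suc e)
  have "u * x ^ Suc e = u * x ^ e * x" by (simp only: power_Suc2 mult.assoc)
  then show ?case using below_x_right[OF Suc.IH[OF Suc.prems]] by simp
qed simp

lemma below_mult: "u \<in> below d \<Longrightarrow> v \<in> below e \<Longrightarrow> u * v \<in> below (d + e)"
proof (induction e arbitrary: v)
  case 0
  then show ?case by (simp add: zero_below)
next
  case (Suc e)
  from Suc.prems(2) obtain v' r where v: "v = v' + r * x ^ e" "v' \<in> below e" "r \<in> R" by (rule below_SucE)
  have "u * v = u * v' + u * r * x ^ e"
    by (simp add: v distrib_left mult.assoc)
  moreover have "u * v' \<in> below (d + Suc e)"
    using below_Suc[OF Suc.IH[OF Suc.prems(1) v(2)]] by simp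
  moreover have "u * r * x ^ e \<in> below (d + Suc e)"
    using below_Suc[OF below_power[OF below_right[OF Suc.prems(1) v(3)], of e]] by simp
  ultimately show ?case by (simp add: below_add)
qed

text \<open>Coefficients stand on the left, so to multiply a leading coefficient by \<open>r\<close>
  on the right, the whole element is multiplied by the \<open>s\<close> found here. This is the
  purpose of \<open>x_right\<close>.\<close>

lemma power_commute_mod_below:
  "r \<in> R \<Longrightarrow> \<exists>s\<in>R. \<exists>u\<in>below d. r * x ^ d = x ^ d * s + u"
proof (induction d)
  case 0
  then show ?case by (intro bexI[of _ r] bexI[of _ 0]) auto
next
  case (Suc d)
  then obtain s u where s: "s \<in> R" "u \<in> below d" "r * x ^ d = x ^ d * s + u" by blast
  obtain s' t where st: "s' \<in> R" "t \<in> R" "s * x = x * s' + t" using x_right[OF s(1)] by blast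
  have "r * x ^ Suc d = (r * x ^ d) * x" by (simp only: power_Suc2 mult.assoc)
  also have "\<dots> = x ^ d * (s * x) + u * x" by (simp only: s(3) distrib_right mult.assoc)
  also have "\<dots> = x ^ Suc d * s' + (x ^ d * t + u * x)"
    by (simp only: st(3) distrib_left mult.assoc power_Suc2 add.assoc)
  finally show ?case
    using st(1) below_add[OF power_right[OF st(2)] below_x_right[OF s(2)]] by blast
qed

lemma extension_closed:
  "R \<subseteq> extension" "x \<in> extension"
  "u \<in> extension \<Longrightarrow> v \<in> extension \<Longrightarrow> u + v \<in> extension"
  "u \<in> extension \<Longrightarrow> v \<in> extension \<Longrightarrow> u * v \<in> extension"
proof -
  have "r \<in> below (Suc 0)" if "r \<in> R" for r
    using below_SucI[OF zero_below that, of 0] by simp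
  then show "R \<subseteq> extension" by (auto simp: extension_def)
  have "x \<in> below (Suc 1)"
    using below_SucI[OF zero_below one_R, of 1] by simp
  then show "x \<in> extension" unfolding extension_def by blast
next
  assume "u \<in> extension" "v \<in> extension"
  then obtain d e where de: "u \<in> below d" "v \<in> below e" by (auto simp: extension_def)
  have "u \<in> below (max d e)" "v \<in> below (max d e)"
    using de below_mono[of d "max d e"] below_mono[of e "max d e"] by auto
  then have "u + v \<in> below (max d e)" by (rule below_add)
  then show "u + v \<in> extension" unfolding extension_def by blast
  have "u * v \<in> below (d + e)" using de by (rule below_mult)
  then show "u * v \<in> extension" unfolding extension_def by blast
qed

definition leading :: "nat \<Rightarrow> 'b set \<Rightarrow> 'b set" where
  "leading d I = {r \<in> R. \<exists>u\<in>below d. r * x ^ d + u \<in> I}"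

lemma right_ideal_leading:
  assumes I: "right_ideal_in extension I"
  shows "right_ideal_in R (leading d I)"
  unfolding right_ideal_in_def
proof (intro conjI ballI)
  show "leading d I \<subseteq> R" by (auto simp: leading_def)
  show "0 \<in> leading d I"
    using I zero_R zero_below[of d] by (force simp: leading_def right_ideal_in_def)
next
  fix r s assume "r \<in> leading d I" "s \<in> leading d I"
  then obtain u v where r: "r \<in> R" "u \<in> below d" "r * x ^ d + u \<in> I"
    and s: "s \<in> R" "v \<in> below d" "s * x ^ d + v \<in> I"
    by (auto simp: leading_def)
  have "(r * x ^ d + u) + (s * x ^ d + v) \<in> I" using I r(3) s(3) by (simp add: right_ideal_in_def)
  then have "(r + s) * x ^ d + (u + v) \<in> I" by (simp add: algebra_simps)
  then show "r + s \<in> leading d I"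
    unfolding leading_def using add_R[OF r(1) s(1)] below_add[OF r(2) s(2)] by blast
next
  fix r s assume "r \<in> leading d I" and s: "s \<in> R"
  then obtain u where r: "r \<in> R" "u \<in> below d" "r * x ^ d + u \<in> I"
    by (auto simp: leading_def)
  obtain t v where t: "t \<in> R" "v \<in> below d" "s * x ^ d = x ^ d * t + v"
    using power_commute_mod_below[OF s] by blast
  have "(r * x ^ d + u) * t \<in> I"
    using I r(3) t(1) extension_closed(1) by (auto simp: right_ideal_in_def)
  moreover have "(r * x ^ d + u) * t = r * s * x ^ d + (u * t + - (r * v))"
    using t(3) by (simp add: distrib_right distrib_left mult.assoc)
  moreover have "u * t + - (r * v) \<in> below d"
    by (intro below_add below_right below_uminus below_left r t)
  ultimately show "r * s \<in> leading d I"
    unfolding leading_def using mult_R[OF r(1) s] by auto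
qed

lemma leading_Suc:
  assumes I: "right_ideal_in extension I"
  shows "leading d I \<subseteq> leading (Suc d) I"
proof
  fix r assume "r \<in> leading d I"
  then obtain u where r: "r \<in> R" "u \<in> below d" "r * x ^ d + u \<in> I"
    by (auto simp: leading_def)
  have "(r * x ^ d + u) * x \<in> I" using I r(3) extension_closed(2) by (simp add: right_ideal_in_def)
  then have "r * x ^ Suc d + u * x \<in> I" by (simp only: distrib_right mult.assoc power_Suc2)
  then show "r \<in> leading (Suc d) I"
    unfolding leading_def using r(1) below_x_right[OF r(2)] by blast
qed

lemma leading_mono: "I \<subseteq> I' \<Longrightarrow> leading d I \<subseteq> leading d I'"
  unfolding leading_def by blast

text \<open>Some element of \<open>I\<close> has the same leading coefficient as a given element of
  \<open>I'\<close>; their difference lies in \<open>I'\<close> with a smaller bound on the degree,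
  and induction applies.\<close>

lemma leading_determines:
  assumes I: "right_ideal_in extension I" and I': "right_ideal_in extension I'"
    and sub: "I \<subseteq> I'" and lead: "\<And>d. leading d I' \<subseteq> leading d I"
  shows "I' \<subseteq> I"
proof -
  have neg: "- u \<in> J" if "right_ideal_in extension J" "u \<in> J" for J u
    using that extension_closed(1) uminus_R by (force simp: right_ideal_in_def)
  have "w \<in> I" if "w \<in> I'" "w \<in> below d" for w d
    using that
  proof (induction d arbitrary: w)
    case 0
    then show ?case using I by (simp add: right_ideal_in_def)
  next
    case (Suc d)
    from Suc.prems(2) obtain u r where w: "w = u + r * x ^ d" "u \<in> below d" "r \<in> R" by (rule below_SucE)
    then have "r \<in> leading d I'" using Suc.prems(1) by (auto simp: leading_def add.commute)
    then obtain v where v: "v \<in> below d" "r * x ^ d + v \<in> I" using lead[of d] by (auto simp: leading_def)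
    have "- (r * x ^ d + v) \<in> I'" using neg[OF I'] v(2) sub by blast
    then have "w + - (r * x ^ d + v) \<in> I'"
      using I' Suc.prems(1) unfolding right_ideal_in_def by blast
    then have "u + - v \<in> I'" by (simp add: w algebra_simps)
    then have "u + - v \<in> I"
      by (rule Suc.IH) (intro below_add below_uminus w v)
    then have "(u + - v) + (r * x ^ d + v) \<in> I" using I v(2) unfolding right_ideal_in_def by blast
    moreover have "(u + - v) + (r * x ^ d + v) = w" by (simp add: w)
    ultimately show ?case by (simp only:)
  qed
  then show ?thesis
    using I' unfolding right_ideal_in_def extension_def by blast
qed

text \<open>Leading coefficients increase with the degree and along the chain. The diagonal
  \<open>leading n (F n)\<close> is stationary from \<open>D\<close> on, which settles all degrees
  from \<open>D\<close> on at once; each of the finitely many smaller degrees has its own bound, and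
  \<open>K\<close> is the maximum of all these.\<close>

lemma right_noetherian_extension:
  assumes R: "right_noetherian R"
  shows "right_noetherian extension"
  unfolding right_noetherian_def
proof (intro allI impI)
  fix F :: "nat \<Rightarrow> 'b set"
  assume "\<forall>n. right_ideal_in extension (F n)" "\<forall>n. F n \<subseteq> F (Suc n)"
  then have F: "\<And>n. right_ideal_in extension (F n)" and F_Suc: "\<And>n. F n \<subseteq> F (Suc n)" by auto
  have F_mono: "F m \<subseteq> F n" if "m \<le> n" for m n
    by (rule lift_Suc_mono_le[of F, OF F_Suc that])
  have lead_mono: "leading d (F m) \<subseteq> leading e (F n)" if "d \<le> e" "m \<le> n" for d e m n
    using lift_Suc_mono_le[of "\<lambda>d. leading d (F m)", OF leading_Suc[OF F] that(1)]
      leading_mono[OF F_mono[OF that(2)]] by blast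
  have "\<exists>K. \<forall>n\<ge>K. leading d (F n) = leading d (F K)" for d
    using right_noetherianD[OF R, of "\<lambda>n. leading d (F n)"] right_ideal_leading[OF F] leading_mono[OF F_Suc]
    by metis
  then obtain k where k: "\<And>d n. n \<ge> k d \<Longrightarrow> leading d (F n) = leading d (F (k d))" by metis
  obtain D where D: "\<And>n. n \<ge> D \<Longrightarrow> leading n (F n) = leading D (F D)"
    using right_noetherianD[OF R, of "\<lambda>n. leading n (F n)"] right_ideal_leading[OF F]
      lead_mono[OF le_SucI[OF order_refl] le_SucI[OF order_refl]] by metis
  define K where "K = Max (insert D (k ` {..<D}))"
  have kK: "k d \<le> K" if "d < D" for d
    unfolding K_def using that by auto
  have DK: "D \<le> K" unfolding K_def by auto
  have "leading d (F n) \<subseteq> leading d (F K)" if "n \<ge> K" for d n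
  proof (cases "d < D")
    case True
    then show ?thesis using k[of d n] k[of d K] kK[of d] that by simp
  next
    case False
    have "leading d (F n) \<subseteq> leading (max d n) (F (max d n))" by (rule lead_mono) auto
    also have "\<dots> = leading D (F D)" by (rule D) (use False in auto)
    also have "\<dots> \<subseteq> leading d (F K)" by (rule lead_mono) (use False DK in auto)
    finally show ?thesis .
  qed
  then have "F n = F K" if "n \<ge> K" for n
    using leading_determines[OF F[of K] F[of n] F_mono[OF that]] F_mono[OF that] that by blast
  then show "\<exists>K. \<forall>n\<ge>K. F n = F K" by blast
qed

end

text \<open>The two conditions on \<open>x\<close> pass from generators to sums and products, so
  checking them on \<open>G\<close> gives a \<open>normalizing_extension\<close> of
  \<open>alg G\<close>.\<close>

lemma right_noetherian_adjoin:
  fixes G :: "'b::ring_1 set" and x :: 'b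
  assumes noeth: "right_noetherian (alg G)" and G: "0 \<in> G" "1 \<in> G" "- 1 \<in> G"
    and left: "\<And>g. g \<in> G \<Longrightarrow> \<exists>s\<in>alg G. \<exists>t\<in>alg G. x * g = s * x + t"
    and right: "\<And>g. g \<in> G \<Longrightarrow> \<exists>s\<in>alg G. \<exists>t\<in>alg G. g * x = x * s + t"
  shows "right_noetherian (alg (insert x G))"
proof -
  have left': "\<exists>s\<in>alg G. \<exists>t\<in>alg G. x * r = s * x + t" if "r \<in> alg G" for r
    using that
  proof induction
    case (add u v)
    then obtain s t s' t' where "s \<in> alg G" "t \<in> alg G" "x * u = s * x + t"
      "s' \<in> alg G" "t' \<in> alg G" "x * v = s' * x + t'" by blast
    then have "s + s' \<in> alg G" "t + t' \<in> alg G" "x * (u + v) = (s + s') * x + (t + t')"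
      by (auto intro: alg.add simp: algebra_simps)
    then show ?case by blast
  next
    case (mult u v)
    then obtain s t s' t' where st: "s \<in> alg G" "t \<in> alg G" "x * u = s * x + t"
      "s' \<in> alg G" "t' \<in> alg G" "x * v = s' * x + t'" by blast
    have "x * (u * v) = s * (x * v) + t * v"
      by (simp only: mult.assoc[symmetric] st(3) distrib_right)
    then have "x * (u * v) = (s * s') * x + (s * t' + t * v)"
      by (simp only: st(6) distrib_left mult.assoc add.assoc)
    moreover have "s * s' \<in> alg G" "s * t' + t * v \<in> alg G"
      using st mult by (auto intro: alg.add alg.mult)
    ultimately show ?case by blast
  qed (rule left)
  have right': "\<exists>s\<in>alg G. \<exists>t\<in>alg G. r * x = x * s + t" if "r \<in> alg G" for r
    using that
  proof induction
    case (add u v)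
    then obtain s t s' t' where "s \<in> alg G" "t \<in> alg G" "u * x = x * s + t"
      "s' \<in> alg G" "t' \<in> alg G" "v * x = x * s' + t'" by blast
    then have "s + s' \<in> alg G" "t + t' \<in> alg G" "(u + v) * x = x * (s + s') + (t + t')"
      by (auto intro: alg.add simp: algebra_simps)
    then show ?case by blast
  next
    case (mult u v)
    then obtain s t s' t' where st: "s \<in> alg G" "t \<in> alg G" "u * x = x * s + t"
      "s' \<in> alg G" "t' \<in> alg G" "v * x = x * s' + t'" by blast
    have "(u * v) * x = (u * x) * s' + u * t'"
      by (simp only: mult.assoc st(6) distrib_left)
    then have "(u * v) * x = x * (s * s') + (t * s' + u * t')"
      by (simp only: st(3) distrib_right mult.assoc add.assoc)
    moreover have "s * s' \<in> alg G" "t * s' + u * t' \<in> alg G"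
      using st mult by (auto intro: alg.add alg.mult)
    ultimately show ?case by blast
  qed (rule right)
  interpret normalizing_extension "alg G" x
    by unfold_locales (use G left' right' in \<open>auto intro: alg.intros\<close>)
  have sub: "alg G \<subseteq> alg (insert x G)"
  proof
    fix u assume "u \<in> alg G"
    then show "u \<in> alg (insert x G)" by induction (auto intro: alg.intros)
  qed
  have x: "x \<in> alg (insert x G)" by (auto intro: alg.base)
  have pow: "x ^ d \<in> alg (insert x G)" for d
    by (induction d) (use x sub one_R in \<open>auto intro: alg.mult\<close>)
  have "u \<in> alg (insert x G)" if "u \<in> below d" for u d
    using that
  proof (induction d arbitrary: u)
    case 0
    then show ?case using sub zero_R by auto
  next
    case (Suc d)
    from Suc.prems obtain v r where "u = v + r * x ^ d" "v \<in> below d" "r \<in> alg G" by (rule below_SucE)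
    then show ?case using Suc.IH sub pow by (auto intro!: alg.add alg.mult)
  qed
  then have "extension \<subseteq> alg (insert x G)" by (auto simp: extension_def)
  moreover have "u \<in> extension" if "u \<in> alg (insert x G)" for u
    using that
  proof induction
    case (base g)
    then show ?case using extension_closed(1,2) by (auto intro: alg.base)
  qed (auto intro: extension_closed)
  ultimately have "alg (insert x G) = extension" by blast
  then show ?thesis using right_noetherian_extension[OF noeth] by simp
qed

lemma right_noetherian_division:
  fixes C :: "'b::ring_1 set"
  assumes "\<And>c. c \<in> C \<Longrightarrow> c \<noteq> 0 \<Longrightarrow> \<exists>d\<in>C. c * d = 1"
  shows "right_noetherian C"
  unfolding right_noetherian_def
proof (intro allI impI)
  fix F :: "nat \<Rightarrow> 'b set"
  assume "\<forall>n. right_ideal_in C (F n)" "\<forall>n. F n \<subseteq> F (Suc n)"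
  then have F: "\<And>n. right_ideal_in C (F n)" and F_Suc: "\<And>n. F n \<subseteq> F (Suc n)" by auto
  show "\<exists>K. \<forall>n\<ge>K. F n = F K"
  proof (cases "\<exists>K. \<exists>c\<in>F K. c \<noteq> 0")
    case True
    then obtain K c where c: "c \<in> F K" "c \<noteq> 0" by blast
    have "F n = C" if "n \<ge> K" for n
    proof
      show "F n \<subseteq> C" using F[of n] by (simp add: right_ideal_in_def)
      have cn: "c \<in> F n" using lift_Suc_mono_le[of F, OF F_Suc that] c(1) by blast
      then have "c \<in> C" using F[of n] unfolding right_ideal_in_def by blast
      then obtain d where d: "d \<in> C" "c * d = 1"
        using assms c(2) by blast
      have "e \<in> F n" if "e \<in> C" for e
      proof -
        have "c * d * e \<in> F n" using F[of n] cn d(1) that by (simp add: right_ideal_in_def)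
        then show ?thesis by (simp add: d(2))
      qed
      then show "C \<subseteq> F n" by blast
    qed
    then show ?thesis by (metis order_refl)
  next
    case False
    then have "F n = {0}" for n using F[of n] by (auto simp: right_ideal_in_def)
    then show ?thesis by simp
  qed
qed

section \<open>Quantum matrices over a field of central scalars\<close>

context quantum_matrix
begin

text \<open>Entries are adjoined in row-major order. Each commutes with its predecessors up to a
  central unit and a correction built from predecessors, so \<open>right_noetherian_adjoin\<close>
  applies at every step, starting from the field \<open>C\<close>.\<close>

theorem quantum_right_noetherian:
  assumes C: "0 \<in> C" "1 \<in> C" "- 1 \<in> C" "q \<in> C" "p \<in> C"
    and C_add: "\<And>c d. c \<in> C \<Longrightarrow> d \<in> C \<Longrightarrow> c + d \<in> C"
    and C_mult: "\<And>c d. c \<in> C \<Longrightarrow> d \<in> C \<Longrightarrow> c * d \<in> C"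
    and C_central: "\<And>c y. c \<in> C \<Longrightarrow> y * c = c * y"
    and C_inverse: "\<And>c. c \<in> C \<Longrightarrow> c \<noteq> 0 \<Longrightarrow> \<exists>d\<in>C. c * d = 1"
  shows "right_noetherian (alg (C \<union> (\<lambda>m. x (m div N) (m mod N)) ` {..<k}))"
proof (induction k)
  case 0
  have "u \<in> C" if "u \<in> alg C" for u
    using that by induction (auto intro: C_add C_mult)
  then have "alg C = C" by (auto intro: alg.base)
  then show ?case using right_noetherian_division[OF C_inverse] by simp
next
  case (Suc k)
  define G where "G = C \<union> (\<lambda>m. x (m div N) (m mod N)) ` {..<k}"
  define l c where "l = k div N" and "c = k mod N"
  have CG: "d \<in> alg G" if "d \<in> C" for d
    using that by (auto simp: G_def intro: alg.base)
  have entry: "x i j \<in> alg G" if "i * N + j < k" "j < N" for i j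
  proof -
    have "(i * N + j) div N = i" "(i * N + j) mod N = j" using that by simp_all
    then show ?thesis
      using that(1) by (intro alg.base) (force simp: G_def image_iff)
  qed
  \<comment> \<open>The inverse \<open>u'\<close> is recorded so that the relation can also be
    solved for \<open>g * x l c\<close>.\<close>
  have rel: "\<exists>u\<in>C. \<exists>u'\<in>C. \<exists>w\<in>alg G. u' * u = 1 \<and> x l c * g = u * (g * x l c) + w" if "g \<in> G" for g
  proof -
    from that consider "g \<in> C" | m where "m < k" "g = x (m div N) (m mod N)" by (auto simp: G_def)
    then show ?thesis
    proof cases
      case 1
      then show ?thesis
        using C C_central[OF 1] CG by (intro bexI[of _ 1] bexI[of _ 0]) auto
    next
      case 2
      define i j where "i = m div N" and "j = m mod N"
      have g: "g = x i j" using 2 by (simp add: i_def j_def)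
      have km: "k = l * N + c" "m = i * N + j" by (simp_all add: l_def c_def i_def j_def)
      show ?thesis
      proof (cases "N = 0")
        \<comment> \<open>Here \<open>k div 0 = 0\<close> and \<open>k mod 0 = k\<close>, so the
          enumeration runs through row 0 and only the row relation occurs.\<close>
        case True
        then have [simp]: "l = 0" "i = 0" "c = k" "j = m" by (simp_all add: l_def c_def i_def j_def)
        then have "x l c * g = p * (g * x l c) + 0" using order_rules(2)[OF 2(1), of 0] by (simp add: g)
        then show ?thesis using C CG q_p by blast
      next
        case False
        then have "c < N" "j < N" by (simp_all add: c_def j_def)
        have "i \<le> l" using 2(1) by (simp add: i_def l_def div_le_mono)
        then consider "i = l" "j < c" | "i < l" "j = c" | "i < l" "c < j" | "i < l" "j < c"
          using 2(1) km by (cases "i = l"; cases j c rule: linorder_cases) auto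
        then show ?thesis
        proof cases
          case 1
          then have "x l c * g = p * (g * x l c) + 0" by (simp add: g order_rules(2))
          then show ?thesis using C CG q_p by blast
        next
          case 2
          then have "x l c * g = p * (g * x l c) + 0" by (simp add: g order_rules(1))
          then show ?thesis using C CG q_p by blast
        next
          case 3
          then have "x l c * g = 1 * (g * x l c) + 0" using order_rules(3)[of i l c j] by (simp add: g)
          then show ?thesis using C CG by (metis mult_1_left)
        next
          case 4
          \<comment> \<open>Both factors of the correction precede entry \<open>k\<close>:
            \<open>x i c\<close> lies in an earlier row, and \<open>x l j\<close> in the same row
            further to the left.\<close>
          have "Suc i * N \<le> l * N" using 4(1) by (intro mult_le_mono1) simp
          then have "x i c \<in> alg G" "x l j \<in> alg G"
            using 4 \<open>c < N\<close> \<open>j < N\<close> km by (auto intro!: entry)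
          then have "(p + - 1 * q) * (x i c * x l j) \<in> alg G"
            by (intro alg.mult alg.add CG[OF C(5)] CG[OF C(3)] CG[OF C(4)])
          moreover have "x l c * g = 1 * (g * x l c) + (p + - 1 * q) * (x i c * x l j)"
            using 4 by (simp add: g order_rules(4) algebra_simps)
          ultimately show ?thesis using C by (metis mult_1_left)
        qed
      qed
    qed
  qed
  have "right_noetherian (alg (insert (x l c) G))"
  proof (rule right_noetherian_adjoin)
    show "right_noetherian (alg G)" using Suc by (simp add: G_def)
    show "0 \<in> G" "1 \<in> G" "- 1 \<in> G" using C by (simp_all add: G_def)
  next
    fix g assume g: "g \<in> G"
    then obtain u u' w where u: "u \<in> C" "u' \<in> C" "w \<in> alg G" "u' * u = 1" "x l c * g = u * (g * x l c) + w"
      using rel by blast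
    have "x l c * g = (u * g) * x l c + w" using u(5) by (simp only: mult.assoc)
    moreover have "u * g \<in> alg G" using CG[OF u(1)] g by (auto intro: alg.intros)
    ultimately show "\<exists>s\<in>alg G. \<exists>t\<in>alg G. x l c * g = s * x l c + t" using u(3) by blast
    have "u' * (x l c * g) = (u' * u) * (g * x l c) + u' * w"
      by (simp only: u(5) distrib_left mult.assoc)
    then have "g * x l c = u' * (x l c * g) + - 1 * (u' * w)" by (simp add: u(4))
    also have "u' * (x l c * g) = x l c * (u' * g)"
      by (simp only: mult.assoc[symmetric] C_central[OF u(2), of "x l c"])
    finally have "g * x l c = x l c * (u' * g) + - 1 * (u' * w)" .
    moreover have "u' * g \<in> alg G" "- 1 * (u' * w) \<in> alg G"
      by (intro alg.mult[OF CG[OF u(2)]] alg.mult[OF CG[OF C(3)]] alg.base[OF g] u(3))+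
    ultimately show "\<exists>s\<in>alg G. \<exists>t\<in>alg G. g * x l c = x l c * s + t" by blast
  qed
  moreover have "insert (x l c) G = C \<union> (\<lambda>m. x (m div N) (m mod N)) ` {..<Suc k}"
    by (auto simp: G_def l_def c_def lessThan_Suc)
  ultimately show ?case by simp
qed

end

section \<open>Quantum minors as sums over permutations\<close>

definition list_inversions :: "nat list \<Rightarrow> nat" where
  "list_inversions js = card {(a, b). a < b \<and> b < length js \<and> js ! a > js ! b}"

lemma list_inversions_Cons:
  assumes "distinct js"
  shows "list_inversions (j # js) = card {k \<in> set js. k < j} + list_inversions js"
proof -
  let ?A = "{b. b < length js \<and> js ! b < j}"
  let ?B = "{(a, b). a < b \<and> b < length js \<and> js ! a > js ! b}"
  have fin: "finite ?A" "finite ?B"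
    by (auto intro: finite_subset[of _ "{..<length js} \<times> {..<length js}"])
  have "{(a, b). a < b \<and> b < length (j # js) \<and> (j # js) ! a > (j # js) ! b} =
      (\<lambda>b. (0, Suc b)) ` ?A \<union> map_prod Suc Suc ` ?B"
  proof (rule Set.set_eqI)
    fix w :: "nat \<times> nat"
    obtain a b where "w = (a, b)" by (cases w)
    then show "w \<in> {(a, b). a < b \<and> b < length (j # js) \<and> (j # js) ! a > (j # js) ! b} \<longleftrightarrow>
        w \<in> (\<lambda>b. (0, Suc b)) ` ?A \<union> map_prod Suc Suc ` ?B"
      by (cases a; cases b) (auto simp: image_iff)
  qed
  then have "list_inversions (j # js) = card ((\<lambda>b. (0 :: nat, Suc b)) ` ?A \<union> map_prod Suc Suc ` ?B)"
    by (simp add: list_inversions_def)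
  also have "\<dots> = card ((\<lambda>b. (0 :: nat, Suc b)) ` ?A) + card (map_prod Suc Suc ` ?B)"
    using fin by (intro card_Un_disjoint) auto
  also have "card ((\<lambda>b. (0 :: nat, Suc b)) ` ?A) = card ?A"
    by (rule card_image) (auto simp: inj_on_def)
  also have "card (map_prod Suc Suc ` ?B) = card ?B"
    by (rule card_image) (auto simp: inj_on_def)
  also have "card ?A = card {k \<in> set js. k < j}"
  proof -
    have "inj_on ((!) js) ?A"
      using assms by (auto simp: inj_on_def nth_eq_iff_index_eq)
    moreover have "(!) js ` ?A = {k \<in> set js. k < j}"
      by (auto simp: in_set_conv_nth)
    ultimately show ?thesis by (metis card_image)
  qed
  finally show ?thesis by (simp add: list_inversions_def)
qed

context quantum_parameter
begin

text \<open>The head of the list is the column chosen by the outermost \<open>lmul\<close>, whose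
  exponent counts the inversions between the head and the rest.\<close>

lemma qdet_permutations_of_set:
  assumes "finite J" "length is = card J"
  shows "qdet x is J = (\<Sum>js\<in>permutations_of_set J.
    (- q) ^ list_inversions js * foldr (\<lambda>(i, j) y. x i j * y) (zip is js) 1)"
  using assms
proof (induction "is" arbitrary: J)
  case Nil
  then show ?case by (simp add: ext_one_def list_inversions_def)
next
  case (Cons i "is")
  let ?t = "\<lambda>is js. (- q) ^ list_inversions js * foldr (\<lambda>(i, j) y. x i j * y) (zip is js) 1"
  have "J \<noteq> {}" using Cons.prems by auto
  have summand: "?t (i # is) (j # js) = (- q) ^ card {m \<in> J. m < j} * (x i j * ?t is js)"
    if "j \<in> J" "js \<in> permutations_of_set (J - {j})" for j js
  proof -
    have "{k \<in> set js. k < j} = {m \<in> J. m < j}"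
      using permutations_of_setD(1)[OF that(2)] by auto
    then show ?thesis
      using list_inversions_Cons[OF permutations_of_setD(2)[OF that(2)], of j]
      by (simp add: power_add mult.assoc neg_q_power_left_commute[of "x i j"])
  qed
  have "(\<Sum>js\<in>permutations_of_set J. ?t (i # is) js) =
      (\<Sum>j\<in>J. \<Sum>js\<in>(#) j ` permutations_of_set (J - {j}). ?t (i # is) js)"
    unfolding permutations_of_set_nonempty[OF \<open>J \<noteq> {}\<close>]
    by (rule sum.UNION_disjoint) (use Cons.prems in auto)
  also have "\<dots> = (\<Sum>j\<in>J. \<Sum>js\<in>permutations_of_set (J - {j}). ?t (i # is) (j # js))"
    by (intro sum.cong refl sum.reindex_cong[of "(#) _"]) auto
  also have "\<dots> = (\<Sum>j\<in>J. (- q) ^ card {m \<in> J. m < j} *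
      (x i j * (\<Sum>js\<in>permutations_of_set (J - {j}). ?t is js)))"
    unfolding sum_distrib_left by (intro sum.cong refl summand)
  also have "\<dots> = qdet x (i # is) J"
    using Cons by (simp add: lmul_def)
  finally show ?case by simp
qed

lemma bij_betw_permutes_lists:
  fixes ls :: "nat list"
  assumes "sorted_wrt (<) ls" "set ls = J"
  shows "bij_betw (\<lambda>\<sigma>. map (\<lambda>a. ls ! \<sigma> a) [0..<length ls]) {\<sigma>. \<sigma> permutes {..<length ls}} (permutations_of_set J)"
proof -
  let ?f = "\<lambda>\<sigma>. map (\<lambda>a. ls ! \<sigma> a) [0..<length ls]"
  let ?P = "{\<sigma>. \<sigma> permutes {..<length ls}}"
  have dist: "distinct ls" using assms(1) by (simp add: strict_sorted_iff)
  have J: "finite J" "card J = length ls" using assms(2) distinct_card[OF dist] by auto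
  have less: "\<sigma> a < length ls" if "\<sigma> \<in> ?P" "a < length ls" for \<sigma> a
    using permutes_in_image[of \<sigma> "{..<length ls}" a] that by auto
  have inj: "inj_on ?f ?P"
  proof (rule inj_onI)
    fix \<sigma> \<tau> assume \<sigma>: "\<sigma> \<in> ?P" and \<tau>: "\<tau> \<in> ?P" and eq: "?f \<sigma> = ?f \<tau>"
    have "\<sigma> a = \<tau> a" for a
    proof (cases "a < length ls")
      case True
      then have "ls ! \<sigma> a = ls ! \<tau> a" using eq by (auto simp: map_eq_conv)
      then show ?thesis using less[OF \<sigma> True] less[OF \<tau> True] dist by (simp add: nth_eq_iff_index_eq)
    next
      case False
      then show ?thesis using \<sigma> \<tau> by (auto simp: permutes_def)
    qed
    then show "\<sigma> = \<tau>" by blast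
  qed
  have "?f \<sigma> \<in> permutations_of_set J" if "\<sigma> \<in> ?P" for \<sigma>
  proof (rule permutations_of_setI)
    have \<sigma>: "\<sigma> ` {..<length ls} = {..<length ls}" using that by (auto simp: permutes_image)
    have "set (?f \<sigma>) = (!) ls ` \<sigma> ` {..<length ls}" by (auto simp: image_iff)
    also have "\<dots> = set ls" unfolding \<sigma> by (auto simp: in_set_conv_nth)
    finally show "set (?f \<sigma>) = J" using assms(2) by simp
    show "distinct (?f \<sigma>)"
      using permutes_inj[of \<sigma>] that less[OF that] dist
      by (auto simp: distinct_map inj_on_def nth_eq_iff_index_eq)
  qed
  then have "?f ` ?P \<subseteq> permutations_of_set J" by blast
  moreover have "card (?f ` ?P) = card (permutations_of_set J)"
    using card_image[OF inj] card_permutations[of "{..<length ls}" "length ls"] J by simp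
  ultimately have "?f ` ?P = permutations_of_set J"
    by (intro card_subset_eq) auto
  with inj show ?thesis by (simp add: bij_betw_def)
qed

lemma qdet_permutes:
  assumes I: "finite I" and J: "finite J" and card: "card I = card J"
  shows "qdet x (sorted_list_of_set I) J = (\<Sum>\<sigma>\<in>{\<sigma>. \<sigma> permutes {..<card I}}.
    (- q) ^ num_inversions (card I) \<sigma> *
      foldr (\<lambda>a y. x (sorted_list_of_set I ! a) (sorted_list_of_set J ! \<sigma> a) * y) [0..<card I] 1)"
proof -
  let ?is = "sorted_list_of_set I" and ?js = "sorted_list_of_set J"
  let ?f = "\<lambda>\<sigma>. map (\<lambda>a. ?js ! \<sigma> a) [0..<card I]"
  have js: "sorted_wrt (<) ?js" "set ?js = J" "length ?js = card I" using J card by auto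
  have bij: "bij_betw ?f {\<sigma>. \<sigma> permutes {..<card I}} (permutations_of_set J)"
    using bij_betw_permutes_lists[OF js(1,2)] js(3) by simp
  have "qdet x ?is J = (\<Sum>js\<in>permutations_of_set J.
      (- q) ^ list_inversions js * foldr (\<lambda>(i, j) y. x i j * y) (zip ?is js) 1)"
    using J card by (intro qdet_permutations_of_set) simp_all
  also have "\<dots> = (\<Sum>\<sigma>\<in>{\<sigma>. \<sigma> permutes {..<card I}}.
      (- q) ^ list_inversions (?f \<sigma>) * foldr (\<lambda>(i, j) y. x i j * y) (zip ?is (?f \<sigma>)) 1)"
    by (rule sum.reindex_bij_betw[OF bij, symmetric])
  also have "\<dots> = (\<Sum>\<sigma>\<in>{\<sigma>. \<sigma> permutes {..<card I}}.
    (- q) ^ num_inversions (card I) \<sigma> * foldr (\<lambda>a y. x (?is ! a) (?js ! \<sigma> a) * y) [0..<card I] 1)"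
  proof (rule sum.cong[OF refl])
    fix \<sigma> assume "\<sigma> \<in> {\<sigma>. \<sigma> permutes {..<card I}}"
    then have less: "\<sigma> a < card I" if "a < card I" for a
      using permutes_in_image[of \<sigma> "{..<card I}" a] that by auto
    have mono: "?js ! a < ?js ! b \<longleftrightarrow> a < b" if "a < card I" "b < card I" for a b
      using that sorted_wrt_nth_less[OF js(1), of a b] sorted_wrt_nth_less[OF js(1), of b a] js(3)
      by (cases a b rule: linorder_cases) auto
    have "list_inversions (?f \<sigma>) = num_inversions (card I) \<sigma>"
      unfolding list_inversions_def num_inversions_def
      by (rule arg_cong[of _ _ card]) (auto simp: mono less)
    moreover have "zip ?is (?f \<sigma>) = map (\<lambda>a. (?is ! a, ?js ! \<sigma> a)) [0..<card I]"
      by (rule nth_equalityI) auto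
    ultimately show "(- q) ^ list_inversions (?f \<sigma>) * foldr (\<lambda>(i, j) y. x i j * y) (zip ?is (?f \<sigma>)) 1 =
        (- q) ^ num_inversions (card I) \<sigma> * foldr (\<lambda>a y. x (?is ! a) (?js ! \<sigma> a) * y) [0..<card I] 1"
      by (simp add: foldr_map comp_def)
  qed
  finally show ?thesis .
qed

end

section \<open>The quantum matrix algebra as a ring\<close>

lemma free_algebra_simps [simp]:
  "zero (free_algebra L) = 0" "one (free_algebra L) = 1"
  "monoid.mult (free_algebra L) = (*)" "add (free_algebra L) = (+)"
  by (simp_all add: free_algebra_def)

lemma carrier_free_algebra: "g \<in> carrier (free_algebra L) \<longleftrightarrow> (\<forall>w\<in>Poly_Mapping.keys g. set (letters w) \<subseteq> L)"
  by (simp add: free_algebra_def)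

lemma free_algebra_closed:
  fixes g h :: "'a word \<Rightarrow>\<^sub>0 'k::field"
  shows "0 \<in> carrier (free_algebra L)" "1 \<in> carrier (free_algebra L)"
    and "g \<in> carrier (free_algebra L) \<Longrightarrow> h \<in> carrier (free_algebra L) \<Longrightarrow> g + h \<in> carrier (free_algebra L)"
    and "g \<in> carrier (free_algebra L) \<Longrightarrow> h \<in> carrier (free_algebra L) \<Longrightarrow> g * h \<in> carrier (free_algebra L)"
    and "g \<in> carrier (free_algebra L) \<Longrightarrow> - g \<in> carrier (free_algebra L)"
proof -
  show "0 \<in> carrier (free_algebra L)" "1 \<in> carrier (free_algebra L)"
    "g \<in> carrier (free_algebra L) \<Longrightarrow> - g \<in> carrier (free_algebra L)"
    by (simp_all add: carrier_free_algebra zero_word_def)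
  assume gh: "g \<in> carrier (free_algebra L)" "h \<in> carrier (free_algebra L)"
  then show "g + h \<in> carrier (free_algebra L)"
    using keys_add[of g h] by (auto simp: carrier_free_algebra)
  show "g * h \<in> carrier (free_algebra L)"
    unfolding carrier_free_algebra
  proof
    fix w assume "w \<in> Poly_Mapping.keys (g * h)"
    then obtain u v where "w = u + v" "u \<in> Poly_Mapping.keys g" "v \<in> Poly_Mapping.keys h"
      using keys_mult[of g h] by blast
    then show "set (letters w) \<subseteq> L"
      using gh by (auto simp: plus_word_def carrier_free_algebra)
  qed
qed

lemma ring_free_algebra: "ring (free_algebra L :: ('a word \<Rightarrow>\<^sub>0 'k::field) ring)"
proof (rule ringI)
  let ?F = "free_algebra L :: ('a word \<Rightarrow>\<^sub>0 'k) ring"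
  show "abelian_group ?F"
  proof (rule abelian_groupI)
    fix g assume "g \<in> carrier ?F"
    then show "\<exists>h\<in>carrier ?F. h \<oplus>\<^bsub>?F\<^esub> g = \<zero>\<^bsub>?F\<^esub>"
      by (intro bexI[of _ "- g"]) (simp_all add: free_algebra_closed)
  qed (simp_all add: free_algebra_closed ac_simps)
  show "monoid ?F"
    by (rule monoidI) (simp_all add: free_algebra_closed mult.assoc)
qed (simp_all add: distrib_left distrib_right)

lemma fa_carrier:
  shows fa_gen_carrier: "i \<in> {1..n} \<Longrightarrow> j \<in> {1..n} \<Longrightarrow> fa_gen i j \<in> carrier (qmat_free n TYPE('k::field))"
    and fa_const_carrier: "fa_const (c :: 'k) \<in> carrier (qmat_free n TYPE('k))"
  by (simp_all add: qmat_free_def carrier_free_algebra fa_gen_def fa_const_def zero_word_def)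

lemma fa_const_mult: "fa_const c * fa_const d = fa_const (c * d)"
  and fa_const_add: "fa_const c + fa_const d = fa_const (c + d)"
  and fa_const_one: "fa_const 1 = 1"
  by (simp_all add: fa_const_def mult_single single_add)

lemma update_conv_add:
  "a \<notin> Poly_Mapping.keys g \<Longrightarrow> Poly_Mapping.update a b g = g + Poly_Mapping.single a b"
  by (rule poly_mapping_eqI) (auto simp: lookup_update lookup_add lookup_single in_keys_iff)

lemma fa_const_central: "fa_const c * g = g * fa_const c"
proof (induction g rule: update_induct)
  case (update g a b)
  have "fa_const c * Poly_Mapping.single a b = Poly_Mapping.single a b * fa_const c"
    by (simp add: fa_const_def mult_single mult.commute)
  with update show ?case
    by (simp add: update_conv_add distrib_left distrib_right)
qed simp

lemma qmat_rels_carrier: "qmat_rels n q \<subseteq> carrier (qmat_free n TYPE('k))" for q :: "'k::field"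
proof -
  interpret ring "qmat_free n TYPE('k)" unfolding qmat_free_def by (rule ring_free_algebra)
  have minus: "g - h \<in> carrier (qmat_free n TYPE('k))"
    if "g \<in> carrier (qmat_free n TYPE('k))" "h \<in> carrier (qmat_free n TYPE('k))" for g h
    using that free_algebra_closed(3,5)[where L = "{1..n} \<times> {1..n}"]
    by (metis qmat_free_def uminus_add_conv_diff add.commute)
  have mult: "g * h \<in> carrier (qmat_free n TYPE('k))"
    if "g \<in> carrier (qmat_free n TYPE('k))" "h \<in> carrier (qmat_free n TYPE('k))" for g h
    using that free_algebra_closed(4) by (auto simp: qmat_free_def)
  show ?thesis
    unfolding qmat_rels_def by (auto intro!: minus mult fa_gen_carrier fa_const_carrier simp del: atLeastAtMost_iff)
qed

lemma ideal_qmat_ideal: "ideal (qmat_ideal n q) (qmat_free n TYPE('k))" for q :: "'k::field"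
  unfolding qmat_ideal_def
  by (rule ring.genideal_ideal[OF _ qmat_rels_carrier]) (simp add: qmat_free_def ring_free_algebra)

lemma ring_qmat: "ring (qmat n q)"
  unfolding qmat_def by (rule ideal.quotient_is_ring[OF ideal_qmat_ideal])

lemma qmat_proj_hom: "qmat_proj n q \<in> ring_hom (qmat_free n TYPE('k)) (qmat n q)" for q :: "'k::field"
  using ideal.rcos_ring_hom[OF ideal_qmat_ideal, of n q] by (simp add: qmat_def qmat_proj_def[abs_def])

lemma qmat_proj_surj:
  fixes q :: "'k::field"
  assumes "y \<in> carrier (qmat n q)"
  shows "\<exists>g\<in>carrier (qmat_free n TYPE('k)). y = qmat_proj n q g"
  using assms by (auto simp: qmat_def qmat_proj_def FactRing_def A_RCOSETS_def')

lemma qmat_proj_rel: "g \<in> qmat_rels n q \<Longrightarrow> qmat_proj n q g = \<zero>\<^bsub>qmat n q\<^esub>" for q :: "'k::field"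
proof -
  interpret I: ideal "qmat_ideal n q" "qmat_free n TYPE('k)" by (rule ideal_qmat_ideal)
  assume "g \<in> qmat_rels n q"
  then have "g \<in> qmat_ideal n q" by (auto simp: qmat_ideal_def genideal_def)
  then show ?thesis
    by (simp add: qmat_proj_def qmat_def FactRing_def I.a_rcos_const)
qed

text \<open>Put \<open>S = {u. u R b \<subseteq> P}\<close> and
  \<open>T = {v. S R v \<subseteq> P}\<close>. Both are two-sided ideals; \<open>a\<close> lies in
  \<open>S\<close> by assumption, \<open>b\<close> lies in \<open>T\<close> by the definition of
  \<open>S\<close>, and the middle factor 1 shows that their product is contained in
  \<open>P\<close>.\<close>

lemma prime_ideal_elementwise:
  assumes R: "ring R" and P: "prime_ideal P R" and ab: "a \<in> carrier R" "b \<in> carrier R"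
    and zero: "\<And>c. c \<in> carrier R \<Longrightarrow> a \<otimes>\<^bsub>R\<^esub> c \<otimes>\<^bsub>R\<^esub> b \<in> P"
  shows "a \<in> P \<or> b \<in> P"
proof -
  interpret ring R by (rule R)
  interpret P: ideal P R using P by (simp add: prime_ideal_def)
  define S where "S = {u \<in> carrier R. \<forall>c\<in>carrier R. u \<otimes>\<^bsub>R\<^esub> c \<otimes>\<^bsub>R\<^esub> b \<in> P}"
  define T where "T = {v \<in> carrier R. \<forall>u\<in>S. \<forall>c\<in>carrier R. u \<otimes>\<^bsub>R\<^esub> c \<otimes>\<^bsub>R\<^esub> v \<in> P}"
  have S_car: "S \<subseteq> carrier R" by (auto simp: S_def)
  have S: "ideal S R"
  proof (rule idealI)
    show "subgroup S (add_monoid R)"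
    proof (rule add.subgroupI)
      show "S \<noteq> {}" using ab(2) by (auto simp: S_def intro!: exI[of _ "\<zero>\<^bsub>R\<^esub>"])
    qed (use ab(2) in \<open>auto simp: S_def l_distr l_minus intro: P.a_closed P.a_inv_closed\<close>)
    show "x \<otimes>\<^bsub>R\<^esub> u \<in> S" if "u \<in> S" "x \<in> carrier R" for u x
    proof -
      have "x \<otimes>\<^bsub>R\<^esub> u \<otimes>\<^bsub>R\<^esub> c \<otimes>\<^bsub>R\<^esub> b \<in> P" if "c \<in> carrier R" for c
      proof -
        have "x \<otimes>\<^bsub>R\<^esub> (u \<otimes>\<^bsub>R\<^esub> c \<otimes>\<^bsub>R\<^esub> b) \<in> P"
          using \<open>u \<in> S\<close> \<open>x \<in> carrier R\<close> that by (intro P.I_l_closed[of "u \<otimes>\<^bsub>R\<^esub> c \<otimes>\<^bsub>R\<^esub> b"]) (simp_all add: S_def)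
        then show ?thesis using \<open>u \<in> S\<close> \<open>x \<in> carrier R\<close> that ab(2) by (simp add: S_def m_assoc)
      qed
      then show ?thesis using that by (simp add: S_def)
    qed
    show "u \<otimes>\<^bsub>R\<^esub> x \<in> S" if "u \<in> S" "x \<in> carrier R" for u x
    proof -
      have "u \<otimes>\<^bsub>R\<^esub> x \<otimes>\<^bsub>R\<^esub> c \<otimes>\<^bsub>R\<^esub> b \<in> P" if "c \<in> carrier R" for c
      proof -
        have "u \<otimes>\<^bsub>R\<^esub> (x \<otimes>\<^bsub>R\<^esub> c) \<otimes>\<^bsub>R\<^esub> b \<in> P"
          using \<open>u \<in> S\<close> \<open>x \<in> carrier R\<close> that by (simp add: S_def)
        then show ?thesis using \<open>u \<in> S\<close> \<open>x \<in> carrier R\<close> that by (simp add: S_def m_assoc)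
      qed
      then show ?thesis using that by (simp add: S_def)
    qed
  qed (rule R)
  have T: "ideal T R"
  proof (rule idealI)
    show "subgroup T (add_monoid R)"
    proof (rule add.subgroupI)
      show "T \<noteq> {}" using S_car by (auto simp: T_def intro!: exI[of _ "\<zero>\<^bsub>R\<^esub>"])
    qed (use S_car in \<open>auto simp: T_def r_distr r_minus subset_iff intro: P.a_closed P.a_inv_closed\<close>)
    show "v \<otimes>\<^bsub>R\<^esub> x \<in> T" if "v \<in> T" "x \<in> carrier R" for v x
    proof -
      have "u \<otimes>\<^bsub>R\<^esub> c \<otimes>\<^bsub>R\<^esub> (v \<otimes>\<^bsub>R\<^esub> x) \<in> P" if "u \<in> S" "c \<in> carrier R" for u c
      proof -
        have "u \<otimes>\<^bsub>R\<^esub> c \<otimes>\<^bsub>R\<^esub> v \<otimes>\<^bsub>R\<^esub> x \<in> P"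
          using \<open>v \<in> T\<close> \<open>x \<in> carrier R\<close> that by (intro P.I_r_closed[of "u \<otimes>\<^bsub>R\<^esub> c \<otimes>\<^bsub>R\<^esub> v"]) (simp_all add: T_def)
        then show ?thesis
          using \<open>v \<in> T\<close> \<open>x \<in> carrier R\<close> that S_car by (simp add: T_def m_assoc subset_iff)
      qed
      then show ?thesis using that by (simp add: T_def)
    qed
    show "x \<otimes>\<^bsub>R\<^esub> v \<in> T" if "v \<in> T" "x \<in> carrier R" for v x
    proof -
      have "u \<otimes>\<^bsub>R\<^esub> c \<otimes>\<^bsub>R\<^esub> (x \<otimes>\<^bsub>R\<^esub> v) \<in> P" if "u \<in> S" "c \<in> carrier R" for u c
      proof -
        have "u \<otimes>\<^bsub>R\<^esub> (c \<otimes>\<^bsub>R\<^esub> x) \<otimes>\<^bsub>R\<^esub> v \<in> P"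
          using \<open>v \<in> T\<close> \<open>x \<in> carrier R\<close> that by (simp add: T_def)
        then show ?thesis using \<open>v \<in> T\<close> \<open>x \<in> carrier R\<close> that S_car by (simp add: T_def m_assoc subset_iff)
      qed
      then show ?thesis using that by (simp add: T_def)
    qed
  qed (rule R)
  have uv: "u \<otimes>\<^bsub>R\<^esub> v \<in> P" if "u \<in> S" "v \<in> T" for u v
  proof -
    have "u \<otimes>\<^bsub>R\<^esub> \<one>\<^bsub>R\<^esub> \<otimes>\<^bsub>R\<^esub> v \<in> P" using that by (simp add: T_def)
    then show ?thesis using that S_car by (simp add: subset_iff)
  qed
  have "w \<in> P" if "w \<in> S \<cdot>\<^bsub>R\<^esub> T" for w
    using that by (induction rule: ideal_prod.induct) (auto intro: uv P.a_closed)
  then have "S \<subseteq> P \<or> T \<subseteq> P"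
    using P S T unfolding prime_ideal_def by blast
  moreover have "a \<in> S" using ab zero by (simp add: S_def)
  moreover have "b \<in> T" using ab by (simp add: T_def S_def)
  ultimately show ?thesis by blast
qed

section \<open>Prime quotients of the quantum matrix algebra\<close>

text \<open>The matrix arguments live in a type of class \<open>ring_1\<close>, whereas quotients
  are rings on carrier sets; \<open>f\<close> identifies the carrier with the whole type.\<close>

locale ring_copy =
  fixes R :: "'a ring" and f :: "'a \<Rightarrow> 'b::ring_1"
  assumes ring_R: "ring R"
    and f_bij: "bij_betw f (carrier R) UNIV"
    and f_mult: "a \<in> carrier R \<Longrightarrow> b \<in> carrier R \<Longrightarrow> f (a \<otimes>\<^bsub>R\<^esub> b) = f a * f b"
    and f_add: "a \<in> carrier R \<Longrightarrow> b \<in> carrier R \<Longrightarrow> f (a \<oplus>\<^bsub>R\<^esub> b) = f a + f b"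
    and f_one: "f \<one>\<^bsub>R\<^esub> = 1"
begin

lemma f_zero: "f \<zero>\<^bsub>R\<^esub> = 0"
  using f_add[of "\<zero>\<^bsub>R\<^esub>" "\<zero>\<^bsub>R\<^esub>"] ring.ring_simprules(2,8)[OF ring_R] by simp

lemma f_surj: "\<exists>a\<in>carrier R. f a = b"
proof -
  have "b \<in> f ` carrier R" using f_bij by (simp add: bij_betw_def)
  then show ?thesis by blast
qed

lemma f_zero_iff: "a \<in> carrier R \<Longrightarrow> f a = 0 \<longleftrightarrow> a = \<zero>\<^bsub>R\<^esub>"
  using f_bij f_zero ring.ring_simprules(2)[OF ring_R] by (metis bij_betw_def inj_on_eq_iff)

end

locale qmat_quotient = ring_copy "qmat n q Quot P" f
  for n :: nat and q :: "'k::field" and P and f :: "((nat \<times> nat) word \<Rightarrow>\<^sub>0 'k) set set \<Rightarrow> 'b::ring_1" +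
  assumes P: "ideal P (qmat n q)"
    and q_nonzero: "q \<noteq> 0"
begin

sublocale A: ring "qmat n q" by (rule ring_qmat)
sublocale P: ideal P "qmat n q" by (rule P)

definition cls :: "((nat \<times> nat) word \<Rightarrow>\<^sub>0 'k) set \<Rightarrow> 'b" where
  "cls y = f (P +>\<^bsub>qmat n q\<^esub> y)"

definition pr :: "((nat \<times> nat) word \<Rightarrow>\<^sub>0 'k) \<Rightarrow> 'b" where
  "pr g = cls (qmat_proj n q g)"

abbreviation "F \<equiv> qmat_free n TYPE('k)"

lemma
  assumes "y \<in> carrier (qmat n q)" "z \<in> carrier (qmat n q)"
  shows cls_mult: "cls (y \<otimes>\<^bsub>qmat n q\<^esub> z) = cls y * cls z"
    and cls_add: "cls (y \<oplus>\<^bsub>qmat n q\<^esub> z) = cls y + cls z"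
  unfolding cls_def ring_hom_mult[OF P.rcos_ring_hom assms] ring_hom_add[OF P.rcos_ring_hom assms]
  by (rule f_mult f_add; rule ring_hom_closed[OF P.rcos_ring_hom]; rule assms)+

lemma cls_one: "cls \<one>\<^bsub>qmat n q\<^esub> = 1"
  using ring_hom_one[OF P.rcos_ring_hom] f_one by (simp add: cls_def)

lemma cls_zero_iff: "y \<in> carrier (qmat n q) \<Longrightarrow> cls y = 0 \<longleftrightarrow> y \<in> P"
proof -
  assume y: "y \<in> carrier (qmat n q)"
  have "cls y = 0 \<longleftrightarrow> P +>\<^bsub>qmat n q\<^esub> y = P"
    unfolding cls_def f_zero_iff[OF ring_hom_closed[OF P.rcos_ring_hom y]] by (simp add: FactRing_def)
  also have "\<dots> \<longleftrightarrow> y \<in> P"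
    using P.rcos_const_imp_mem[OF y] P.a_rcos_const[of y] by blast
  finally show ?thesis .
qed

lemma cls_zero: "cls \<zero>\<^bsub>qmat n q\<^esub> = 0"
  by (simp add: cls_zero_iff)

lemma cls_surj: "\<exists>y\<in>carrier (qmat n q). cls y = b"
proof -
  obtain Y where "Y \<in> carrier (qmat n q Quot P)" "f Y = b"
    using f_surj by blast
  then show ?thesis by (auto simp: cls_def FactRing_def A_RCOSETS_def')
qed

lemma pr_surj: "\<exists>g\<in>carrier F. pr g = b"
  using cls_surj qmat_proj_surj unfolding pr_def by metis

lemma proj_closed: "g \<in> carrier F \<Longrightarrow> qmat_proj n q g \<in> carrier (qmat n q)"
  by (rule ring_hom_closed[OF qmat_proj_hom])

lemma F_closed:
  "g \<in> carrier F \<Longrightarrow> h \<in> carrier F \<Longrightarrow> g + h \<in> carrier F"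
  "g \<in> carrier F \<Longrightarrow> h \<in> carrier F \<Longrightarrow> g * h \<in> carrier F"
  "g \<in> carrier F \<Longrightarrow> h \<in> carrier F \<Longrightarrow> g - h \<in> carrier F"
proof -
  show c: "g \<in> carrier F \<Longrightarrow> h \<in> carrier F \<Longrightarrow> g + h \<in> carrier F"
    "g \<in> carrier F \<Longrightarrow> h \<in> carrier F \<Longrightarrow> g * h \<in> carrier F" for g h
    by (simp_all add: qmat_free_def free_algebra_closed)
  show "g \<in> carrier F \<Longrightarrow> h \<in> carrier F \<Longrightarrow> g - h \<in> carrier F"
    using c(1)[of g "- h"] by (simp add: qmat_free_def free_algebra_closed)
qed

lemma
  assumes "g \<in> carrier F" "h \<in> carrier F"
  shows pr_mult: "pr (g * h) = pr g * pr h" and pr_add: "pr (g + h) = pr g + pr h"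
  using ring_hom_mult[OF qmat_proj_hom assms, of q] ring_hom_add[OF qmat_proj_hom assms, of q]
    cls_mult[OF proj_closed[OF assms(1)] proj_closed[OF assms(2)]]
    cls_add[OF proj_closed[OF assms(1)] proj_closed[OF assms(2)]]
  by (simp_all add: pr_def qmat_free_def)

lemma pr_diff: "g \<in> carrier F \<Longrightarrow> h \<in> carrier F \<Longrightarrow> pr (g - h) = pr g - pr h"
  using pr_add[of "g - h" h] by (simp add: F_closed)

lemma pr_one: "pr 1 = 1"
  using ring_hom_one[OF qmat_proj_hom, of n q] cls_one by (simp add: pr_def qmat_free_def)

definition k_of :: "'k \<Rightarrow> 'b" where
  "k_of c = pr (fa_const c)"

definition X :: "nat \<Rightarrow> nat \<Rightarrow> 'b" where
  "X i j = (if i \<in> {1..n} \<and> j \<in> {1..n} then pr (fa_gen i j) else 0)"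

lemma k_of_mult: "k_of (c * d) = k_of c * k_of d"
  and k_of_add: "k_of (c + d) = k_of c + k_of d"
  and k_of_one: "k_of 1 = 1"
  unfolding k_of_def by (simp_all add: fa_const_mult[symmetric] fa_const_add[symmetric] pr_mult pr_add
      fa_const_carrier fa_const_one pr_one)

lemma k_of_zero: "k_of 0 = 0"
  using k_of_add[of 0 0] by simp

lemma k_of_minus: "k_of (- c) = - k_of c"
  using k_of_add[of c "- c"] by (simp add: k_of_zero eq_neg_iff_add_eq_0 add.commute)

lemma k_of_diff: "k_of (c - d) = k_of c - k_of d"
  using k_of_add[of "c - d" d] by simp

lemma k_of_power: "k_of (c ^ m) = k_of c ^ m"
  by (induction m) (simp_all add: k_of_one k_of_mult)

lemma k_of_central: "y * k_of c = k_of c * y"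
proof -
  obtain g where "g \<in> carrier F" "pr g = y" using pr_surj by blast
  then show ?thesis
    using pr_mult[of g "fa_const c"] pr_mult[of "fa_const c" g] fa_const_central[of c g]
    by (simp add: k_of_def fa_const_carrier)
qed

lemma k_of_inverse: "c \<noteq> 0 \<Longrightarrow> k_of c * k_of (inverse c) = 1"
  by (simp add: k_of_mult[symmetric] k_of_one)

lemma pr_eq_of_rel:
  assumes "g - h \<in> qmat_rels n q" "g \<in> carrier F" "h \<in> carrier F"
  shows "pr g = pr h"
proof -
  have "pr (g - h) = 0"
    using qmat_proj_rel[OF assms(1)] cls_zero by (simp add: pr_def)
  then show ?thesis using assms(2,3) by (simp add: pr_diff)
qed

lemma pr_gen: "i \<in> {1..n} \<Longrightarrow> j \<in> {1..n} \<Longrightarrow> pr (fa_gen i j) = X i j"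
  by (simp add: X_def)

lemmas pr_simps = pr_mult pr_diff pr_add F_closed fa_gen_carrier fa_const_carrier pr_gen k_of_def[symmetric]

lemma quantum_matrix_X:
  assumes "q \<noteq> 1" "q \<noteq> - 1"
  shows "quantum_matrix (k_of q) (k_of (inverse q)) X"
proof unfold_locales
  show "y * k_of q = k_of q * y" "y * k_of (inverse q) = k_of (inverse q) * y" for y
    by (rule k_of_central)+
  show "k_of q * k_of (inverse q) = 1" using q_nonzero by (rule k_of_inverse)
  have "q * q \<noteq> 1" using assms by (simp add: square_eq_1_iff)
  then have "q - inverse q \<noteq> 0" using q_nonzero by (simp add: field_simps)
  from k_of_inverse[OF this] show "\<exists>w. w * (k_of q - k_of (inverse q)) = 1"
    by (metis k_of_central k_of_diff)
next
  fix i l j :: nat assume "i < l"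
  show "X i j * X l j = k_of q * (X l j * X i j)"
  proof (cases "i \<in> {1..n} \<and> l \<in> {1..n} \<and> j \<in> {1..n}")
    case True
    then have "pr (fa_gen i j * fa_gen l j) = pr (fa_const q * (fa_gen l j * fa_gen i j))"
      using \<open>i < l\<close> by (intro pr_eq_of_rel) (unfold qmat_rels_def, blast, (intro F_closed fa_gen_carrier fa_const_carrier; simp)+)
    then show ?thesis using True by (simp add: pr_simps del: atLeastAtMost_iff)
  qed (auto simp: X_def)
next
  fix i j m :: nat assume "j < m"
  show "X i j * X i m = k_of q * (X i m * X i j)"
  proof (cases "i \<in> {1..n} \<and> j \<in> {1..n} \<and> m \<in> {1..n}")
    case True
    then have "pr (fa_gen i j * fa_gen i m) = pr (fa_const q * (fa_gen i m * fa_gen i j))"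
      using \<open>j < m\<close> by (intro pr_eq_of_rel) (unfold qmat_rels_def, blast, (intro F_closed fa_gen_carrier fa_const_carrier; simp)+)
    then show ?thesis using True by (simp add: pr_simps del: atLeastAtMost_iff)
  qed (auto simp: X_def)
next
  fix i l j m :: nat assume "i < l" "m < j"
  show "X i j * X l m = X l m * X i j"
  proof (cases "i \<in> {1..n} \<and> j \<in> {1..n} \<and> l \<in> {1..n} \<and> m \<in> {1..n}")
    case True
    then have "pr (fa_gen i j * fa_gen l m) = pr (fa_gen l m * fa_gen i j)"
      using \<open>i < l\<close> \<open>m < j\<close> by (intro pr_eq_of_rel) (unfold qmat_rels_def, blast, (intro F_closed fa_gen_carrier fa_const_carrier; simp)+)
    then show ?thesis using True by (simp add: pr_simps del: atLeastAtMost_iff)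
  qed (auto simp: X_def)
next
  fix i l j m :: nat assume "i < l" "j < m"
  show "X i j * X l m - X l m * X i j = (k_of q - k_of (inverse q)) * (X i m * X l j)"
  proof (cases "i \<in> {1..n} \<and> j \<in> {1..n} \<and> l \<in> {1..n} \<and> m \<in> {1..n}")
    case True
    then have "pr (fa_gen i j * fa_gen l m - fa_gen l m * fa_gen i j) =
        pr (fa_const (q - inverse q) * (fa_gen i m * fa_gen l j))"
      using \<open>i < l\<close> \<open>j < m\<close> by (intro pr_eq_of_rel) (unfold qmat_rels_def, blast, (intro F_closed fa_gen_carrier fa_const_carrier; simp)+)
    then show ?thesis using True by (simp add: pr_simps k_of_diff[symmetric] del: atLeastAtMost_iff)
  qed (auto simp: X_def)
qed

lemma finite_X: "finite {i. \<exists>j. X i j \<noteq> 0}"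
  by (rule finite_subset[of _ "{1..n}"]) (auto simp: X_def)

lemma pr_word:
  assumes "set ls \<subseteq> {1..n} \<times> {1..n}" "\<And>i j. X i j \<in> alg G" "\<And>c. k_of c \<in> alg G"
  shows "Poly_Mapping.single (Word ls) b \<in> carrier F \<and> pr (Poly_Mapping.single (Word ls) b) \<in> alg G"
  using assms(1)
proof (induction ls)
  case Nil
  have "Poly_Mapping.single (Word []) b = (fa_const b :: (nat \<times> nat) word \<Rightarrow>\<^sub>0 'k)" by (simp add: fa_const_def zero_word_def)
  then show ?case using assms(3)[of b] fa_const_carrier[of b n] by (simp add: k_of_def)
next
  case (Cons l ls)
  obtain i j where l: "l = (i, j)" "i \<in> {1..n}" "j \<in> {1..n}" using Cons.prems by auto
  have eq: "Poly_Mapping.single (Word (l # ls)) b = fa_gen i j * Poly_Mapping.single (Word ls) b"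
    by (simp add: fa_gen_def mult_single plus_word_def l(1))
  have IH: "Poly_Mapping.single (Word ls) b \<in> carrier F" "pr (Poly_Mapping.single (Word ls) b) \<in> alg G"
    using Cons by auto
  show ?case
    unfolding eq using IH l assms(2)[of i j]
    by (simp add: pr_mult fa_gen_carrier F_closed pr_gen alg.mult del: atLeastAtMost_iff)
qed

lemma alg_UNIV:
  assumes "\<And>i j. X i j \<in> alg G" "\<And>c. k_of c \<in> alg G"
  shows "alg G = UNIV"
proof -
  have "pr g \<in> alg G" if "g \<in> carrier F" for g
    using that
  proof (induction g rule: update_induct)
    case const
    have "pr 0 = k_of 0" by (simp add: k_of_def fa_const_def)
    then show ?case using assms(2)[of 0] by simp
  next
    case (update g a b)
    have g: "g \<in> carrier F" and a: "set (letters a) \<subseteq> {1..n} \<times> {1..n}"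
      using update.prems update.hyps by (auto simp: qmat_free_def carrier_free_algebra keys_update)
    have "Poly_Mapping.single a b \<in> carrier F \<and> pr (Poly_Mapping.single a b) \<in> alg G"
      using pr_word[OF a assms, of b] by (cases a) simp
    then show ?case
      using update g by (simp add: update_conv_add pr_add alg.add)
  qed
  then show ?thesis using pr_surj by (metis UNIV_eq_I)
qed

lemma noetherian:
  assumes "q \<noteq> 1" "q \<noteq> - 1"
  shows "right_noetherian (UNIV :: 'b set)"
proof -
  interpret quantum_matrix "k_of q" "k_of (inverse q)" X by (rule quantum_matrix_X[OF assms])
  \<comment> \<open>Indices run from 1 to \<open>n\<close>, so columns are digits in base
    \<open>Suc n\<close>, and \<open>i * N + j\<close> encodes the position
    \<open>(i, j)\<close>.\<close>
  define N where "N = Suc n"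
  define G where "G = range k_of \<union> (\<lambda>m. X (m div N) (m mod N)) ` {..<N * N}"
  have k_range: "k_of c \<in> range k_of" for c by simp
  have "right_noetherian (alg G)"
    unfolding G_def
  proof (rule quantum_right_noetherian)
    show "0 \<in> range k_of" "1 \<in> range k_of" "- 1 \<in> range k_of"
      using k_range[of 0] k_range[of 1] k_range[of "- 1"] by (simp_all add: k_of_zero k_of_one k_of_minus)
    show "c + d \<in> range k_of" if "c \<in> range k_of" "d \<in> range k_of" for c d
      using that by (auto simp: k_of_add[symmetric])
    show "c * d \<in> range k_of" if "c \<in> range k_of" "d \<in> range k_of" for c d
      using that by (auto simp: k_of_mult[symmetric])
    show "y * c = c * y" if "c \<in> range k_of" for c y
      using that k_of_central by blast
    show "\<exists>d\<in>range k_of. c * d = 1" if "c \<in> range k_of" "c \<noteq> 0" for c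
    proof -
      obtain a where "c = k_of a" "a \<noteq> 0" using \<open>c \<in> range k_of\<close> \<open>c \<noteq> 0\<close> k_of_zero by auto
      then show ?thesis using k_of_inverse by blast
    qed
  qed simp_all
  moreover have "alg G = UNIV"
  proof (rule alg_UNIV)
    show k: "k_of c \<in> alg G" for c by (auto simp: G_def intro: alg.base)
    show "X i j \<in> alg G" for i j
    proof (cases "i \<in> {1..n} \<and> j \<in> {1..n}")
      case True
      have "j < N" using True by (simp add: N_def)
      then have "(i * N + j) div N = i" "(i * N + j) mod N = j" by simp_all
      moreover have "i * N + j < N * N"
      proof -
        have "i * N + j < i * N + N" using True by (simp add: N_def)
        also have "\<dots> = Suc i * N" by simp
        also have "\<dots> \<le> N * N" using True by (intro mult_le_mono1) (simp add: N_def)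
        finally show ?thesis .
      qed
      ultimately show ?thesis by (intro alg.base) (force simp: G_def image_iff)
    next
      case False
      then show ?thesis using k[of 0] by (auto simp: X_def k_of_zero)
    qed
  qed
  ultimately show ?thesis by simp
qed

section \<open>Quantum minors in the quotient and the resulting stratum\<close>

lemma cls_qX: "i \<in> {1..n} \<Longrightarrow> j \<in> {1..n} \<Longrightarrow> qX n q i j \<in> carrier (qmat n q) \<and> cls (qX n q i j) = X i j"
  using proj_closed[OF fa_gen_carrier] by (simp add: qX_def X_def pr_def)

lemma cls_foldr:
  assumes "\<And>a. a \<in> set as \<Longrightarrow> g a \<in> carrier (qmat n q)"
  shows "foldr (\<lambda>a y. g a \<otimes>\<^bsub>qmat n q\<^esub> y) as \<one>\<^bsub>qmat n q\<^esub> \<in> carrier (qmat n q) \<and>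
    cls (foldr (\<lambda>a y. g a \<otimes>\<^bsub>qmat n q\<^esub> y) as \<one>\<^bsub>qmat n q\<^esub>) = foldr (\<lambda>a y. cls (g a) * y) as 1"
  using assms by (induction as) (simp_all add: cls_one cls_mult)

lemma cls_finsum:
  assumes "finite S" "\<And>s. s \<in> S \<Longrightarrow> g s \<in> carrier (qmat n q)"
  shows "finsum (qmat n q) g S \<in> carrier (qmat n q) \<and> cls (finsum (qmat n q) g S) = (\<Sum>s\<in>S. cls (g s))"
  using assms
proof (induction S rule: finite_induct)
  case (insert s S)
  then have "g \<in> S \<rightarrow> carrier (qmat n q)" "g s \<in> carrier (qmat n q)" by auto
  then show ?case using insert by (simp add: cls_add)
qed (simp add: cls_zero)

lemma cls_qminor:
  assumes "q \<noteq> 1" "q \<noteq> - 1" and I: "I \<subseteq> {1..n}" and J: "J \<subseteq> {1..n}" and card: "card I = card J"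
  shows "qminor n q I J \<in> carrier (qmat n q) \<and>
    cls (qminor n q I J) = quantum_parameter.qdet (k_of q) X (sorted_list_of_set I) J"
proof -
  interpret quantum_matrix "k_of q" "k_of (inverse q)" X by (rule quantum_matrix_X[OF assms(1,2)])
  let ?is = "sorted_list_of_set I" and ?js = "sorted_list_of_set J"
  have fin: "finite I" "finite J" using I J finite_subset by auto
  have entry: "qX n q (?is ! a) (?js ! \<sigma> a) \<in> carrier (qmat n q) \<and> cls (qX n q (?is ! a) (?js ! \<sigma> a)) = X (?is ! a) (?js ! \<sigma> a)"
    if "\<sigma> permutes {..<card I}" "a < card I" for \<sigma> a
  proof (rule cls_qX)
    have "\<sigma> a < card J" using permutes_in_image[OF that(1), of a] that(2) card by simp
    then have "?js ! \<sigma> a \<in> J" "?is ! a \<in> I"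
      using fin that(2) nth_mem[of "\<sigma> a" ?js] nth_mem[of a ?is] by auto
    then show "?is ! a \<in> {1..n}" "?js ! \<sigma> a \<in> {1..n}" using I J by auto
  qed
  define T where "T \<sigma> = qmat_proj n q (fa_const ((- q) ^ num_inversions (card I) \<sigma>)) \<otimes>\<^bsub>qmat n q\<^esub>
        foldr (\<lambda>a y. qX n q (?is ! a) (?js ! \<sigma> a) \<otimes>\<^bsub>qmat n q\<^esub> y) [0..<card I] \<one>\<^bsub>qmat n q\<^esub>" for \<sigma>
  have T: "T \<sigma> \<in> carrier (qmat n q) \<and> cls (T \<sigma>) = (- k_of q) ^ num_inversions (card I) \<sigma> *
      foldr (\<lambda>a y. X (?is ! a) (?js ! \<sigma> a) * y) [0..<card I] 1"
    if \<sigma>: "\<sigma> permutes {..<card I}" for \<sigma>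
  proof -
    have fold: "foldr (\<lambda>a y. qX n q (?is ! a) (?js ! \<sigma> a) \<otimes>\<^bsub>qmat n q\<^esub> y) [0..<card I] \<one>\<^bsub>qmat n q\<^esub> \<in> carrier (qmat n q)"
      "cls (foldr (\<lambda>a y. qX n q (?is ! a) (?js ! \<sigma> a) \<otimes>\<^bsub>qmat n q\<^esub> y) [0..<card I] \<one>\<^bsub>qmat n q\<^esub>) =
        foldr (\<lambda>a y. cls (qX n q (?is ! a) (?js ! \<sigma> a)) * y) [0..<card I] 1"
      using cls_foldr[of "[0..<card I]" "\<lambda>a. qX n q (?is ! a) (?js ! \<sigma> a)"] entry[OF \<sigma>] by auto
    have const: "qmat_proj n q (fa_const c) \<in> carrier (qmat n q)" "cls (qmat_proj n q (fa_const c)) = k_of c" for c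
      using proj_closed[OF fa_const_carrier, of c] by (simp_all add: k_of_def pr_def)
    have "foldr (\<lambda>a y. cls (qX n q (?is ! a) (?js ! \<sigma> a)) * y) [0..<card I] 1 =
        foldr (\<lambda>a y. X (?is ! a) (?js ! \<sigma> a) * y) [0..<card I] 1"
      using entry[OF \<sigma>] by (intro foldr_cong) auto
    then show ?thesis
      using fold const by (simp add: T_def cls_mult k_of_power k_of_minus)
  qed
  have "qminor n q I J = finsum (qmat n q) T {\<sigma>. \<sigma> permutes {..<card I}}"
    by (simp add: qminor_def T_def[abs_def])
  then show ?thesis
    using cls_finsum[of "{\<sigma>. \<sigma> permutes {..<card I}}" T] T finite_permutations[of "{..<card I}"]
      qdet_permutes[OF fin card, of X]
    by simp
qed

text \<open>Positions count from 0: if the entry of \<open>I\<close> at position \<open>m\<close> is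
  below \<open>r ! m\<close>, so are the \<open>m + 1\<close> entries up to it. This turns the
  entrywise order into the counting form of \<open>exceeds\<close>.\<close>

lemma index_le_exceeds:
  assumes r: "sorted_wrt (<) r" and "length r = length c" and I: "finite I" "card I \<le> length r"
    and not_le: "\<not> index_le (set (take (card I) r)) I"
  shows "\<exists>m<length r. m < card {i \<in> I. i < r ! m}"
proof -
  let ?t = "take (card I) r" and ?is = "sorted_list_of_set I"
  have t: "sorted_wrt (<) ?t" using r by (rule sorted_wrt_take)
  have "sorted_list_of_set (set ?t) = ?t"
    using t by (simp add: strict_sorted_iff sorted_list_of_set.idem_if_sorted_distinct)
  moreover have "card (set ?t) = card I"
    using t I(2) by (simp add: strict_sorted_iff distinct_card)
  ultimately obtain m where m: "m < card I" "?is ! m < r ! m"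
    using not_le by (auto simp: index_le_def not_le)
  have "(!) ?is ` {..m} \<subseteq> {i \<in> I. i < r ! m}"
  proof
    fix y assume "y \<in> (!) ?is ` {..m}"
    then obtain k where k: "k \<le> m" "y = ?is ! k" by auto
    have "?is ! k \<le> ?is ! m" using k(1) m(1) I(1) by (intro sorted_nth_mono) auto
    moreover have "?is ! k \<in> I" using k(1) m(1) I(1) nth_mem[of k ?is] by auto
    ultimately show "y \<in> {i \<in> I. i < r ! m}" using m(2) k(2) by simp
  qed
  moreover have "inj_on ((!) ?is) {..m}"
    using m(1) I(1) by (intro inj_on_nth) auto
  ultimately have "card {..m} \<le> card {i \<in> I. i < r ! m}"
    using card_mono[of "{i \<in> I. i < r ! m}" "(!) ?is ` {..m}"] I(1) by (simp add: card_image)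
  then show ?thesis using m(1) I(2) by (intro exI[of _ m]) simp
qed

lemma echelon_stratum:
  assumes q: "q \<noteq> 1" "q \<noteq> - 1" and ech: "quantum_parameter.echelon (k_of q) X r c"
  shows "(r, c) \<in> RC n \<and> K_ideal n q r c \<subseteq> P \<and> P \<inter> D_set n q r c = {}"
proof (intro conjI)
  interpret quantum_matrix "k_of q" "k_of (inverse q)" X by (rule quantum_matrix_X[OF q])
  have r: "sorted_wrt (<) r" and c: "sorted_wrt (<) c" and len: "length r = length c"
    and rX: "\<And>i. i \<in> set r \<Longrightarrow> \<exists>j. X i j \<noteq> 0" and cX: "\<And>j. j \<in> set c \<Longrightarrow> \<exists>i. X i j \<noteq> 0"
    and reg: "\<And>l. l \<le> length r \<Longrightarrow> lreg (qdet X (take l r) (set (take l c)))"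
    and zero: "\<And>is J. sorted_wrt (<) is \<Longrightarrow> exceeds r c is J \<Longrightarrow> qdet X is J = 0"
    using ech unfolding echelon_def by blast+
  have rn: "set r \<subseteq> {1..n}" and cn: "set c \<subseteq> {1..n}"
    using rX cX by (force simp: X_def split: if_splits)+
  then show "(r, c) \<in> RC n" using r c len by (simp add: RC_def)
  show "K_ideal n q r c \<subseteq> P"
    unfolding K_ideal_def
  proof (rule A.genideal_minimal[OF P], clarify)
    fix I J assume I: "I \<subseteq> {1..n}" and J: "J \<subseteq> {1..n}" and card: "card I = card J"
      and cond: "card I > length r \<or> card I \<le> length r \<and> \<not> index_le (set (take (card I) r)) I
         \<or> card I \<le> length r \<and> \<not> index_le (set (take (card I) c)) J"
    have fin: "finite I" "finite J" using I J finite_subset by auto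
    have "exceeds r c (sorted_list_of_set I) J"
      unfolding exceeds_def
      using cond index_le_exceeds[OF r len fin(1)] index_le_exceeds[OF c len[symmetric] fin(2)] fin card len
      by auto
    then have "cls (qminor n q I J) = 0"
      using cls_qminor[OF q I J card] zero[of "sorted_list_of_set I" J] by simp
    then show "qminor n q I J \<in> P"
      using cls_qminor[OF q I J card] cls_zero_iff by blast
  qed
  \<comment> \<open>\<open>D_set\<close> is an intersection of submonoids, so a single one that
    contains the generators and misses \<open>P\<close> suffices. Elements of \<open>P\<close> have
    class 0, which is not left regular.\<close>
  define S where "S = {y \<in> carrier (qmat n q). lreg (cls y)}"
  have "submonoid S (qmat n q)"
    by (rule submonoid.intro) (auto simp: S_def cls_mult cls_one intro: lreg_mult lreg_one)
  moreover have "qminor n q (set (take l r)) (set (take l c)) \<in> S" if "l \<in> {1..length r}" for l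
  proof -
    have sub: "set (take l r) \<subseteq> {1..n}" "set (take l c) \<subseteq> {1..n}"
      using rn cn set_take_subset[of l r] set_take_subset[of l c] by auto
    have t: "sorted_wrt (<) (take l r)" "sorted_wrt (<) (take l c)" using r c by (auto intro: sorted_wrt_take)
    then have "card (set (take l r)) = card (set (take l c))"
      using len by (simp add: strict_sorted_iff distinct_card)
    moreover have "sorted_list_of_set (set (take l r)) = take l r"
      using t(1) by (simp add: strict_sorted_iff sorted_list_of_set.idem_if_sorted_distinct)
    ultimately show ?thesis
      using cls_qminor[OF q sub] reg[of l] that by (simp add: S_def)
  qed
  ultimately have "D_set n q r c \<subseteq> S" unfolding D_set_def by blast
  moreover have "y \<notin> S" if "y \<in> P" for y
    using that cls_zero_iff[of y] lreg_nonzero[of "cls y"] by (auto simp: S_def)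
  ultimately show "P \<inter> D_set n q r c = {}" by blast
qed

lemma stratum_domain:
  assumes q: "q \<noteq> 1" "q \<noteq> - 1" and dom: "nc_domain (qmat n q Quot P)"
  shows "\<exists>(r, c)\<in>RC n. K_ideal n q r c \<subseteq> P \<and> P \<inter> D_set n q r c = {}"
proof -
  interpret quantum_matrix "k_of q" "k_of (inverse q)" X by (rule quantum_matrix_X[OF q])
  have "u = 0 \<or> v = 0" if "u * v = 0" for u v :: 'b
  proof -
    obtain a b where ab: "a \<in> carrier (qmat n q Quot P)" "b \<in> carrier (qmat n q Quot P)" "f a = u" "f b = v"
      using f_surj by meson
    then have "f (a \<otimes>\<^bsub>qmat n q Quot P\<^esub> b) = 0" using that f_mult by simp
    then have "a \<otimes>\<^bsub>qmat n q Quot P\<^esub> b = \<zero>\<^bsub>qmat n q Quot P\<^esub>"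
      using f_zero_iff ring.ring_simprules(5)[OF ring_R] ab by blast
    then have "a = \<zero>\<^bsub>qmat n q Quot P\<^esub> \<or> b = \<zero>\<^bsub>qmat n q Quot P\<^esub>"
      using dom ab(1,2) unfolding nc_domain_def by blast
    then show ?thesis using ab(3,4) f_zero by blast
  qed
  then obtain r c where "echelon X r c"
    using echelon_domain[OF _ quantum_matrix_axioms finite_X] by blast
  then show ?thesis using echelon_stratum[OF q] by blast
qed

lemma stratum_prime:
  assumes root: "\<And>m. m \<ge> 1 \<Longrightarrow> q ^ m \<noteq> 1" and prime: "prime_ideal P (qmat n q)"
  shows "\<exists>(r, c)\<in>RC n. K_ideal n q r c \<subseteq> P \<and> P \<inter> D_set n q r c = {}"
proof -
  have q: "q \<noteq> 1" "q \<noteq> - 1" using root[of 1] root[of 2] by auto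
  interpret quantum_matrix "k_of q" "k_of (inverse q)" X by (rule quantum_matrix_X[OF q])
  have "\<exists>rs cs. echelon X rs cs"
  proof (rule echelon_prime[OF _ _ _ quantum_matrix_axioms finite_X])
    fix u v :: 'b assume zero: "\<And>y. u * y * v = 0"
    obtain a b where ab: "a \<in> carrier (qmat n q)" "b \<in> carrier (qmat n q)" "cls a = u" "cls b = v"
      using cls_surj by metis
    have "a \<otimes>\<^bsub>qmat n q\<^esub> d \<otimes>\<^bsub>qmat n q\<^esub> b \<in> P" if "d \<in> carrier (qmat n q)" for d
    proof -
      have "cls (a \<otimes>\<^bsub>qmat n q\<^esub> d \<otimes>\<^bsub>qmat n q\<^esub> b) = 0"
        using zero[of "cls d"] ab that by (simp add: cls_mult)
      then show ?thesis using cls_zero_iff ab that by simp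
    qed
    then have "a \<in> P \<or> b \<in> P"
      using prime_ideal_elementwise[OF A.ring_axioms prime ab(1,2)] by blast
    then show "u = 0 \<or> v = 0" using cls_zero_iff ab by blast
  next
    fix H :: "nat \<Rightarrow> 'b set"
    assume H: "\<And>n. right_ideal (H n)" "\<And>n. H n \<subseteq> H (Suc n)"
    have "right_ideal_in UNIV (H n)" for n
      using H(1)[of n] by (simp add: right_ideal_def right_ideal_in_def)
    then show "\<exists>K. \<forall>n\<ge>K. H n = H K"
      using right_noetherianD[OF noetherian[OF q], of H] H(2) by metis
  next
    fix m :: nat
    have "q ^ (2 * Suc m) - 1 \<noteq> 0" using root[of "2 * Suc m"] by simp
    from k_of_inverse[OF this] show "\<exists>w. w * (k_of q ^ (2 * Suc m) - 1) = 1"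
      by (metis k_of_central k_of_diff k_of_power k_of_one)
  next
    fix N :: "'b set" and y b
    assume N: "right_ideal N" "\<And>i j b. b \<in> N \<Longrightarrow> X i j * b \<in> N" and b: "b \<in> N"
    define G where "G = range k_of \<union> range (\<lambda>(i, j). X i j)"
    have "alg G = UNIV"
      by (rule alg_UNIV) (auto simp: G_def intro!: alg.base)
    then have "y \<in> alg G" by simp
    \<comment> \<open>Left multiplication by a central scalar is right multiplication, under which
      \<open>N\<close> is closed. Quantifying over \<open>b\<close> lets the closure properties of
      two factors be composed.\<close>
    then have "\<forall>b\<in>N. y * b \<in> N"
    proof induction
      case (base g)
      then consider d where "g = k_of d" | i j where "g = X i j" by (auto simp: G_def)
      then show ?case
      proof cases
        case 1
        have "g * b = b * g" for b using k_of_central[of b d] 1 by simp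
        then show ?thesis using N(1) by (simp add: right_ideal_def)
      next
        case 2
        then show ?thesis using N(2) by simp
      qed
    next
      case (add u v)
      then show ?case using N(1) by (simp add: right_ideal_def distrib_right)
    next
      case (mult u v)
      then show ?case by (simp add: mult.assoc)
    qed
    then show "y * b \<in> N" using b by blast
  qed
  then show ?thesis using echelon_stratum[OF q] by blast
qed

end

section \<open>Existence and uniqueness of the stratum\<close>

definition has_stratum :: "nat \<Rightarrow> 'k::field \<Rightarrow> ((nat \<times> nat) word \<Rightarrow>\<^sub>0 'k) set set \<Rightarrow> bool" where
  "has_stratum n q P \<longleftrightarrow> (\<exists>(r, c)\<in>RC n. K_ideal n q r c \<subseteq> P \<and> P \<inter> D_set n q r c = {})"

text \<open>Completely prime and prime ideals share one predicate, so that one choice of a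
  counterexample, and hence one type, serves both halves of the theorem.\<close>

definition stratifiable :: "nat \<Rightarrow> 'k::field \<Rightarrow> ((nat \<times> nat) word \<Rightarrow>\<^sub>0 'k) set set \<Rightarrow> bool" where
  "stratifiable n q P \<longleftrightarrow> q \<noteq> 0 \<and> ideal P (qmat n q) \<and> P \<noteq> carrier (qmat n q) \<and>
     (q \<noteq> 1 \<and> q \<noteq> - 1 \<and> nc_domain (qmat n q Quot P) \<or>
      (\<forall>m\<ge>1. q ^ m \<noteq> 1) \<and> prime_ideal P (qmat n q))"

definition exceptional_quotient :: "((nat \<times> nat) word \<Rightarrow>\<^sub>0 'k::field) set set ring \<Rightarrow> bool" where
  "exceptional_quotient R \<longleftrightarrow> (\<exists>n q P. R = qmat n q Quot P \<and> stratifiable n q P \<and> \<not> has_stratum n q P)"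

text \<open>The field with two elements. It is realised on \<open>{}\<close> and
  \<open>UNIV\<close>, which are distinct over every type, because the elements of a quotient ring
  are sets.\<close>

definition boolean_ring :: "'a set ring" where
  "boolean_ring = \<lparr>carrier = {{}, UNIV}, monoid.mult = (\<inter>), one = UNIV, zero = {},
     add = (\<lambda>A B. if A = B then {} else UNIV)\<rparr>"

lemma ring_boolean_ring: "ring (boolean_ring :: 'a set ring)"
proof (rule ringI)
  show "abelian_group (boolean_ring :: 'a set ring)"
  proof (rule abelian_groupI)
    fix A assume "A \<in> carrier (boolean_ring :: 'a set ring)"
    then show "\<exists>B\<in>carrier boolean_ring. B \<oplus>\<^bsub>boolean_ring\<^esub> A = \<zero>\<^bsub>boolean_ring\<^esub>"
      by (intro bexI[of _ A]) (auto simp: boolean_ring_def)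
  qed (auto simp: boolean_ring_def)
  show "monoid (boolean_ring :: 'a set ring)"
    by (rule monoidI) (auto simp: boolean_ring_def)
qed (auto simp: boolean_ring_def)

text \<open>
  A ring with carrier set is turned into a type of class \<^class>\<open>ring_1\<close>.  The ring cannot depend
  on \<open>n\<close>, \<open>q\<close> and \<open>P\<close>, so a counterexample to the existence of a stratum is chosen, if
  there is one.  The Boolean ring serves to make the type well defined in any case.
\<close>

definition chosen_quotient :: "((nat \<times> nat) word \<Rightarrow>\<^sub>0 'k::field) set set ring" where
  "chosen_quotient = (if \<exists>R :: ((nat \<times> nat) word \<Rightarrow>\<^sub>0 'k) set set ring. exceptional_quotient R
     then SOME R. exceptional_quotient R else boolean_ring)"

lemma exceptional_chosen:
  fixes R :: "((nat \<times> nat) word \<Rightarrow>\<^sub>0 'k::field) set set ring"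
  assumes "exceptional_quotient R"
  shows "exceptional_quotient (chosen_quotient :: ((nat \<times> nat) word \<Rightarrow>\<^sub>0 'k) set set ring)"
  using assms unfolding chosen_quotient_def by (auto intro: someI)

lemma chosen_quotient:
  "ring (chosen_quotient :: ((nat \<times> nat) word \<Rightarrow>\<^sub>0 'k::field) set set ring) \<and>
   \<one>\<^bsub>chosen_quotient :: ((nat \<times> nat) word \<Rightarrow>\<^sub>0 'k) set set ring\<^esub> \<noteq> \<zero>\<^bsub>chosen_quotient\<^esub>"
  proof (cases "\<exists>R :: ((nat \<times> nat) word \<Rightarrow>\<^sub>0 'k) set set ring. exceptional_quotient R")
    case True
    then have "exceptional_quotient (chosen_quotient :: ((nat \<times> nat) word \<Rightarrow>\<^sub>0 'k) set set ring)"
      using exceptional_chosen by blast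
    then obtain n P and q :: 'k where R: "chosen_quotient = qmat n q Quot P" and P: "ideal P (qmat n q)" "P \<noteq> carrier (qmat n q)"
      unfolding exceptional_quotient_def stratifiable_def by blast
    interpret P: ideal P "qmat n q" by (rule P(1))
    have "\<one>\<^bsub>qmat n q\<^esub> \<notin> P" using P.one_imp_carrier P(2) by blast
    then have "P +>\<^bsub>qmat n q\<^esub> \<one>\<^bsub>qmat n q\<^esub> \<noteq> P"
      using P.rcos_const_imp_mem by blast
    then have "\<one>\<^bsub>qmat n q Quot P\<^esub> \<noteq> \<zero>\<^bsub>qmat n q Quot P\<^esub>" by (simp add: FactRing_def)
    then show ?thesis unfolding R using P.quotient_is_ring by blast
  next
    case False
    then have R: "chosen_quotient = (boolean_ring :: ((nat \<times> nat) word \<Rightarrow>\<^sub>0 'k) set set ring)"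
      by (simp add: chosen_quotient_def)
    show ?thesis unfolding R using ring_boolean_ring by (simp add: boolean_ring_def)
  qed

lemmas chosen_quotient_ring = chosen_quotient[THEN conjunct1]

section \<open>The chosen quotient as a type\<close>

typedef (overloaded) 'k quotient_algebra =
  "carrier (chosen_quotient :: ((nat \<times> nat) word \<Rightarrow>\<^sub>0 'k::field) set set ring)"
  using ring.ring_simprules(2)[OF chosen_quotient_ring] by blast

setup_lifting type_definition_quotient_algebra

instantiation quotient_algebra :: (field) ring_1
begin

lift_definition zero_quotient_algebra :: "'a quotient_algebra" is "\<zero>\<^bsub>chosen_quotient\<^esub>"
  by (rule ring.ring_simprules(2)[OF chosen_quotient_ring])

lift_definition one_quotient_algebra :: "'a quotient_algebra" is "\<one>\<^bsub>chosen_quotient\<^esub>"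
  by (rule ring.ring_simprules(6)[OF chosen_quotient_ring])

lift_definition plus_quotient_algebra :: "'a quotient_algebra \<Rightarrow> 'a quotient_algebra \<Rightarrow> 'a quotient_algebra"
  is "add chosen_quotient"
  by (rule ring.ring_simprules(1)[OF chosen_quotient_ring])

lift_definition times_quotient_algebra :: "'a quotient_algebra \<Rightarrow> 'a quotient_algebra \<Rightarrow> 'a quotient_algebra"
  is "monoid.mult chosen_quotient"
  by (rule ring.ring_simprules(5)[OF chosen_quotient_ring])

lift_definition uminus_quotient_algebra :: "'a quotient_algebra \<Rightarrow> 'a quotient_algebra"
  is "a_inv chosen_quotient"
  by (rule ring.ring_simprules(3)[OF chosen_quotient_ring])

lift_definition minus_quotient_algebra :: "'a quotient_algebra \<Rightarrow> 'a quotient_algebra \<Rightarrow> 'a quotient_algebra"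
  is "a_minus chosen_quotient"
  by (rule ring.ring_simprules(4)[OF chosen_quotient_ring])

instance
proof
  interpret ring "chosen_quotient :: ((nat \<times> nat) word \<Rightarrow>\<^sub>0 'a) set set ring" by (rule chosen_quotient_ring)
  fix a b c :: "'a quotient_algebra"
  show "a + b + c = a + (b + c)" by transfer (rule a_assoc)
  show "a + b = b + a" by transfer (rule a_comm)
  show "0 + a = a" by transfer (rule l_zero)
  show "- a + a = 0" by transfer (rule l_neg)
  show "a - b = a + - b" by transfer (simp add: a_minus_def)
  show "a * b * c = a * (b * c)" by transfer (rule m_assoc)
  show "1 * a = a" by transfer (rule l_one)
  show "a * 1 = a" by transfer (rule r_one)
  show "(a + b) * c = a * c + b * c" by transfer (rule l_distr)
  show "a * (b + c) = a * b + a * c" by transfer (rule r_distr)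
  show "(0 :: 'a quotient_algebra) \<noteq> 1" by transfer (rule chosen_quotient[THEN conjunct2, symmetric])
qed

end

lemma ring_copy_quotient_algebra:
  "ring_copy (chosen_quotient :: ((nat \<times> nat) word \<Rightarrow>\<^sub>0 'k::field) set set ring) Abs_quotient_algebra"
proof (rule ring_copy.intro)
  let ?R = "chosen_quotient :: ((nat \<times> nat) word \<Rightarrow>\<^sub>0 'k) set set ring"
  interpret ring ?R by (rule chosen_quotient_ring)
  show "ring ?R" by (rule chosen_quotient_ring)
  show "bij_betw Abs_quotient_algebra (carrier ?R) UNIV"
    by (rule bij_betwI[of _ _ _ Rep_quotient_algebra])
      (auto simp: Rep_quotient_algebra Rep_quotient_algebra_inverse Abs_quotient_algebra_inverse)
  show "Abs_quotient_algebra (a \<otimes>\<^bsub>?R\<^esub> b) = Abs_quotient_algebra a * Abs_quotient_algebra b"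
    if "a \<in> carrier ?R" "b \<in> carrier ?R" for a b
    using that by (simp add: times_quotient_algebra.abs_eq eq_onp_def)
  show "Abs_quotient_algebra (a \<oplus>\<^bsub>?R\<^esub> b) = Abs_quotient_algebra a + Abs_quotient_algebra b"
    if "a \<in> carrier ?R" "b \<in> carrier ?R" for a b
    using that by (simp add: plus_quotient_algebra.abs_eq eq_onp_def)
  show "Abs_quotient_algebra \<one>\<^bsub>?R\<^esub> = 1"
    by (simp add: one_quotient_algebra_def)
qed

lemma stratum_exists:
  fixes q :: "'k::field"
  assumes "stratifiable n q P"
  shows "has_stratum n q P"
proof (rule ccontr)
  assume "\<not> has_stratum n q P"
  then have "exceptional_quotient (qmat n q Quot P)"
    using assms unfolding exceptional_quotient_def by blast
  then have "exceptional_quotient (chosen_quotient :: ((nat \<times> nat) word \<Rightarrow>\<^sub>0 'k) set set ring)"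
    by (rule exceptional_chosen)
  \<comment> \<open>The chosen ring may come from another triple than \<open>n\<close>,
    \<open>q\<close>, \<open>P\<close>; that triple lacks a stratum too, and it is the one
    refuted.\<close>
  then obtain n' P' and q' :: 'k where R: "chosen_quotient = qmat n' q' Quot P'"
    and strat: "stratifiable n' q' P'" and no: "\<not> has_stratum n' q' P'"
    unfolding exceptional_quotient_def by blast
  interpret qmat_quotient n' q' P' Abs_quotient_algebra
    using ring_copy_quotient_algebra[where 'k = 'k] strat
    unfolding R qmat_quotient_def qmat_quotient_axioms_def stratifiable_def by blast
  have "has_stratum n' q' P'"
    using strat stratum_domain stratum_prime unfolding stratifiable_def has_stratum_def by blast
  with no show False by blast
qed

section \<open>Comparison of two strata\<close>

lemma qminor_in_K_ideal:
  assumes "I \<subseteq> {1..n}" "J \<subseteq> {1..n}" "card I = card J"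
    and "card I > length r \<or> card I \<le> length r \<and> \<not> index_le (set (take (card I) r)) I
         \<or> card I \<le> length r \<and> \<not> index_le (set (take (card I) c)) J"
  shows "qminor n q I J \<in> K_ideal n q r c"
proof -
  have sub: "S \<subseteq> Idl\<^bsub>qmat n q\<^esub> S" for S
    by (auto simp: genideal_def)
  show ?thesis
    unfolding K_ideal_def by (rule subsetD[OF sub]) (use assms in blast)
qed

text \<open>The leading minors of \<open>(r, c)\<close> lie in \<open>D_set\<close> and hence
  outside \<open>P\<close>, so none of them is a generator of the ideal of \<open>(r', c')\<close>.
  For the largest one, of size \<open>length r\<close>, this yields the bound on the length and all
  entrywise inequalities.\<close>

lemma stratum_le:
  assumes rc: "(r, c) \<in> RC n" "(r', c') \<in> RC n"
    and K: "K_ideal n q r' c' \<subseteq> P" and D: "P \<inter> D_set n q r c = {}"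
  shows "length r \<le> length r' \<and> (\<forall>m<length r. r' ! m \<le> r ! m \<and> c' ! m \<le> c ! m)"
proof -
  have srt: "sorted_wrt (<) r" "sorted_wrt (<) c" "sorted_wrt (<) r'" "sorted_wrt (<) c'"
    and len: "length r = length c" "length r' = length c'"
    and sub: "set r \<subseteq> {1..n}" "set c \<subseteq> {1..n}"
    using rc by (auto simp: RC_def)
  have card: "card (set (take l s)) = min l (length s)"
    and list: "sorted_list_of_set (set (take l s)) = take l s" if "sorted_wrt (<) s" for l and s :: "nat list"
    using sorted_wrt_take[OF that, of l]
    by (simp_all add: strict_sorted_iff distinct_card sorted_list_of_set.idem_if_sorted_distinct min.commute)
  have not_P: "qminor n q (set (take l r)) (set (take l c)) \<notin> P" if "l \<in> {1..length r}" for l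
  proof -
    have "qminor n q (set (take l r)) (set (take l c)) \<in> D_set n q r c"
      using that unfolding D_set_def by blast
    then show ?thesis using D by blast
  qed
  have bound: "card (set (take l r)) \<le> length r' \<and>
      index_le (set (take (card (set (take l r))) r')) (set (take l r)) \<and>
      index_le (set (take (card (set (take l r))) c')) (set (take l c))"
    if l: "l \<in> {1..length r}" for l
  proof (rule ccontr)
    assume neg: "\<not> ?thesis"
    have "set (take l r) \<subseteq> {1..n}" "set (take l c) \<subseteq> {1..n}"
      using sub set_take_subset[of l r] set_take_subset[of l c] by auto
    moreover have "card (set (take l r)) = card (set (take l c))"
      using card[OF srt(1)] card[OF srt(2)] len by simp
    ultimately have "qminor n q (set (take l r)) (set (take l c)) \<in> K_ideal n q r' c'"
      using neg by (intro qminor_in_K_ideal) linarith+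
    then show False using not_P[OF l] K by blast
  qed
  have "length r \<le> length r'"
  proof (cases "length r = 0")
    case False
    then have "length r \<in> {1..length r}" unfolding atLeastAtMost_iff by linarith
    from bound[OF this] show ?thesis using card[OF srt(1), of "length r"] by simp
  qed simp
  moreover have "r' ! m \<le> r ! m \<and> c' ! m \<le> c ! m" if m: "m < length r" for m
  proof -
    have "card (set (take (length r) r)) = length r" using card[OF srt(1), of "length r"] by simp
    then have "index_le (set (take (length r) r')) (set (take (length r) r))"
      "index_le (set (take (length r) c')) (set (take (length r) c))"
      using bound[of "length r"] m by auto
    moreover have "sorted_list_of_set (set r) = r" "sorted_list_of_set (set c) = c"
      using list[OF srt(1), of "length r"] list[OF srt(2), of "length c"] by simp_all
    ultimately show ?thesis
      using m len \<open>length r \<le> length r'\<close>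
      unfolding index_le_def by (simp add: list[OF srt(3)] list[OF srt(4)] card[OF srt(3)] card[OF srt(4)])
  qed
  ultimately show ?thesis by blast
qed

lemma stratum_unique:
  assumes "(r, c) \<in> RC n" "(r', c') \<in> RC n"
    and "K_ideal n q r c \<subseteq> P" "P \<inter> D_set n q r c = {}"
    and "K_ideal n q r' c' \<subseteq> P" "P \<inter> D_set n q r' c' = {}"
  shows "(r, c) = (r', c')"
proof -
  have "length r = length c" "length r' = length c'" using assms(1,2) by (auto simp: RC_def)
  moreover note stratum_le[OF assms(1,2,5,4)] stratum_le[OF assms(2,1,3,6)]
  ultimately show ?thesis by (auto intro!: nth_equalityI antisym)
qed

theorem corollary1p10:
  fixes q :: "'k::field" and n :: nat
  assumes "n \<ge> 1" and "q \<noteq> 0"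
  shows
    "(q \<noteq> 1 \<and> q \<noteq> - 1 \<longrightarrow>
        (\<forall>P \<in> ring_spec (qmat n q). completely_prime P (qmat n q) \<longrightarrow>
          (\<exists>!(r, c). (r, c) \<in> RC n \<and> K_ideal n q r c \<subseteq> P \<and> P \<inter> D_set n q r c = {})))
     \<and>
     ((\<forall>m::nat. m \<ge> 1 \<longrightarrow> q ^ m \<noteq> 1) \<longrightarrow>
        ring_spec (qmat n q) = (\<Union>(r, c)\<in>RC n. spec_rc n q r c) \<and>
        disjoint_family_on (\<lambda>(r, c). spec_rc n q r c) (RC n))"
proof (intro conjI impI ballI)
  fix P assume q: "q \<noteq> 1 \<and> q \<noteq> - 1" and "P \<in> ring_spec (qmat n q)" "completely_prime P (qmat n q)"
  then have "stratifiable n q P"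
    using assms(2) by (simp add: stratifiable_def ring_spec_def prime_ideal_def completely_prime_def)
  then obtain r c where rc: "(r, c) \<in> RC n" "K_ideal n q r c \<subseteq> P" "P \<inter> D_set n q r c = {}"
    using stratum_exists unfolding has_stratum_def by blast
  show "\<exists>!(r, c). (r, c) \<in> RC n \<and> K_ideal n q r c \<subseteq> P \<and> P \<inter> D_set n q r c = {}"
  proof (rule ex1I[of _ "(r, c)"])
    fix s assume "case s of (r, c) \<Rightarrow> (r, c) \<in> RC n \<and> K_ideal n q r c \<subseteq> P \<and> P \<inter> D_set n q r c = {}"
    moreover obtain a b where "s = (a, b)" by (cases s)
    ultimately show "s = (r, c)" using stratum_unique[OF _ rc(1) _ _ rc(2,3), of a b] by simp
  qed (use rc in simp)
next
  assume root: "\<forall>m::nat. m \<ge> 1 \<longrightarrow> q ^ m \<noteq> 1"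
  show "ring_spec (qmat n q) = (\<Union>(r, c)\<in>RC n. spec_rc n q r c)"
  proof
    show "ring_spec (qmat n q) \<subseteq> (\<Union>(r, c)\<in>RC n. spec_rc n q r c)"
    proof
      fix P assume P: "P \<in> ring_spec (qmat n q)"
      then have "stratifiable n q P"
        using assms(2) root by (simp add: stratifiable_def ring_spec_def) (simp add: prime_ideal_def)
      then obtain r c where "(r, c) \<in> RC n" "K_ideal n q r c \<subseteq> P" "P \<inter> D_set n q r c = {}"
        using stratum_exists unfolding has_stratum_def by blast
      then show "P \<in> (\<Union>(r, c)\<in>RC n. spec_rc n q r c)"
        using P by (intro UN_I[of "(r, c)"]) (simp_all add: spec_rc_def)
    qed
  qed (auto simp: spec_rc_def)
  show "disjoint_family_on (\<lambda>(r, c). spec_rc n q r c) (RC n)"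
    unfolding disjoint_family_on_def
  proof (intro ballI impI)
    fix s t assume st: "s \<in> RC n" "t \<in> RC n" "s \<noteq> t"
    obtain r c r' c' where eq: "s = (r, c)" "t = (r', c')" by (cases s, cases t)
    have "P \<notin> spec_rc n q r' c'" if "P \<in> spec_rc n q r c" for P
      using that stratum_unique[of r c n r' c' q P] st unfolding eq spec_rc_def by blast
    then show "(case s of (r, c) \<Rightarrow> spec_rc n q r c) \<inter> (case t of (r, c) \<Rightarrow> spec_rc n q r c) = {}"
      unfolding eq by auto
  qed
qed

end
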